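(* Let $f$ be a strongly extensional mapping of a complete metric space $X$ into a metric space $(Y,\rho)$, and let $(x_n)_{n\geqslant 1}$ be a sequence in $X$ converging to a limit $x \in X$. Then for every real $\beta > 0$, either $\rho(f(x_n),f(x)) < \beta$ eventually (there is $N$ such that the inequality holds for all $n \geqslant N$), or $\rho(f(x_n),f(x)) \geqslant \beta$ infinitely often (for every $N$ there is $n \geqslant N$ such that the inequality holds).
   Context: The setting is Bishop-style constructive mathematics: intuitionistic logic (no law of excluded middle), with countable and dependent choice allowed. "Either $A$ or $B$" is the constructive disjunction $A \lor B$. In a metric space, $x \neq y$ means that the distance between $x$ and $y$ is $>0$. A function $f:X\to Y$ between metric spaces $(X,\sigma)$ and $(Y,\rho)$ is strongly extensional if for all $x,y\in X$, $\rho(f(x),f(y))>0$ implies $\sigma(x,y)>0$. *)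

theory Defs
  imports Main
begin

text \<open>
  HOL is classical, and there a disjunction of the form "eventually or infinitely often not"
  is an instance of excluded middle.  A theorem of constructive mathematics is therefore rendered as
  derivability in a formal system for Bishop-style mathematics: many-sorted intuitionistic
  predicate logic with equality, natural numbers, the constructive real numbers, products,
  function sorts, unique choice, countable choice and dependent choice.  Excluded middle is not
  available inside the system.

  A sort stands for a set in Bishop's sense, i.e. with its own equality, and the elements of a
  function sort are the functions respecting these equalities.  The sorts \<open>SET i\<close> are
  uninterpreted and so play the role of arbitrary sets.  As usual in many-sorted logic, sorts are
  assumed to be inhabited; this is no restriction for statements that start from a point of a
  set \<open>X\<close> and a mapping from \<open>X\<close> to \<open>Y\<close>.
\<close>

section \<open>Syntax\<close>

datatype srt = NAT | REAL | SET nat | PAIR srt srt | FUN srt srt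

text \<open>A variable is a name together with its sort.\<close>

type_synonym var = "string \<times> srt"

datatype cst =
    NZero | NSuc | NAdd | NMul
  | RZero | ROne | RAdd | RMul | RNeg
  | OfNat
  | MkPair srt srt | Proj1 srt srt | Proj2 srt srt

primrec cst_srt :: "cst \<Rightarrow> srt" where
  "cst_srt NZero = NAT"
| "cst_srt NSuc = FUN NAT NAT"
| "cst_srt NAdd = FUN NAT (FUN NAT NAT)"
| "cst_srt NMul = FUN NAT (FUN NAT NAT)"
| "cst_srt RZero = REAL"
| "cst_srt ROne = REAL"
| "cst_srt RAdd = FUN REAL (FUN REAL REAL)"
| "cst_srt RMul = FUN REAL (FUN REAL REAL)"
| "cst_srt RNeg = FUN REAL REAL"
| "cst_srt OfNat = FUN NAT REAL"
| "cst_srt (MkPair s t) = FUN s (FUN t (PAIR s t))"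
| "cst_srt (Proj1 s t) = FUN (PAIR s t) s"
| "cst_srt (Proj2 s t) = FUN (PAIR s t) t"

text \<open>
  The representation is locally nameless: \<open>Fv\<close> is a free variable, \<open>Bv\<close> a de Bruijn index.
  Formulas are written with the named binders \<open>all_fm\<close> and \<open>ex_fm\<close> below, so that formulas
  differing only in the names of bound variables are equal.
\<close>

datatype tm = Fv var | Bv nat | Cst cst | App tm tm  (infixl "\<cdot>" 90)

datatype fm =
    Eq tm tm  (infix "\<^bold>=" 55)
  | Less tm tm  (infix "\<^bold><" 55)
  | Falsum  ("\<^bold>\<bottom>")
  | Conj fm fm  (infixr "\<^bold>\<and>" 45)
  | Disj fm fm  (infixr "\<^bold>\<or>" 40)
  | Imp fm fm  (infixr "\<^bold>\<longrightarrow>" 35)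
  | All srt fm
  | Ex srt fm

abbreviation Neg :: "fm \<Rightarrow> fm"  ("\<^bold>\<not> _" [50] 50) where
  "\<^bold>\<not> A \<equiv> A \<^bold>\<longrightarrow> \<^bold>\<bottom>"

primrec fv_tm :: "tm \<Rightarrow> var set" where
  "fv_tm (Fv v) = {v}"
| "fv_tm (Bv i) = {}"
| "fv_tm (Cst c) = {}"
| "fv_tm (t \<cdot> u) = fv_tm t \<union> fv_tm u"

primrec fv :: "fm \<Rightarrow> var set" where
  "fv (t \<^bold>= u) = fv_tm t \<union> fv_tm u"
| "fv (t \<^bold>< u) = fv_tm t \<union> fv_tm u"
| "fv \<^bold>\<bottom> = {}"
| "fv (A \<^bold>\<and> B) = fv A \<union> fv B"
| "fv (A \<^bold>\<or> B) = fv A \<union> fv B"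
| "fv (A \<^bold>\<longrightarrow> B) = fv A \<union> fv B"
| "fv (All s A) = fv A"
| "fv (Ex s A) = fv A"

text \<open>Substitution for a free variable.  It cannot capture, as only terms without dangling
  indices are ever substituted.\<close>

primrec subst_tm :: "var \<Rightarrow> tm \<Rightarrow> tm \<Rightarrow> tm" where
  "subst_tm v r (Fv w) = (if w = v then r else Fv w)"
| "subst_tm v r (Bv i) = Bv i"
| "subst_tm v r (Cst c) = Cst c"
| "subst_tm v r (t \<cdot> u) = subst_tm v r t \<cdot> subst_tm v r u"

primrec subst :: "var \<Rightarrow> tm \<Rightarrow> fm \<Rightarrow> fm" where
  "subst v r (t \<^bold>= u) = (subst_tm v r t \<^bold>= subst_tm v r u)"
| "subst v r (t \<^bold>< u) = (subst_tm v r t \<^bold>< subst_tm v r u)"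
| "subst v r \<^bold>\<bottom> = \<^bold>\<bottom>"
| "subst v r (A \<^bold>\<and> B) = (subst v r A \<^bold>\<and> subst v r B)"
| "subst v r (A \<^bold>\<or> B) = (subst v r A \<^bold>\<or> subst v r B)"
| "subst v r (A \<^bold>\<longrightarrow> B) = (subst v r A \<^bold>\<longrightarrow> subst v r B)"
| "subst v r (All s A) = All s (subst v r A)"
| "subst v r (Ex s A) = Ex s (subst v r A)"

text \<open>\<open>close k v\<close> turns the free variable \<open>v\<close> into the index bound \<open>k\<close> quantifiers further out.\<close>

primrec close_tm :: "nat \<Rightarrow> var \<Rightarrow> tm \<Rightarrow> tm" where
  "close_tm k v (Fv w) = (if w = v then Bv k else Fv w)"
| "close_tm k v (Bv i) = Bv i"
| "close_tm k v (Cst c) = Cst c"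
| "close_tm k v (t \<cdot> u) = close_tm k v t \<cdot> close_tm k v u"

primrec close :: "nat \<Rightarrow> var \<Rightarrow> fm \<Rightarrow> fm" where
  "close k v (t \<^bold>= u) = (close_tm k v t \<^bold>= close_tm k v u)"
| "close k v (t \<^bold>< u) = (close_tm k v t \<^bold>< close_tm k v u)"
| "close k v \<^bold>\<bottom> = \<^bold>\<bottom>"
| "close k v (A \<^bold>\<and> B) = (close k v A \<^bold>\<and> close k v B)"
| "close k v (A \<^bold>\<or> B) = (close k v A \<^bold>\<or> close k v B)"
| "close k v (A \<^bold>\<longrightarrow> B) = (close k v A \<^bold>\<longrightarrow> close k v B)"
| "close k v (All s A) = All s (close (Suc k) v A)"
| "close k v (Ex s A) = Ex s (close (Suc k) v A)"

definition all_fm :: "var \<Rightarrow> fm \<Rightarrow> fm"  ("(3\<^bold>\<forall>_./ _)" [100, 10] 10) where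
  "(\<^bold>\<forall>v. A) = All (snd v) (close 0 v A)"

definition ex_fm :: "var \<Rightarrow> fm \<Rightarrow> fm"  ("(3\<^bold>\<exists>_./ _)" [100, 10] 10) where
  "(\<^bold>\<exists>v. A) = Ex (snd v) (close 0 v A)"

text \<open>The list gives the sorts of the enclosing quantifiers, innermost first.\<close>

primrec srt_of :: "srt list \<Rightarrow> tm \<Rightarrow> srt option" where
  "srt_of \<Theta> (Fv v) = Some (snd v)"
| "srt_of \<Theta> (Bv i) = (if i < length \<Theta> then Some (\<Theta> ! i) else None)"
| "srt_of \<Theta> (Cst c) = Some (cst_srt c)"
| "srt_of \<Theta> (t \<cdot> u) =
     (case srt_of \<Theta> t of
        Some (FUN a b) \<Rightarrow> (if srt_of \<Theta> u = Some a then Some b else None)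
      | _ \<Rightarrow> None)"

primrec wff :: "srt list \<Rightarrow> fm \<Rightarrow> bool" where
  "wff \<Theta> (t \<^bold>= u) \<longleftrightarrow> srt_of \<Theta> t \<noteq> None \<and> srt_of \<Theta> u = srt_of \<Theta> t"
| "wff \<Theta> (t \<^bold>< u) \<longleftrightarrow> srt_of \<Theta> t = Some REAL \<and> srt_of \<Theta> u = Some REAL"
| "wff \<Theta> \<^bold>\<bottom> \<longleftrightarrow> True"
| "wff \<Theta> (A \<^bold>\<and> B) \<longleftrightarrow> wff \<Theta> A \<and> wff \<Theta> B"
| "wff \<Theta> (A \<^bold>\<or> B) \<longleftrightarrow> wff \<Theta> A \<and> wff \<Theta> B"
| "wff \<Theta> (A \<^bold>\<longrightarrow> B) \<longleftrightarrow> wff \<Theta> A \<and> wff \<Theta> B"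
| "wff \<Theta> (All s A) \<longleftrightarrow> wff (s # \<Theta>) A"
| "wff \<Theta> (Ex s A) \<longleftrightarrow> wff (s # \<Theta>) A"

definition Tm :: "srt \<Rightarrow> tm set" where
  "Tm s = {t. srt_of [] t = Some s}"

definition Fm :: "fm set" where
  "Fm = {A. wff [] A}"

section \<open>Notation for arithmetic and limits\<close>

text \<open>
  The formulas below bind variables with fixed names.  They are meant for argument terms
  in which these variables do not occur free, otherwise the variables would be captured.
\<close>

abbreviation nadd :: "tm \<Rightarrow> tm \<Rightarrow> tm"  (infixl "\<^bold>+\<^sub>N" 65) where
  "m \<^bold>+\<^sub>N n \<equiv> Cst NAdd \<cdot> m \<cdot> n"

abbreviation nmul :: "tm \<Rightarrow> tm \<Rightarrow> tm"  (infixl "\<^bold>*\<^sub>N" 70) where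
  "m \<^bold>*\<^sub>N n \<equiv> Cst NMul \<cdot> m \<cdot> n"

abbreviation radd :: "tm \<Rightarrow> tm \<Rightarrow> tm"  (infixl "\<^bold>+" 65) where
  "a \<^bold>+ b \<equiv> Cst RAdd \<cdot> a \<cdot> b"

abbreviation rmul :: "tm \<Rightarrow> tm \<Rightarrow> tm"  (infixl "\<^bold>*" 70) where
  "a \<^bold>* b \<equiv> Cst RMul \<cdot> a \<cdot> b"

abbreviation rneg :: "tm \<Rightarrow> tm"  ("\<^bold>- _" [81] 80) where
  "\<^bold>- a \<equiv> Cst RNeg \<cdot> a"

abbreviation rzero :: tm  ("\<^bold>0") where "\<^bold>0 \<equiv> Cst RZero"
abbreviation rone :: tm  ("\<^bold>1") where "\<^bold>1 \<equiv> Cst ROne"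

text \<open>Constructively, \<open>a \<le> b\<close> on the reals is the negation of \<open>b < a\<close>.\<close>

definition le_fm :: "tm \<Rightarrow> tm \<Rightarrow> fm"  (infix "\<^bold>\<le>" 55) where
  "(a \<^bold>\<le> b) = (\<^bold>\<not> (b \<^bold>< a))"

definition nle_fm :: "tm \<Rightarrow> tm \<Rightarrow> fm"  (infix "\<^bold>\<le>\<^sub>N" 55) where
  "(m \<^bold>\<le>\<^sub>N n) = (let k = (''k'', NAT) in \<^bold>\<exists>k. n \<^bold>= m \<^bold>+\<^sub>N Fv k)"

definition eventually_fm :: "var \<Rightarrow> fm \<Rightarrow> fm" where
  "eventually_fm n A =
     (let N = (''N'', NAT) in \<^bold>\<exists>N. \<^bold>\<forall>n. Fv N \<^bold>\<le>\<^sub>N Fv n \<^bold>\<longrightarrow> A)"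

definition infinitely_often_fm :: "var \<Rightarrow> fm \<Rightarrow> fm" where
  "infinitely_often_fm n A =
     (let N = (''N'', NAT) in \<^bold>\<forall>N. \<^bold>\<exists>n. Fv N \<^bold>\<le>\<^sub>N Fv n \<^bold>\<and> A)"

text \<open>Completeness of the reals; \<open>\<bar>a - b\<bar> < e\<close> is spelled out by two inequalities, one of which
  suffices in the Cauchy condition since it is symmetric in \<open>m\<close> and \<open>n\<close>.\<close>

definition real_complete :: fm where
  "real_complete =
     (let u = (''u'', FUN NAT REAL); l = (''l'', REAL); e = (''e'', REAL);
          m = (''m'', NAT); n = (''n'', NAT); N = (''N'', NAT) in
      \<^bold>\<forall>u. (\<^bold>\<forall>e. \<^bold>0 \<^bold>< Fv e \<^bold>\<longrightarrow>
               (\<^bold>\<exists>N. \<^bold>\<forall>m. \<^bold>\<forall>n. Fv N \<^bold>\<le>\<^sub>N Fv m \<^bold>\<and> Fv N \<^bold>\<le>\<^sub>N Fv n \<^bold>\<longrightarrow>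
                  Fv u \<cdot> Fv m \<^bold>< Fv u \<cdot> Fv n \<^bold>+ Fv e)) \<^bold>\<longrightarrow>
           (\<^bold>\<exists>l. \<^bold>\<forall>e. \<^bold>0 \<^bold>< Fv e \<^bold>\<longrightarrow>
               eventually_fm n (Fv u \<cdot> Fv n \<^bold>< Fv l \<^bold>+ Fv e \<^bold>\<and> Fv l \<^bold>< Fv u \<cdot> Fv n \<^bold>+ Fv e)))"

section \<open>Derivability\<close>

text \<open>
  \<open>\<Gamma> \<turnstile> A\<close>: natural deduction for intuitionistic logic, Peano axioms with full induction, and the
  axioms for the constructive real line (a complete Archimedean ordered Heyting field, after
  Bridges; the order is cotransitive and tight instead of linear).  Axioms with term parameters
  are equivalent to their universal closures.  The well-formedness premises keep ill-sorted
  terms and dangling indices out of derivations.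
\<close>

inductive deriv :: "fm set \<Rightarrow> fm \<Rightarrow> bool"  (infix "\<turnstile>" 6) where
  \<comment> \<open>intuitionistic logic\<close>
  assm: "A \<in> \<Gamma> \<Longrightarrow> A \<in> Fm \<Longrightarrow> \<Gamma> \<turnstile> A"
| weaken: "\<Gamma> \<turnstile> A \<Longrightarrow> \<Gamma> \<subseteq> \<Delta> \<Longrightarrow> \<Delta> \<turnstile> A"
| botE: "\<Gamma> \<turnstile> \<^bold>\<bottom> \<Longrightarrow> A \<in> Fm \<Longrightarrow> \<Gamma> \<turnstile> A"
| conjI: "\<Gamma> \<turnstile> A \<Longrightarrow> \<Gamma> \<turnstile> B \<Longrightarrow> \<Gamma> \<turnstile> A \<^bold>\<and> B"
| conjE1: "\<Gamma> \<turnstile> A \<^bold>\<and> B \<Longrightarrow> \<Gamma> \<turnstile> A"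
| conjE2: "\<Gamma> \<turnstile> A \<^bold>\<and> B \<Longrightarrow> \<Gamma> \<turnstile> B"
| disjI1: "\<Gamma> \<turnstile> A \<Longrightarrow> B \<in> Fm \<Longrightarrow> \<Gamma> \<turnstile> A \<^bold>\<or> B"
| disjI2: "\<Gamma> \<turnstile> B \<Longrightarrow> A \<in> Fm \<Longrightarrow> \<Gamma> \<turnstile> A \<^bold>\<or> B"
| disjE: "\<Gamma> \<turnstile> A \<^bold>\<or> B \<Longrightarrow> insert A \<Gamma> \<turnstile> C \<Longrightarrow> insert B \<Gamma> \<turnstile> C \<Longrightarrow> \<Gamma> \<turnstile> C"
| impI: "insert A \<Gamma> \<turnstile> B \<Longrightarrow> A \<in> Fm \<Longrightarrow> \<Gamma> \<turnstile> A \<^bold>\<longrightarrow> B"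
| impE: "\<Gamma> \<turnstile> A \<^bold>\<longrightarrow> B \<Longrightarrow> \<Gamma> \<turnstile> A \<Longrightarrow> \<Gamma> \<turnstile> B"
| allI: "\<Gamma> \<turnstile> A \<Longrightarrow> v \<notin> \<Union> (fv ` \<Gamma>) \<Longrightarrow> \<Gamma> \<turnstile> \<^bold>\<forall>v. A"
| allE: "\<Gamma> \<turnstile> \<^bold>\<forall>v. A \<Longrightarrow> A \<in> Fm \<Longrightarrow> t \<in> Tm (snd v) \<Longrightarrow> \<Gamma> \<turnstile> subst v t A"
| exI: "\<Gamma> \<turnstile> subst v t A \<Longrightarrow> A \<in> Fm \<Longrightarrow> t \<in> Tm (snd v) \<Longrightarrow> \<Gamma> \<turnstile> \<^bold>\<exists>v. A"
| exE: "\<Gamma> \<turnstile> \<^bold>\<exists>v. A \<Longrightarrow> A \<in> Fm \<Longrightarrow> insert A \<Gamma> \<turnstile> C \<Longrightarrow>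
    v \<notin> \<Union> (fv ` \<Gamma>) \<Longrightarrow> v \<notin> fv C \<Longrightarrow> \<Gamma> \<turnstile> C"
  \<comment> \<open>equality, functions and pairs\<close>
| eq_refl: "t \<in> Tm s \<Longrightarrow> \<Gamma> \<turnstile> t \<^bold>= t"
| eq_subst: "\<Gamma> \<turnstile> t \<^bold>= u \<Longrightarrow> \<Gamma> \<turnstile> subst v t A \<Longrightarrow> A \<in> Fm \<Longrightarrow>
    t \<in> Tm (snd v) \<Longrightarrow> u \<in> Tm (snd v) \<Longrightarrow> \<Gamma> \<turnstile> subst v u A"
| fun_ext: "\<Gamma> \<turnstile> \<^bold>\<forall>x. t \<cdot> Fv x \<^bold>= u \<cdot> Fv x \<Longrightarrow> x \<notin> fv_tm t \<union> fv_tm u \<Longrightarrow>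
    t \<in> Tm (FUN (snd x) s) \<Longrightarrow> u \<in> Tm (FUN (snd x) s) \<Longrightarrow> \<Gamma> \<turnstile> t \<^bold>= u"
| proj1: "t \<in> Tm a \<Longrightarrow> u \<in> Tm b \<Longrightarrow> \<Gamma> \<turnstile> Cst (Proj1 a b) \<cdot> (Cst (MkPair a b) \<cdot> t \<cdot> u) \<^bold>= t"
| proj2: "t \<in> Tm a \<Longrightarrow> u \<in> Tm b \<Longrightarrow> \<Gamma> \<turnstile> Cst (Proj2 a b) \<cdot> (Cst (MkPair a b) \<cdot> t \<cdot> u) \<^bold>= u"
| pair_eta: "t \<in> Tm (PAIR a b) \<Longrightarrow>
    \<Gamma> \<turnstile> Cst (MkPair a b) \<cdot> (Cst (Proj1 a b) \<cdot> t) \<cdot> (Cst (Proj2 a b) \<cdot> t) \<^bold>= t"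
  \<comment> \<open>choice principles\<close>
| unique_choice: "\<Gamma> \<turnstile> \<^bold>\<forall>x. \<^bold>\<exists>y. A \<Longrightarrow>
    \<Gamma> \<turnstile> \<^bold>\<forall>x. \<^bold>\<forall>y. \<^bold>\<forall>z. A \<^bold>\<and> subst y (Fv z) A \<^bold>\<longrightarrow> Fv y \<^bold>= Fv z \<Longrightarrow>
    A \<in> Fm \<Longrightarrow> distinct [x, y, z] \<Longrightarrow> z \<notin> fv A \<Longrightarrow> f \<notin> fv A \<Longrightarrow>
    snd z = snd y \<Longrightarrow> snd f = FUN (snd x) (snd y) \<Longrightarrow>
    \<Gamma> \<turnstile> \<^bold>\<exists>f. \<^bold>\<forall>x. subst y (Fv f \<cdot> Fv x) A"
| countable_choice: "\<Gamma> \<turnstile> \<^bold>\<forall>n. \<^bold>\<exists>y. A \<Longrightarrow>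
    A \<in> Fm \<Longrightarrow> n \<noteq> y \<Longrightarrow> f \<notin> fv A \<Longrightarrow>
    snd n = NAT \<Longrightarrow> snd f = FUN NAT (snd y) \<Longrightarrow>
    \<Gamma> \<turnstile> \<^bold>\<exists>f. \<^bold>\<forall>n. subst y (Fv f \<cdot> Fv n) A"
| dependent_choice: "\<Gamma> \<turnstile> \<^bold>\<forall>x. \<^bold>\<exists>y. A \<Longrightarrow>
    A \<in> Fm \<Longrightarrow> distinct [x, y, n] \<Longrightarrow> n \<notin> fv A \<Longrightarrow> f \<notin> fv A \<Longrightarrow>
    snd y = snd x \<Longrightarrow> snd n = NAT \<Longrightarrow> snd f = FUN NAT (snd x) \<Longrightarrow>
    \<Gamma> \<turnstile> \<^bold>\<forall>x. \<^bold>\<exists>f. Fv f \<cdot> Cst NZero \<^bold>= Fv x \<^bold>\<and>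
         (\<^bold>\<forall>n. subst y (Fv f \<cdot> (Cst NSuc \<cdot> Fv n)) (subst x (Fv f \<cdot> Fv n) A))"
  \<comment> \<open>natural numbers\<close>
| suc_not_zero: "t \<in> Tm NAT \<Longrightarrow> \<Gamma> \<turnstile> \<^bold>\<not> (Cst NSuc \<cdot> t \<^bold>= Cst NZero)"
| suc_inj: "t \<in> Tm NAT \<Longrightarrow> u \<in> Tm NAT \<Longrightarrow> \<Gamma> \<turnstile> Cst NSuc \<cdot> t \<^bold>= Cst NSuc \<cdot> u \<^bold>\<longrightarrow> t \<^bold>= u"
| nadd_zero: "t \<in> Tm NAT \<Longrightarrow> \<Gamma> \<turnstile> t \<^bold>+\<^sub>N Cst NZero \<^bold>= t"
| nadd_suc: "t \<in> Tm NAT \<Longrightarrow> u \<in> Tm NAT \<Longrightarrow>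
    \<Gamma> \<turnstile> t \<^bold>+\<^sub>N (Cst NSuc \<cdot> u) \<^bold>= Cst NSuc \<cdot> (t \<^bold>+\<^sub>N u)"
| nmul_zero: "t \<in> Tm NAT \<Longrightarrow> \<Gamma> \<turnstile> t \<^bold>*\<^sub>N Cst NZero \<^bold>= Cst NZero"
| nmul_suc: "t \<in> Tm NAT \<Longrightarrow> u \<in> Tm NAT \<Longrightarrow>
    \<Gamma> \<turnstile> t \<^bold>*\<^sub>N (Cst NSuc \<cdot> u) \<^bold>= t \<^bold>*\<^sub>N u \<^bold>+\<^sub>N t"
| nat_induction: "\<Gamma> \<turnstile> subst n (Cst NZero) A \<Longrightarrow>
    \<Gamma> \<turnstile> \<^bold>\<forall>n. A \<^bold>\<longrightarrow> subst n (Cst NSuc \<cdot> Fv n) A \<Longrightarrow>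
    A \<in> Fm \<Longrightarrow> snd n = NAT \<Longrightarrow> \<Gamma> \<turnstile> \<^bold>\<forall>n. A"
  \<comment> \<open>real numbers\<close>
| radd_assoc: "a \<in> Tm REAL \<Longrightarrow> b \<in> Tm REAL \<Longrightarrow> c \<in> Tm REAL \<Longrightarrow>
    \<Gamma> \<turnstile> (a \<^bold>+ b) \<^bold>+ c \<^bold>= a \<^bold>+ (b \<^bold>+ c)"
| radd_comm: "a \<in> Tm REAL \<Longrightarrow> b \<in> Tm REAL \<Longrightarrow> \<Gamma> \<turnstile> a \<^bold>+ b \<^bold>= b \<^bold>+ a"
| radd_zero: "a \<in> Tm REAL \<Longrightarrow> \<Gamma> \<turnstile> a \<^bold>+ \<^bold>0 \<^bold>= a"
| radd_neg: "a \<in> Tm REAL \<Longrightarrow> \<Gamma> \<turnstile> a \<^bold>+ (\<^bold>- a) \<^bold>= \<^bold>0"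
| rmul_assoc: "a \<in> Tm REAL \<Longrightarrow> b \<in> Tm REAL \<Longrightarrow> c \<in> Tm REAL \<Longrightarrow>
    \<Gamma> \<turnstile> (a \<^bold>* b) \<^bold>* c \<^bold>= a \<^bold>* (b \<^bold>* c)"
| rmul_comm: "a \<in> Tm REAL \<Longrightarrow> b \<in> Tm REAL \<Longrightarrow> \<Gamma> \<turnstile> a \<^bold>* b \<^bold>= b \<^bold>* a"
| rmul_one: "a \<in> Tm REAL \<Longrightarrow> \<Gamma> \<turnstile> a \<^bold>* \<^bold>1 \<^bold>= a"
| rdistrib: "a \<in> Tm REAL \<Longrightarrow> b \<in> Tm REAL \<Longrightarrow> c \<in> Tm REAL \<Longrightarrow>
    \<Gamma> \<turnstile> a \<^bold>* (b \<^bold>+ c) \<^bold>= a \<^bold>* b \<^bold>+ a \<^bold>* c"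
| rinverse: "a \<in> Tm REAL \<Longrightarrow> snd y = REAL \<Longrightarrow> y \<notin> fv_tm a \<Longrightarrow>
    \<Gamma> \<turnstile> a \<^bold>< \<^bold>0 \<^bold>\<or> \<^bold>0 \<^bold>< a \<^bold>\<longrightarrow> (\<^bold>\<exists>y. a \<^bold>* Fv y \<^bold>= \<^bold>1)"
| zero_less_one: "\<Gamma> \<turnstile> \<^bold>0 \<^bold>< \<^bold>1"
| less_asym: "a \<in> Tm REAL \<Longrightarrow> b \<in> Tm REAL \<Longrightarrow> \<Gamma> \<turnstile> \<^bold>\<not> (a \<^bold>< b \<^bold>\<and> b \<^bold>< a)"
| less_cotrans: "a \<in> Tm REAL \<Longrightarrow> b \<in> Tm REAL \<Longrightarrow> c \<in> Tm REAL \<Longrightarrow>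
    \<Gamma> \<turnstile> a \<^bold>< b \<^bold>\<longrightarrow> a \<^bold>< c \<^bold>\<or> c \<^bold>< b"
| less_tight: "a \<in> Tm REAL \<Longrightarrow> b \<in> Tm REAL \<Longrightarrow>
    \<Gamma> \<turnstile> \<^bold>\<not> (a \<^bold>< b \<^bold>\<or> b \<^bold>< a) \<^bold>\<longrightarrow> a \<^bold>= b"
| less_add: "a \<in> Tm REAL \<Longrightarrow> b \<in> Tm REAL \<Longrightarrow> c \<in> Tm REAL \<Longrightarrow>
    \<Gamma> \<turnstile> a \<^bold>< b \<^bold>\<longrightarrow> a \<^bold>+ c \<^bold>< b \<^bold>+ c"
| less_mul: "a \<in> Tm REAL \<Longrightarrow> b \<in> Tm REAL \<Longrightarrow>
    \<Gamma> \<turnstile> \<^bold>0 \<^bold>< a \<^bold>\<and> \<^bold>0 \<^bold>< b \<^bold>\<longrightarrow> \<^bold>0 \<^bold>< a \<^bold>* b"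
| of_nat_zero: "\<Gamma> \<turnstile> Cst OfNat \<cdot> Cst NZero \<^bold>= \<^bold>0"
| of_nat_suc: "t \<in> Tm NAT \<Longrightarrow> \<Gamma> \<turnstile> Cst OfNat \<cdot> (Cst NSuc \<cdot> t) \<^bold>= Cst OfNat \<cdot> t \<^bold>+ \<^bold>1"
| archimedean: "a \<in> Tm REAL \<Longrightarrow> snd n = NAT \<Longrightarrow> n \<notin> fv_tm a \<Longrightarrow>
    \<Gamma> \<turnstile> \<^bold>\<exists>n. a \<^bold>< Cst OfNat \<cdot> Fv n"
| completeness: "\<Gamma> \<turnstile> real_complete"

section \<open>Metric spaces\<close>

text \<open>A metric on \<open>X\<close> is a term \<open>d\<close> of sort \<open>FUN X (FUN X REAL)\<close>, a sequence in \<open>X\<close> a term of sort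
  \<open>FUN NAT X\<close>.\<close>

definition metric :: "srt \<Rightarrow> tm \<Rightarrow> fm" where
  "metric X d =
     (let x = (''x'', X); y = (''y'', X); z = (''z'', X) in
      (\<^bold>\<forall>x. \<^bold>\<forall>y. \<^bold>0 \<^bold>\<le> d \<cdot> Fv x \<cdot> Fv y) \<^bold>\<and>
      (\<^bold>\<forall>x. d \<cdot> Fv x \<cdot> Fv x \<^bold>= \<^bold>0) \<^bold>\<and>
      (\<^bold>\<forall>x. \<^bold>\<forall>y. d \<cdot> Fv x \<cdot> Fv y \<^bold>= \<^bold>0 \<^bold>\<longrightarrow> Fv x \<^bold>= Fv y) \<^bold>\<and>
      (\<^bold>\<forall>x. \<^bold>\<forall>y. d \<cdot> Fv x \<cdot> Fv y \<^bold>= d \<cdot> Fv y \<cdot> Fv x) \<^bold>\<and>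
      (\<^bold>\<forall>x. \<^bold>\<forall>y. \<^bold>\<forall>z. d \<cdot> Fv x \<cdot> Fv z \<^bold>\<le> d \<cdot> Fv x \<cdot> Fv y \<^bold>+ d \<cdot> Fv y \<cdot> Fv z))"

definition converges :: "tm \<Rightarrow> tm \<Rightarrow> tm \<Rightarrow> fm" where
  "converges d s l =
     (let e = (''e'', REAL); n = (''n'', NAT) in
      \<^bold>\<forall>e. \<^bold>0 \<^bold>< Fv e \<^bold>\<longrightarrow> eventually_fm n (d \<cdot> (s \<cdot> Fv n) \<cdot> l \<^bold>< Fv e))"

definition cauchy :: "tm \<Rightarrow> tm \<Rightarrow> fm" where
  "cauchy d s =
     (let e = (''e'', REAL); N = (''N'', NAT); m = (''m'', NAT); n = (''n'', NAT) in
      \<^bold>\<forall>e. \<^bold>0 \<^bold>< Fv e \<^bold>\<longrightarrow>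
        (\<^bold>\<exists>N. \<^bold>\<forall>m. \<^bold>\<forall>n. Fv N \<^bold>\<le>\<^sub>N Fv m \<^bold>\<and> Fv N \<^bold>\<le>\<^sub>N Fv n \<^bold>\<longrightarrow>
           d \<cdot> (s \<cdot> Fv m) \<cdot> (s \<cdot> Fv n) \<^bold>< Fv e))"

definition complete :: "srt \<Rightarrow> tm \<Rightarrow> fm" where
  "complete X d =
     (let s = (''s'', FUN NAT X); l = (''l'', X) in
      \<^bold>\<forall>s. cauchy d (Fv s) \<^bold>\<longrightarrow> (\<^bold>\<exists>l. converges d (Fv s) (Fv l)))"

definition strongly_extensional :: "srt \<Rightarrow> tm \<Rightarrow> tm \<Rightarrow> tm \<Rightarrow> fm" where
  "strongly_extensional X dX dY f =
     (let x = (''x'', X); y = (''y'', X) in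
      \<^bold>\<forall>x. \<^bold>\<forall>y. \<^bold>0 \<^bold>< dY \<cdot> (f \<cdot> Fv x) \<cdot> (f \<cdot> Fv y) \<^bold>\<longrightarrow> \<^bold>0 \<^bold>< dX \<cdot> Fv x \<cdot> Fv y)"

end

theory Submission
  imports Defs "HOL-Library.Countable"
begin

text \<open>
  Derivability is complete for Kripke models: over prime Henkin theories ("worlds") disjunction and
  existence are evaluated classically, and implication and universal quantification range over all
  extensions.  It therefore suffices to carry out Ishihara's argument inside a Kripke model.

  Write \<open>r x\<close> for the distance of \<open>f x\<close> and \<open>f a\<close>, and fix \<open>0 < \<alpha> < \<beta>\<close>.  By completeness of \<open>X\<close>, if
  \<open>y\<^sub>n\<close> tends to \<open>a\<close> and \<open>A n \<or> B n\<close> for all \<open>n\<close>, where \<open>A n\<close> is only chosen if \<open>r (y\<^sub>n) > \<alpha>\<close>, then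
  some \<open>A n\<close> or all \<open>B n\<close> hold: the sequence that is \<open>a\<close> until the first chosen \<open>A m\<close> and \<open>y\<^sub>m\<close> from
  then on has a limit \<open>z\<close>, and \<open>r z > 0\<close> or \<open>r z < \<alpha>\<close>.  Choosing between \<open>r (x\<^sub>n) < \<beta>\<close> and
  \<open>r (x\<^sub>n) > \<alpha>\<close> for each \<open>n\<close>, this shows that either the former is chosen for all large \<open>n\<close>, which
  settles the theorem, or the latter for infinitely many \<open>n\<close>.  In that case there is a sequence \<open>y\<close>
  tending to \<open>a\<close> with \<open>r (y\<^sub>n) > \<alpha>\<close> for all \<open>n\<close>, so that the limited principle of omniscience holds.
  It decides, in turn, whether \<open>r (x\<^sub>n) < \<beta>\<close>, whether this holds for all \<open>n \<ge> N\<close>, and whether there is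
  such an \<open>N\<close>.
\<close>

section \<open>Opening a binder\<close>

text \<open>Two obstacles shape the argument. The metatheory is classical, but worlds grow: an
  alternative that is itself forced persists in every extension, while the failure of forcing at one
  world says nothing about the next. Lasting decisions therefore come from primeness, cotransitivity
  and induction inside a world. Every property used for an induction or a choice has to be an object
  formula; the facts named \<open>sem\<close> translate between such a formula and its Kripke
  meaning.

  A disjunction that holds for every \<open>n\<close> may be decided differently in different
  worlds. Countable choice replaces it by a term \<open>\<mu>\<close> with values 0 and 1, fixed
  once and for all, so that a first index with value 1 makes sense and can be searched for below any
  bound. The gap between \<open>\<alpha>\<close> and \<open>\<beta>\<close> pays for this, since
  cotransitivity cannot split at a single number. The side condition \<open>\<alpha> < r\<close> is
  what limits the trick; once it holds along a whole sequence, arbitrary formulas are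
  decided.\<close>

primrec open_tm :: "nat \<Rightarrow> tm \<Rightarrow> tm \<Rightarrow> tm" where
  "open_tm k r (Fv w) = Fv w"
| "open_tm k r (Bv i) = (if i = k then r else Bv i)"
| "open_tm k r (Cst c) = Cst c"
| "open_tm k r (t \<cdot> u) = open_tm k r t \<cdot> open_tm k r u"

primrec open_fm :: "nat \<Rightarrow> tm \<Rightarrow> fm \<Rightarrow> fm" where
  "open_fm k r (t \<^bold>= u) = (open_tm k r t \<^bold>= open_tm k r u)"
| "open_fm k r (t \<^bold>< u) = (open_tm k r t \<^bold>< open_tm k r u)"
| "open_fm k r \<^bold>\<bottom> = \<^bold>\<bottom>"
| "open_fm k r (A \<^bold>\<and> B) = (open_fm k r A \<^bold>\<and> open_fm k r B)"
| "open_fm k r (A \<^bold>\<or> B) = (open_fm k r A \<^bold>\<or> open_fm k r B)"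
| "open_fm k r (A \<^bold>\<longrightarrow> B) = (open_fm k r A \<^bold>\<longrightarrow> open_fm k r B)"
| "open_fm k r (All s A) = All s (open_fm (Suc k) r A)"
| "open_fm k r (Ex s A) = Ex s (open_fm (Suc k) r A)"

lemma close_open_tm: "v \<notin> fv_tm t \<Longrightarrow> close_tm k v (open_tm k (Fv v) t) = t"
  by (induction t) auto

lemma close_open: "v \<notin> fv A \<Longrightarrow> close k v (open_fm k (Fv v) A) = A"
  by (induction A arbitrary: k) (auto simp: close_open_tm)

lemma subst_open_tm: "v \<notin> fv_tm t \<Longrightarrow> subst_tm v r (open_tm k (Fv v) t) = open_tm k r t"
  by (induction t) auto

lemma subst_open: "v \<notin> fv A \<Longrightarrow> subst v r (open_fm k (Fv v) A) = open_fm k r A"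
  by (induction A arbitrary: k) (auto simp: subst_open_tm)

lemma srt_of_append: "srt_of \<Theta> t = Some s \<Longrightarrow> srt_of (\<Theta> @ \<Theta>') t = Some s"
  by (induction t arbitrary: s) (auto split: if_splits option.splits srt.splits simp: nth_append)

lemma srt_of_closed: "t \<in> Tm s \<Longrightarrow> srt_of \<Theta> t = Some s"
  using srt_of_append[of "[]" t s \<Theta>] by (simp add: Tm_def)

lemma open_tm_id: "srt_of \<Theta> t = Some s \<Longrightarrow> length \<Theta> \<le> k \<Longrightarrow> open_tm k r t = t"
  by (induction t arbitrary: s) (auto split: if_splits option.splits srt.splits)

lemma open_tm_closed: "t \<in> Tm s \<Longrightarrow> open_tm k r t = t"
  using open_tm_id[of "[]" t s k r] by (simp add: Tm_def)

text \<open>Index \<open>k\<close> does not occur in a term that is well formed under at most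
  \<open>k\<close> binders, so reopening replaces just the occurrences that closing created.\<close>

lemma open_close_tm:
  "srt_of \<Theta> t = Some s \<Longrightarrow> length \<Theta> \<le> k \<Longrightarrow> open_tm k r (close_tm k v t) = subst_tm v r t"
  by (induction t arbitrary: s) (auto split: if_splits option.splits srt.splits)

lemma open_close: "wff \<Theta> A \<Longrightarrow> length \<Theta> \<le> k \<Longrightarrow> open_fm k r (close k v A) = subst v r A"
proof (induction A arbitrary: \<Theta> k)
  case (Eq t u)
  then show ?case by (auto simp: open_close_tm)
next
  case (Less t u)
  then show ?case by (auto simp: open_close_tm)
next
  case (All s A)
  from All.IH[of "s # \<Theta>" "Suc k"] All.prems show ?case by simp
next
  case (Ex s A)
  from Ex.IH[of "s # \<Theta>" "Suc k"] Ex.prems show ?case by simp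
qed auto

lemma subst_open_commute_tm:
  "r \<in> Tm s \<Longrightarrow> subst_tm v r (open_tm k u t) = open_tm k (subst_tm v r u) (subst_tm v r t)"
  by (induction t) (auto simp: open_tm_closed)

lemma subst_open_commute:
  "r \<in> Tm s \<Longrightarrow> subst v r (open_fm k u A) = open_fm k (subst_tm v r u) (subst v r A)"
  by (induction A arbitrary: k) (auto simp: subst_open_commute_tm)

lemma srt_of_open:
  "srt_of (\<Theta> @ [s]) t = Some s' \<Longrightarrow> r \<in> Tm s \<Longrightarrow> length \<Theta> = k \<Longrightarrow>
    srt_of \<Theta> (open_tm k r t) = Some s'"
  by (induction t arbitrary: s')
     (auto split: if_splits option.splits srt.splits simp: nth_append srt_of_closed less_Suc_eq)

lemma wff_open:
  "wff (\<Theta> @ [s]) A \<Longrightarrow> r \<in> Tm s \<Longrightarrow> length \<Theta> = k \<Longrightarrow> wff \<Theta> (open_fm k r A)"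
proof (induction A arbitrary: \<Theta> k)
  case (Eq t u)
  then show ?case by (auto simp: srt_of_open)
next
  case (Less t u)
  then show ?case by (auto simp: srt_of_open)
next
  case (All a A)
  then show ?case by (simp flip: append_Cons)
next
  case (Ex a A)
  then show ?case by (simp flip: append_Cons)
qed auto

lemma wff_open0: "wff [s] A \<Longrightarrow> r \<in> Tm s \<Longrightarrow> open_fm 0 r A \<in> Fm"
  using wff_open[of "[]" s A r 0] by (simp add: Fm_def)

lemma fv_open_tm_upper: "fv_tm (open_tm k r t) \<subseteq> fv_tm t \<union> fv_tm r"
  by (induction t) auto

lemma fv_open_upper: "fv (open_fm k r A) \<subseteq> fv A \<union> fv_tm r"
  by (induction A arbitrary: k) (insert fv_open_tm_upper, simp_all, blast+)

lemma finite_fv_tm [simp]: "finite (fv_tm t)"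
  by (induction t) auto

lemma finite_fv [simp]: "finite (fv A)"
  by (induction A) auto

lemma subst_tm_fresh: "v \<notin> fv_tm t \<Longrightarrow> subst_tm v r t = t"
  by (induction t) auto

lemma subst_fresh: "v \<notin> fv A \<Longrightarrow> subst v r A = A"
  by (induction A) (auto simp: subst_tm_fresh)

lemma subst_close_tm:
  "v \<noteq> w \<Longrightarrow> w \<notin> fv_tm r \<Longrightarrow> subst_tm v r (close_tm k w t) = close_tm k w (subst_tm v r t)"
proof (induction t)
  case (Fv x)
  have "close_tm k w r = r" if "w \<notin> fv_tm r" for r
    using that by (induction r) auto
  with Fv show ?case by auto
qed auto

lemma subst_close:
  "v \<noteq> w \<Longrightarrow> w \<notin> fv_tm r \<Longrightarrow> subst v r (close k w A) = close k w (subst v r A)"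
  by (induction A arbitrary: k) (auto simp: subst_close_tm)

lemma close_tm_fresh: "v \<notin> fv_tm t \<Longrightarrow> close_tm k v t = t"
  by (induction t) auto

lemma Fv_Tm [simp]: "Fv v \<in> Tm (snd v)"
  by (simp add: Tm_def)

lemma ex_fresh: "finite (V :: var set) \<Longrightarrow> \<exists>v. snd v = s \<and> v \<notin> V"
proof -
  assume "finite V"
  then have "finite (fst ` V)" by simp
  then obtain x where "x \<notin> fst ` V"
    using ex_new_if_finite[OF infinite_UNIV_listI] by metis
  then have "(x, s) \<notin> V" by (metis fst_conv imageI)
  then show ?thesis by (metis snd_conv)
qed

section \<open>Derived rules\<close>

text \<open>The primitive rules speak of named variables, whereas the Kripke clauses meet raw
  \<open>All s B\<close> and \<open>Ex s B\<close>. A variable fresh for \<open>B\<close> makes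
  opening and closing inverse to each other, which carries the rules over.\<close>

lemma deriv_allI:
  assumes "\<Gamma> \<turnstile> open_fm 0 (Fv v) B" "v \<notin> \<Union> (fv ` \<Gamma>)" "v \<notin> fv B"
  shows "\<Gamma> \<turnstile> All (snd v) B"
  using allI[OF assms(1,2)] assms(3) by (simp add: all_fm_def close_open)

lemma deriv_allE:
  assumes "\<Gamma> \<turnstile> All s B" "wff [s] B" "t \<in> Tm s"
  shows "\<Gamma> \<turnstile> open_fm 0 t B"
proof -
  obtain v where v: "snd v = s" "v \<notin> fv B" using ex_fresh by (metis finite_fv)
  have "open_fm 0 (Fv v) B \<in> Fm" using v assms by (metis wff_open0 Fv_Tm)
  moreover have "\<Gamma> \<turnstile> \<^bold>\<forall>v. open_fm 0 (Fv v) B"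
    using assms v by (simp add: all_fm_def close_open)
  ultimately show ?thesis using v assms(3) by (metis deriv.allE subst_open)
qed

lemma deriv_exI:
  assumes "\<Gamma> \<turnstile> open_fm 0 t B" "wff [s] B" "t \<in> Tm s"
  shows "\<Gamma> \<turnstile> Ex s B"
proof -
  obtain v where v: "snd v = s" "v \<notin> fv B" using ex_fresh by (metis finite_fv)
  have "open_fm 0 (Fv v) B \<in> Fm" using v assms by (metis wff_open0 Fv_Tm)
  then have "\<Gamma> \<turnstile> \<^bold>\<exists>v. open_fm 0 (Fv v) B"
    using assms v by (intro exI[where t = t]) (simp_all add: subst_open)
  then show ?thesis using v by (simp add: ex_fm_def close_open)
qed

lemma deriv_exE:
  assumes "\<Gamma> \<turnstile> Ex (snd v) B" "wff [snd v] B" "insert (open_fm 0 (Fv v) B) \<Gamma> \<turnstile> C"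
    and "v \<notin> \<Union> (fv ` \<Gamma>)" "v \<notin> fv B" "v \<notin> fv C"
  shows "\<Gamma> \<turnstile> C"
proof -
  have "\<Gamma> \<turnstile> \<^bold>\<exists>v. open_fm 0 (Fv v) B" using assms(1,5) by (simp add: ex_fm_def close_open)
  moreover have "open_fm 0 (Fv v) B \<in> Fm" using assms(2) Fv_Tm by (rule wff_open0)
  ultimately show ?thesis using assms(3,4,6) by (rule deriv.exE)
qed

lemmas deriv_axioms = eq_refl proj1 proj2 pair_eta suc_not_zero suc_inj nadd_zero nadd_suc
  nmul_zero nmul_suc radd_assoc radd_comm radd_zero radd_neg rmul_assoc rmul_comm rmul_one
  rdistrib rinverse zero_less_one less_asym less_cotrans less_tight less_add less_mul
  of_nat_zero of_nat_suc archimedean completeness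

text \<open>Derivations are finite trees. Where a rule discharges an assumption, that formula is
  removed from the finite set again, and the freshness conditions on variables pass to subsets of
  the context. This lets an underivable \<open>C\<close> survive the union of a chain.\<close>

lemma deriv_compact: "\<Gamma> \<turnstile> A \<Longrightarrow> \<exists>\<Delta>. finite \<Delta> \<and> \<Delta> \<subseteq> \<Gamma> \<and> (\<Delta> \<turnstile> A)"
proof (induction rule: deriv.induct)
  case (assm A \<Gamma>)
  then show ?case by (intro HOL.exI[of _ "{A}"]) (auto intro: deriv.assm)
next
  case (weaken \<Gamma> A \<Delta>)
  then show ?case by blast
next
  case (botE \<Gamma> A)
  then show ?case by (blast intro: deriv.botE)
next
  case (conjI \<Gamma> A B)
  then obtain F G where "finite F" "F \<subseteq> \<Gamma>" "F \<turnstile> A" "finite G" "G \<subseteq> \<Gamma>" "G \<turnstile> B" by blast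
  then show ?case
    by (intro HOL.exI[of _ "F \<union> G"]) (auto intro!: deriv.conjI intro: deriv.weaken)
next
  case (conjE1 \<Gamma> A B)
  then show ?case by (blast intro: deriv.conjE1)
next
  case (conjE2 \<Gamma> A B)
  then show ?case by (blast intro: deriv.conjE2)
next
  case (disjI1 \<Gamma> A B)
  then show ?case by (blast intro: deriv.disjI1)
next
  case (disjI2 \<Gamma> B A)
  then show ?case by (blast intro: deriv.disjI2)
next
  case (disjE \<Gamma> A B C)
  then obtain F G H where *: "finite F" "F \<subseteq> \<Gamma>" "F \<turnstile> A \<^bold>\<or> B"
      "finite G" "G \<subseteq> insert A \<Gamma>" "G \<turnstile> C" "finite H" "H \<subseteq> insert B \<Gamma>" "H \<turnstile> C"
    by blast
  let ?K = "F \<union> (G - {A}) \<union> (H - {B})"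
  have "?K \<turnstile> C"
  proof (rule deriv.disjE)
    show "?K \<turnstile> A \<^bold>\<or> B" using *(3) by (rule deriv.weaken) auto
    show "insert A ?K \<turnstile> C" using *(6) by (rule deriv.weaken) auto
    show "insert B ?K \<turnstile> C" using *(9) by (rule deriv.weaken) auto
  qed
  then show ?case using * by (intro HOL.exI[of _ ?K]) auto
next
  case (impI A \<Gamma> B)
  then obtain F where *: "finite F" "F \<subseteq> insert A \<Gamma>" "F \<turnstile> B" by blast
  then have "F - {A} \<turnstile> A \<^bold>\<longrightarrow> B" using impI by (auto intro!: deriv.impI intro: deriv.weaken)
  then show ?case using * by (intro HOL.exI[of _ "F - {A}"]) auto
next
  case (impE \<Gamma> A B)
  then obtain F G where *: "finite F" "F \<subseteq> \<Gamma>" "F \<turnstile> A \<^bold>\<longrightarrow> B" "finite G" "G \<subseteq> \<Gamma>" "G \<turnstile> A" by blast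
  have "F \<union> G \<turnstile> B"
    by (rule deriv.impE[OF deriv.weaken[OF *(3)] deriv.weaken[OF *(6)]]) auto
  then show ?case using * by (intro HOL.exI[of _ "F \<union> G"]) auto
next
  case (allI \<Gamma> A v)
  then obtain F where *: "finite F" "F \<subseteq> \<Gamma>" "F \<turnstile> A" by blast
  have "F \<turnstile> \<^bold>\<forall>v. A" by (rule deriv.allI) (use * allI in auto)
  then show ?case using * by blast
next
  case (allE \<Gamma> v A t)
  then show ?case by (blast intro: deriv.allE)
next
  case (exI \<Gamma> v t A)
  then show ?case by (blast intro: deriv.exI)
next
  case (exE \<Gamma> v A C)
  then obtain F G where *: "finite F" "F \<subseteq> \<Gamma>" "F \<turnstile> \<^bold>\<exists>v. A" "finite G" "G \<subseteq> insert A \<Gamma>" "G \<turnstile> C"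
    by blast
  let ?K = "F \<union> (G - {A})"
  have "?K \<turnstile> C"
  proof (rule deriv.exE)
    show "?K \<turnstile> \<^bold>\<exists>v. A" using *(3) by (rule deriv.weaken) auto
    show "insert A ?K \<turnstile> C" using *(6) by (rule deriv.weaken) auto
  qed (use exE * in auto)
  then show ?case using * by (intro HOL.exI[of _ ?K]) auto
next
  case (eq_subst \<Gamma> t u v A)
  then obtain F G where *: "finite F" "F \<subseteq> \<Gamma>" "F \<turnstile> t \<^bold>= u" "finite G" "G \<subseteq> \<Gamma>" "G \<turnstile> subst v t A"
    by blast
  have "F \<union> G \<turnstile> subst v u A"
    by (rule deriv.eq_subst[OF deriv.weaken[OF *(3)] deriv.weaken[OF *(6)]]) (use eq_subst in auto)
  then show ?case using * by (intro HOL.exI[of _ "F \<union> G"]) auto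
next
  case (fun_ext \<Gamma> x t u s)
  then show ?case by (blast intro: deriv.fun_ext)
next
  case (unique_choice \<Gamma> x y A z f)
  then obtain F G where *: "finite F" "F \<subseteq> \<Gamma>" "F \<turnstile> \<^bold>\<forall>x. \<^bold>\<exists>y. A" "finite G" "G \<subseteq> \<Gamma>"
      "G \<turnstile> \<^bold>\<forall>x. \<^bold>\<forall>y. \<^bold>\<forall>z. A \<^bold>\<and> subst y (Fv z) A \<^bold>\<longrightarrow> Fv y \<^bold>= Fv z"
    by blast
  have "F \<union> G \<turnstile> \<^bold>\<exists>f. \<^bold>\<forall>x. subst y (Fv f \<cdot> Fv x) A"
    by (rule deriv.unique_choice[OF deriv.weaken[OF *(3)] deriv.weaken[OF *(6)]])
       (use unique_choice in auto)
  then show ?case using * by (intro HOL.exI[of _ "F \<union> G"]) auto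
next
  case (countable_choice \<Gamma> n y A f)
  then show ?case by (blast intro: deriv.countable_choice)
next
  case (dependent_choice \<Gamma> x y A n f)
  then show ?case by (blast intro: deriv.dependent_choice)
next
  case (nat_induction \<Gamma> n A)
  then obtain F G where *: "finite F" "F \<subseteq> \<Gamma>" "F \<turnstile> subst n (Cst NZero) A" "finite G" "G \<subseteq> \<Gamma>"
      "G \<turnstile> \<^bold>\<forall>n. A \<^bold>\<longrightarrow> subst n (Cst NSuc \<cdot> Fv n) A"
    by blast
  have "F \<union> G \<turnstile> \<^bold>\<forall>n. A"
    by (rule deriv.nat_induction[OF deriv.weaken[OF *(3)] deriv.weaken[OF *(6)]])
       (use nat_induction in auto)
  then show ?case using * by (intro HOL.exI[of _ "F \<union> G"]) auto
\<comment> \<open>The remaining rules have no derivability premise, so the empty context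
  suffices.\<close>
qed ((intro HOL.exI[of _ "{}"] HOL.conjI finite.emptyI empty_subsetI)[1], (rule deriv_axioms; assumption)[1])+

text \<open>An enumeration of all formulas drives the stages of the Henkin construction.\<close>

instance srt :: countable by countable_datatype
instance cst :: countable by countable_datatype
instance tm :: countable by countable_datatype
instance fm :: countable by countable_datatype

section \<open>Kripke worlds\<close>

definition lang :: "fm set \<Rightarrow> var set" where
  "lang T = \<Union> (fv ` T)"

definition coinfinite :: "var set \<Rightarrow> bool" where
  "coinfinite V \<longleftrightarrow> (\<forall>s. infinite {x. (x, s) \<notin> V})"

text \<open>The domain of a world at sort \<open>s\<close>. The variables occurring in
  \<open>T\<close> are its parameters, and the elements are terms rather than classes of provably
  equal terms.\<close>

definition D :: "fm set \<Rightarrow> srt \<Rightarrow> tm set" where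
  "D T s = {t \<in> Tm s. fv_tm t \<subseteq> lang T}"

definition Form :: "fm set \<Rightarrow> fm set" where
  "Form T = {A \<in> Fm. fv A \<subseteq> lang T}"

text \<open>Forcing is derivability within the language of \<open>T\<close>; the Kripke clauses
  (\<open>forces_disj\<close>, \<open>forces_imp\<close>, \<open>forces_all\<close> and so on) are
  then theorems about worlds. Membership in \<open>Form T\<close> keeps out foreign parameters, for
  which a world promises neither primeness nor witnesses.\<close>

definition forces :: "fm set \<Rightarrow> fm \<Rightarrow> bool"  (infix "\<tturnstile>" 32) where
  "(T \<tturnstile> A) \<longleftrightarrow> A \<in> Form T \<and> (T \<turnstile> A)"

text \<open>Consistent prime theories with witnesses, where the conditions concern derivability
  rather than membership. Coinfiniteness ensures that a world can be extended again.\<close>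

definition world :: "fm set \<Rightarrow> bool" where
  "world T \<longleftrightarrow> coinfinite (lang T) \<and> \<not> (T \<turnstile> \<^bold>\<bottom>) \<and>
     (\<forall>A B. (T \<tturnstile> A \<^bold>\<or> B) \<longrightarrow> (T \<turnstile> A) \<or> (T \<turnstile> B)) \<and>
     (\<forall>s B. (T \<tturnstile> Ex s B) \<longrightarrow> (\<exists>t \<in> D T s. (T \<turnstile> open_fm 0 t B)))"

definition exts :: "fm set \<Rightarrow> fm set set" where
  "exts T = {T'. world T' \<and> T \<subseteq> T'}"

section \<open>Henkin extensions of coinfinite theories\<close>

lemma deriv_cut: "insert A \<Gamma> \<turnstile> C \<Longrightarrow> \<Gamma> \<turnstile> A \<Longrightarrow> A \<in> Fm \<Longrightarrow> \<Gamma> \<turnstile> C"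
  by (rule impE[OF impI])

lemma coinfinite_Un: "coinfinite V \<Longrightarrow> finite F \<Longrightarrow> coinfinite (V \<union> F)"
proof (unfold coinfinite_def, rule)
  fix s assume V: "\<forall>s. infinite {x. (x, s) \<notin> V}" and F: "finite F"
  have "{x. (x, s) \<notin> V} \<subseteq> {x. (x, s) \<notin> V \<union> F} \<union> fst ` F" by force
  then show "infinite {x. (x, s) \<notin> V \<union> F}"
    using V F by (metis finite_Un finite_imageI finite_subset)
qed

lemma infinite_split:
  assumes "infinite S"
  shows "\<exists>P\<subseteq>S. infinite P \<and> infinite (S - P)"
proof -
  obtain f :: "nat \<Rightarrow> _" where f: "inj f" "range f \<subseteq> S"
    using infinite_countable_subset[OF assms] by blast
  have inf: "infinite (range (\<lambda>n. f (2 * n + k)))" for k :: nat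
  proof -
    have "inj (\<lambda>n. f (2 * n + k))" by (rule injI) (use injD[OF f(1)] in force)
    then show ?thesis using finite_imageD infinite_UNIV_nat by blast
  qed
  have "2 * m + 1 \<noteq> 2 * n + 0" for m n :: nat by presburger
  then have "range (\<lambda>n. f (2 * n + 1)) \<subseteq> S - range (\<lambda>n. f (2 * n + 0))"
    using f by (force simp: inj_eq)
  then have "infinite (S - range (\<lambda>n. f (2 * n + 0)))" using inf finite_subset by blast
  moreover have "range (\<lambda>n. f (2 * n + 0)) \<subseteq> S" using f(2) by blast
  ultimately show ?thesis using inf by blast
qed

lemma finite_subset_chain:
  fixes f :: "nat \<Rightarrow> 'a set"
  assumes "\<And>n. f n \<subseteq> f (Suc n)" "finite F" "F \<subseteq> (\<Union>n. f n)"
  shows "\<exists>n. F \<subseteq> f n"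
  using assms(2,3)
proof (induction F)
  case (insert x F)
  then obtain m n where "F \<subseteq> f m" "x \<in> f n" by auto
  moreover have "f k \<subseteq> f (max m n)" if "k \<le> max m n" for k
    using lift_Suc_mono_le[of f] assms(1) that by blast
  ultimately show ?case by (meson insert_subset max.cobounded1 max.cobounded2 subset_iff)
qed simp

text \<open>A Henkin construction inside a language that leaves infinitely many variables of every sort
  unused, so that the resulting world can be extended again.\<close>

lemma world_extension:
  assumes "coinfinite (lang \<Gamma>)" "finite F" "\<not> (\<Gamma> \<turnstile> C)" "C \<in> Fm"
  obtains T where "world T" "\<Gamma> \<subseteq> T" "\<not> (T \<turnstile> C)" "F \<subseteq> lang T"
proof -
  define V where "V = lang \<Gamma> \<union> (fv C \<union> F)"
  have V: "coinfinite V" unfolding V_def using assms by (intro coinfinite_Un) auto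
  then have "\<exists>P. \<forall>s. P s \<subseteq> {x. (x, s) \<notin> V} \<and> infinite (P s) \<and> infinite ({x. (x, s) \<notin> V} - P s)"
    unfolding coinfinite_def by (intro choice) (meson infinite_split)
  then obtain P where P: "\<And>s. P s \<subseteq> {x. (x, s) \<notin> V}" "\<And>s. infinite (P s)"
      "\<And>s. infinite ({x. (x, s) \<notin> V} - P s)" by blast
  define L where "L = {(x, s). x \<notin> P s}"
  have VL: "V \<subseteq> L" using P(1) by (auto simp: L_def)
  have freshL: "\<exists>v \<in> L. snd v = s \<and> v \<notin> V \<union> G" if "finite G" for s G
  proof -
    have "\<not> {x. (x, s) \<notin> V} - P s \<subseteq> fst ` G"
      using P(3)[of s] finite_imageI[OF that, of fst] finite_subset by blast
    then obtain x where "x \<in> {x. (x, s) \<notin> V} - P s" "x \<notin> fst ` G" by blast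
    then show ?thesis by (intro bexI[of _ "(x, s)"]) (auto simp: L_def image_iff)
  qed
  \<comment> \<open>Each stage has only finitely many formulas beyond \<open>\<Gamma>\<close>, so a
    fresh witness in \<open>L\<close> can always be found, and \<open>C\<close> stays
    underivable.\<close>
  define inv where "inv S \<longleftrightarrow> \<Gamma> \<subseteq> S \<and> finite (S - \<Gamma>) \<and> lang S \<subseteq> L \<and> \<not> (S \<turnstile> C)" for S
  define treat where "treat A S S' \<longleftrightarrow> S \<subseteq> S' \<and>
      (A \<in> Fm \<longrightarrow> fv A \<subseteq> L \<longrightarrow> \<not> (insert A S \<turnstile> C) \<longrightarrow> A \<in> S' \<and>
        (\<forall>s B. A = Ex s B \<longrightarrow> (\<exists>v \<in> L. snd v = s \<and> open_fm 0 (Fv v) B \<in> S')))" for A S S'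
  have step: "\<exists>S'. inv S' \<and> treat A S S'" if "inv S" for A S
  proof (cases "A \<in> Fm \<and> fv A \<subseteq> L \<and> \<not> (insert A S \<turnstile> C)")
    case False
    then show ?thesis using that unfolding treat_def by blast
  next
    case True
    show ?thesis
    proof (cases "\<exists>s B. A = Ex s B")
      case False
      have "finite (insert A S - \<Gamma>)" using that by (auto simp: inv_def insert_Diff_if)
      then have "inv (insert A S)" using that True by (auto simp: inv_def lang_def)
      then show ?thesis using False unfolding treat_def by blast
    next
      case ex: True
      then obtain s B where A: "A = Ex s B" by blast
      have "finite (\<Union> (fv ` (S - \<Gamma>)) \<union> fv A)" using that by (auto simp: inv_def)
      from freshL[OF this] obtain v where v: "v \<in> L" "snd v = s" "v \<notin> V"
        "v \<notin> \<Union> (fv ` (S - \<Gamma>)) \<union> fv A" by blast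
      let ?S = "insert (open_fm 0 (Fv v) B) (insert A S)"
      have vS: "v \<notin> \<Union> (fv ` insert A S)" using v by (auto simp: V_def lang_def)
      have wB: "wff [snd v] B" using True A v(2) by (simp add: Fm_def)
      have "\<not> (?S \<turnstile> C)"
      proof
        assume S: "?S \<turnstile> C"
        have "insert A S \<turnstile> Ex (snd v) B" using True A v(2) by (intro assm) auto
        from deriv_exE[OF this wB S vS] have "insert A S \<turnstile> C"
          using v A by (auto simp: V_def)
        with True show False by blast
      qed
      moreover have "fv (open_fm 0 (Fv v) B) \<subseteq> L"
        using fv_open_upper[of 0 "Fv v" B] True A v(1) by auto
      moreover have "finite (?S - \<Gamma>)" using that by (auto simp: inv_def insert_Diff_if)
      ultimately have "inv ?S" using that True by (auto simp: inv_def lang_def)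
      moreover have "treat A S ?S" using v A unfolding treat_def by blast
      ultimately show ?thesis by blast
    qed
  qed
  have "inv \<Gamma>" using assms VL by (auto simp: inv_def V_def)
  with step have "\<exists>f. \<forall>n. inv (f n) \<and> treat (from_nat n) (f n) (f (Suc n))"
    by (intro dependent_nat_choice) auto
  then obtain f where f: "\<And>n. inv (f n)" "\<And>n. treat (from_nat n) (f n) (f (Suc n))" by blast
  define T where "T = (\<Union>n. f n)"
  have mono: "f n \<subseteq> f (Suc n)" for n using f(2) by (simp add: treat_def)
  have fT: "f n \<subseteq> T" for n by (auto simp: T_def)
  have \<Gamma>T: "\<Gamma> \<subseteq> T" using f(1)[of 0] fT[of 0] by (auto simp: inv_def)
  have nC: "\<not> (T \<turnstile> C)"
  proof
    assume "T \<turnstile> C"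
    then obtain G where G: "finite G" "G \<subseteq> T" "G \<turnstile> C" using deriv_compact by blast
    obtain n where "G \<subseteq> f n"
      using finite_subset_chain[of f, OF mono G(1)] G(2) by (auto simp: T_def)
    with G(3) have "f n \<turnstile> C" by (rule weaken)
    with f(1) show False by (simp add: inv_def)
  qed
  have treated: "treat A (f (to_nat A)) (f (Suc (to_nat A)))" for A using f(2)[of "to_nat A"] by simp
  \<comment> \<open>Maximality with respect to \<open>C\<close>: a refused formula of the language
    yields \<open>C\<close> over \<open>T\<close>. Primeness follows, since two refused disjuncts
    would give \<open>C\<close> by \<open>disjE\<close>.\<close>
  have not_in: "insert A T \<turnstile> C" if "A \<in> Fm" "fv A \<subseteq> L" "A \<notin> T" for A
  proof -
    have "insert A (f (to_nat A)) \<turnstile> C"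
      using treated[of A] that fT unfolding treat_def by blast
    then show ?thesis by (rule weaken) (use fT in blast)
  qed
  have in_T: "A \<in> T" if "A \<in> Fm" "fv A \<subseteq> L" "T \<turnstile> A" for A
    using not_in that deriv_cut nC by blast
  have "lang T \<subseteq> L" using f(1) by (auto simp: T_def lang_def inv_def)
  moreover have "v \<in> lang T" if "v \<in> L" for v
  proof -
    \<comment> \<open>Reflexivity equations lie in \<open>T\<close>, so every variable of
      \<open>L\<close> occurs in it and the language is exactly \<open>L\<close>.\<close>
    have "(Fv v \<^bold>= Fv v) \<in> T" using that by (intro in_T eq_refl) (auto simp: Fm_def Tm_def)
    then show ?thesis by (force simp: lang_def)
  qed
  ultimately have langT: "lang T = L" by blast
  have "world T"
    unfolding world_def
  proof (intro HOL.conjI HOL.allI HOL.impI)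
    show "coinfinite (lang T)" using P(2) by (auto simp: langT L_def coinfinite_def)
    show "\<not> (T \<turnstile> \<^bold>\<bottom>)" using nC assms(4) botE by blast
    fix A B assume AB: "T \<tturnstile> A \<^bold>\<or> B"
    show "(T \<turnstile> A) \<or> (T \<turnstile> B)"
    proof (rule ccontr)
      assume n: "\<not> ((T \<turnstile> A) \<or> (T \<turnstile> B))"
      have "A \<in> Fm" "B \<in> Fm" "fv A \<subseteq> L" "fv B \<subseteq> L"
        using AB by (auto simp: forces_def Form_def Fm_def langT)
      moreover from this n have "A \<notin> T" "B \<notin> T" by (auto intro: assm)
      ultimately have "insert A T \<turnstile> C" "insert B T \<turnstile> C" using not_in by auto
      with AB have "T \<turnstile> C" by (auto simp: forces_def intro: disjE)
      with nC show False by simp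
    qed
  next
    fix s B assume ex: "T \<tturnstile> Ex s B"
    then have wf: "Ex s B \<in> Fm" "fv (Ex s B) \<subseteq> L" by (auto simp: forces_def Form_def langT)
    \<comment> \<open>A derivable existential formula cannot have been refused at its stage, so its
      witness was added there.\<close>
    have "\<not> (insert (Ex s B) (f (to_nat (Ex s B))) \<turnstile> C)"
    proof
      assume "insert (Ex s B) (f (to_nat (Ex s B))) \<turnstile> C"
      then have "insert (Ex s B) T \<turnstile> C" by (rule weaken) (use fT in blast)
      with ex wf nC show False by (meson deriv_cut forces_def)
    qed
    then obtain v where v: "v \<in> L" "snd v = s" "open_fm 0 (Fv v) B \<in> T"
      using treated[of "Ex s B"] wf fT unfolding treat_def by blast
    have "wff [s] B" "Fv v \<in> Tm s" using wf v Fv_Tm[of v] by (simp_all add: Fm_def)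
    then have "open_fm 0 (Fv v) B \<in> Fm" by (rule wff_open0)
    then have "T \<turnstile> open_fm 0 (Fv v) B" using v by (intro assm)
    moreover have "Fv v \<in> D T s" using v by (auto simp: D_def langT)
    ultimately show "\<exists>t\<in>D T s. (T \<turnstile> open_fm 0 t B)" by blast
  qed
  moreover have "F \<subseteq> lang T" using VL by (auto simp: langT V_def)
  ultimately show thesis using that \<Gamma>T nC by blast
qed

section \<open>Monotonicity and the Kripke clauses\<close>

lemma world_exts: "world T \<Longrightarrow> T \<in> exts T"
  by (simp add: exts_def)

lemma extsD: "T' \<in> exts T \<Longrightarrow> world T'"
  by (simp add: exts_def)

lemma exts_trans: "T' \<in> exts T \<Longrightarrow> T'' \<in> exts T' \<Longrightarrow> T'' \<in> exts T"
  by (auto simp: exts_def)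

lemma lang_mono: "T' \<in> exts T \<Longrightarrow> lang T \<subseteq> lang T'"
  by (auto simp: exts_def lang_def)

lemma D_mono: "t \<in> D T s \<Longrightarrow> T' \<in> exts T \<Longrightarrow> t \<in> D T' s"
  using lang_mono by (auto simp: D_def)

lemma Form_mono: "A \<in> Form T \<Longrightarrow> T' \<in> exts T \<Longrightarrow> A \<in> Form T'"
  using lang_mono by (auto simp: Form_def)

lemma forces_mono: "T \<tturnstile> A \<Longrightarrow> T' \<in> exts T \<Longrightarrow> T' \<tturnstile> A"
  by (auto simp: forces_def Form_mono exts_def intro: weaken)

lemma forces_Form: "T \<tturnstile> A \<Longrightarrow> A \<in> Form T"
  by (simp add: forces_def)

lemma Form_simps:
  "(t \<^bold>= u) \<in> Form T \<longleftrightarrow> (\<exists>s. t \<in> D T s \<and> u \<in> D T s)"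
  "(t \<^bold>< u) \<in> Form T \<longleftrightarrow> t \<in> D T REAL \<and> u \<in> D T REAL"
  "\<^bold>\<bottom> \<in> Form T"
  "(A \<^bold>\<and> B) \<in> Form T \<longleftrightarrow> A \<in> Form T \<and> B \<in> Form T"
  "(A \<^bold>\<or> B) \<in> Form T \<longleftrightarrow> A \<in> Form T \<and> B \<in> Form T"
  "(A \<^bold>\<longrightarrow> B) \<in> Form T \<longleftrightarrow> A \<in> Form T \<and> B \<in> Form T"
  "All s A \<in> Form T \<longleftrightarrow> wff [s] A \<and> fv A \<subseteq> lang T"
  "Ex s A \<in> Form T \<longleftrightarrow> wff [s] A \<and> fv A \<subseteq> lang T"
  by (auto simp: Form_def Fm_def D_def Tm_def)

lemma D_srt_of: "t \<in> D T s \<Longrightarrow> srt_of \<Theta> t = Some s"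
  by (simp add: D_def srt_of_closed)

lemma D_fv_tm: "t \<in> D T s \<Longrightarrow> fv_tm t \<subseteq> lang T"
  by (simp add: D_def)

lemma D_open_tm: "t \<in> D T s \<Longrightarrow> open_tm k r t = t"
  by (auto simp: D_def intro: open_tm_closed)

lemma D_Tm: "t \<in> D T s \<Longrightarrow> t \<in> Tm s"
  by (simp add: D_def)

lemma Form_open: "wff [s] A \<Longrightarrow> fv A \<subseteq> lang T \<Longrightarrow> t \<in> D T s \<Longrightarrow> open_fm 0 t A \<in> Form T"
  using fv_open_upper[of 0 t A] by (auto simp: Form_def D_def intro!: wff_open0)

lemma FormD: "A \<in> Form T \<Longrightarrow> A \<in> Fm"
  by (simp add: Form_def)

lemma forces_conj: "(T \<tturnstile> A \<^bold>\<and> B) \<longleftrightarrow> (T \<tturnstile> A) \<and> (T \<tturnstile> B)"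
  unfolding forces_def Form_simps by (metis conjI conjE1 conjE2)

lemma forces_disj:
  assumes "world T"
  shows "(T \<tturnstile> A \<^bold>\<or> B) \<longleftrightarrow> A \<in> Form T \<and> B \<in> Form T \<and> ((T \<tturnstile> A) \<or> (T \<tturnstile> B))"
proof -
  have "(T \<turnstile> A) \<or> (T \<turnstile> B)" if "T \<tturnstile> A \<^bold>\<or> B"
    using assms that by (simp add: world_def)
  then show ?thesis
    unfolding forces_def Form_simps by (metis FormD disjI1 disjI2)
qed

lemma forces_bot: "world T \<Longrightarrow> \<not> (T \<tturnstile> \<^bold>\<bottom>)"
  by (simp add: world_def forces_def)

lemma forces_ex:
  assumes "world T"
  shows "(T \<tturnstile> Ex s A) \<longleftrightarrow>
    wff [s] A \<and> fv A \<subseteq> lang T \<and> (\<exists>t \<in> D T s. T \<tturnstile> open_fm 0 t A)"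
proof -
  have "\<exists>t \<in> D T s. (T \<turnstile> open_fm 0 t A)" if "T \<tturnstile> Ex s A"
    using assms that by (simp add: world_def)
  then show ?thesis
    unfolding forces_def Form_simps by (metis Form_open deriv_exI D_Tm)
qed

text \<open>An underivable \<open>A\<close> would stay underivable in some world above
  \<open>T\<close>. The set \<open>F\<close> names variables that this world is to have as
  elements.\<close>

lemma deriv_if_extensions:
  assumes "coinfinite (lang T)" "\<And>T'. world T' \<Longrightarrow> T \<subseteq> T' \<Longrightarrow> F \<subseteq> lang T' \<Longrightarrow> T' \<turnstile> A"
    and "A \<in> Fm" "finite F"
  shows "T \<turnstile> A"
  proof (rule ccontr)
  assume "\<not> (T \<turnstile> A)"
  then show False using world_extension[OF assms(1,4) _ assms(3)] assms(2) by blast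
qed

text \<open>For the converse, \<open>insert A T\<close> has the same language as \<open>T\<close>
  and is therefore still coinfinite, and every world containing it is an extension of
  \<open>T\<close> that forces \<open>A\<close>.\<close>

lemma forces_imp:
  assumes "world T"
  shows "(T \<tturnstile> A \<^bold>\<longrightarrow> B) \<longleftrightarrow>
    A \<in> Form T \<and> B \<in> Form T \<and> (\<forall>T' \<in> exts T. (T' \<tturnstile> A) \<longrightarrow> (T' \<tturnstile> B))"
proof (intro iffI HOL.conjI)
  assume *: "T \<tturnstile> A \<^bold>\<longrightarrow> B"
  then show "A \<in> Form T" "B \<in> Form T" by (auto simp: forces_def Form_simps)
  then show "\<forall>T' \<in> exts T. (T' \<tturnstile> A) \<longrightarrow> (T' \<tturnstile> B)"
    using forces_mono[OF *] Form_mono unfolding forces_def by (blast intro: impE)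
next
  assume *: "A \<in> Form T \<and> B \<in> Form T \<and> (\<forall>T' \<in> exts T. (T' \<tturnstile> A) \<longrightarrow> (T' \<tturnstile> B))"
  have "lang (insert A T) = lang T" using * by (auto simp: lang_def Form_def)
  then have "coinfinite (lang (insert A T))" using assms by (simp add: world_def)
  then have "insert A T \<turnstile> B"
  proof (rule deriv_if_extensions)
    fix T' assume T': "world T'" "insert A T \<subseteq> T'"
    then have "T' \<in> exts T" by (auto simp: exts_def)
    moreover have "T' \<tturnstile> A"
      using * T' Form_mono[OF _ calculation] by (auto simp: forces_def Form_def intro: assm)
    ultimately show "T' \<turnstile> B" using * by (auto simp: forces_def)
  qed (use * in \<open>auto simp: Form_def\<close>)
  then show "T \<tturnstile> A \<^bold>\<longrightarrow> B" using * by (auto simp: forces_def Form_simps intro: impI dest: FormD)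
qed

text \<open>A variable outside \<open>lang T\<close> serves as a generic element: every extension
  that has it forces the instance, hence \<open>T\<close> derives the instance, and generalization
  applies.\<close>

lemma forces_all:
  assumes "world T"
  shows "(T \<tturnstile> All s A) \<longleftrightarrow>
    wff [s] A \<and> fv A \<subseteq> lang T \<and> (\<forall>T' \<in> exts T. \<forall>t \<in> D T' s. T' \<tturnstile> open_fm 0 t A)"
proof (intro iffI HOL.conjI)
  assume *: "T \<tturnstile> All s A"
  then show wf: "wff [s] A" "fv A \<subseteq> lang T" by (auto simp: forces_def Form_simps)
  show "\<forall>T' \<in> exts T. \<forall>t \<in> D T' s. T' \<tturnstile> open_fm 0 t A"
  proof (intro ballI)
    fix T' t assume T': "T' \<in> exts T" and t: "t \<in> D T' s"
    have "T' \<tturnstile> All s A" using forces_mono[OF * T'] .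
    then show "T' \<tturnstile> open_fm 0 t A"
      using t by (auto simp: forces_def Form_simps intro: deriv_allE Form_open dest: D_Tm)
  qed
next
  assume *: "wff [s] A \<and> fv A \<subseteq> lang T \<and> (\<forall>T' \<in> exts T. \<forall>t \<in> D T' s. T' \<tturnstile> open_fm 0 t A)"
  have "infinite {x. (x, s) \<notin> lang T}" using assms by (simp add: world_def coinfinite_def)
  then obtain x where "(x, s) \<notin> lang T" using not_finite_existsD by blast
  define v where "v = (x, s)"
  have v: "v \<notin> lang T" "snd v = s" by (simp_all add: v_def \<open>(x, s) \<notin> lang T\<close>)
  have "coinfinite (lang T)" using assms by (simp add: world_def)
  then have "T \<turnstile> open_fm 0 (Fv v) A"
  proof (rule deriv_if_extensions)
    fix T' assume T': "world T'" "T \<subseteq> T'" "{v} \<subseteq> lang T'"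
    have "Fv v \<in> D T' s" using v T' by (auto simp: D_def)
    then show "T' \<turnstile> open_fm 0 (Fv v) A" using * T' by (auto simp: forces_def exts_def)
  next
    show "open_fm 0 (Fv v) A \<in> Fm" using * v(2) Fv_Tm[of v] by (auto intro: wff_open0)
  qed simp
  then have "T \<turnstile> All (snd v) A"
    by (rule deriv_allI) (use * v in \<open>auto simp: lang_def\<close>)
  then show "T \<tturnstile> All s A" using * v by (auto simp: forces_def Form_simps)
qed

lemma kripke_complete:
  assumes "A \<in> Fm" "\<And>T. world T \<Longrightarrow> A \<in> Form T \<Longrightarrow> T \<tturnstile> A"
  shows "{} \<turnstile> A"
proof (rule deriv_if_extensions)
  show "coinfinite (lang {})" by (simp add: coinfinite_def lang_def infinite_UNIV_listI)
  show "T \<turnstile> A" if "world T" "fv A \<subseteq> lang T" for T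
    using assms that by (simp add: forces_def Form_def)
qed (use assms in auto)

section \<open>Semantic induction and choice\<close>

lemma srt_of_close:
  "srt_of \<Theta> t = Some s \<Longrightarrow> length \<Theta> = k \<Longrightarrow> srt_of (\<Theta> @ [snd v]) (close_tm k v t) = Some s"
  by (induction t arbitrary: s) (auto split: if_splits option.splits srt.splits simp: nth_append)

lemma wff_close: "wff \<Theta> A \<Longrightarrow> length \<Theta> = k \<Longrightarrow> wff (\<Theta> @ [snd v]) (close k v A)"
proof (induction A arbitrary: \<Theta> k)
  case (Eq t u)
  then show ?case by (auto simp: srt_of_close)
next
  case (Less t u)
  then show ?case by (auto simp: srt_of_close)
next
  case (All a A)
  then show ?case by (metis append_Cons close.simps(7) length_Cons wff.simps(7))
next
  case (Ex a A)
  then show ?case by (metis append_Cons close.simps(8) length_Cons wff.simps(8))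
qed auto

lemma wff_close0: "A \<in> Fm \<Longrightarrow> wff [snd v] (close 0 v A)"
  using wff_close[of "[]" A 0 v] by (simp add: Fm_def)

lemma fv_close_tm: "fv_tm (close_tm k v t) = fv_tm t - {v}"
  by (induction t) auto

lemma fv_close: "fv (close k v A) = fv A - {v}"
  by (induction A arbitrary: k) (auto simp: fv_close_tm)

lemma fresh_for_world:
  assumes "world T" "finite F"
  obtains v where "snd v = s" "v \<notin> lang T" "v \<notin> F"
proof -
  have "coinfinite (lang T \<union> F)" using assms by (auto simp: world_def intro: coinfinite_Un)
  then have "infinite {x. (x, s) \<notin> lang T \<union> F}" by (simp add: coinfinite_def)
  then obtain x where "(x, s) \<notin> lang T \<union> F" using not_finite_existsD by blast
  then show thesis using that[of "(x, s)"] by simp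
qed

text \<open>The step is demanded at all extensions because it is applied to a generic number, namely
  a variable that \<open>T\<close> does not yet contain. Forcing the implication for this variable
  gives the premise of the induction axiom.\<close>

lemma forces_induct:
  assumes W: "world T" and B: "wff [NAT] B" "fv B \<subseteq> lang T"
    and base: "T \<tturnstile> open_fm 0 (Cst NZero) B"
    and step: "\<And>T' n. T' \<in> exts T \<Longrightarrow> n \<in> D T' NAT \<Longrightarrow> T' \<tturnstile> open_fm 0 n B \<Longrightarrow>
      T' \<tturnstile> open_fm 0 (Cst NSuc \<cdot> n) B"
  shows "T \<tturnstile> All NAT B"
proof -
  obtain v where v: "snd v = NAT" "v \<notin> lang T"
    using fresh_for_world[OF W, of "{}" NAT] by blast
  have vB: "v \<notin> fv B" using v B by blast
  have vN: "Fv v \<in> Tm NAT" "Cst NSuc \<cdot> Fv v \<in> Tm NAT" using v by (auto simp: Tm_def)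
  let ?A = "open_fm 0 (Fv v) B"
  have A: "?A \<in> Fm" "open_fm 0 (Cst NSuc \<cdot> Fv v) B \<in> Fm"
    using wff_open0[OF B(1)] vN by auto
  have "T \<turnstile> ?A \<^bold>\<longrightarrow> open_fm 0 (Cst NSuc \<cdot> Fv v) B"
  proof (rule deriv_if_extensions)
    show "coinfinite (lang T)" using W by (simp add: world_def)
    fix T' assume T': "world T'" "T \<subseteq> T'" "{v} \<subseteq> lang T'"
    then have ext: "T' \<in> exts T" by (simp add: exts_def)
    have vD: "Fv v \<in> D T' NAT" "Cst NSuc \<cdot> Fv v \<in> D T' NAT" using T' vN by (auto simp: D_def)
    have "T' \<tturnstile> ?A \<^bold>\<longrightarrow> open_fm 0 (Cst NSuc \<cdot> Fv v) B"
      unfolding forces_imp[OF T'(1)]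
    proof (intro HOL.conjI ballI HOL.impI)
      show "?A \<in> Form T'" "open_fm 0 (Cst NSuc \<cdot> Fv v) B \<in> Form T'"
        using B lang_mono[OF ext] vD by (auto intro!: Form_open)
      fix T'' assume "T'' \<in> exts T'" "T'' \<tturnstile> ?A"
      then show "T'' \<tturnstile> open_fm 0 (Cst NSuc \<cdot> Fv v) B"
        using step exts_trans[OF ext] D_mono[OF vD(1)] by blast
    qed
    then show "T' \<turnstile> ?A \<^bold>\<longrightarrow> open_fm 0 (Cst NSuc \<cdot> Fv v) B" by (simp add: forces_def)
  qed (use A in \<open>simp_all add: Fm_def\<close>)
  then have "T \<turnstile> \<^bold>\<forall>v. ?A \<^bold>\<longrightarrow> open_fm 0 (Cst NSuc \<cdot> Fv v) B"
    by (rule allI) (use v in \<open>simp add: lang_def\<close>)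
  moreover have "T \<turnstile> open_fm 0 (Cst NZero) B" using base by (simp add: forces_def)
  ultimately have "T \<turnstile> \<^bold>\<forall>v. ?A"
    using nat_induction[of T v ?A] A(1) v(1) by (simp only: subst_open[OF vB])
  then have "T \<turnstile> All NAT B" using v vB by (simp add: all_fm_def close_open)
  then show ?thesis using B by (simp add: forces_def Form_simps)
qed

text \<open>In \<open>B\<close>, index 1 stands for the argument and index 0 for the value. The
  choice axiom yields an existential statement about functions, and the witness property turns it
  into a single term \<open>g\<close> of \<open>T\<close> that works in all extensions.\<close>

lemma forces_countable_choice:
  assumes W: "world T" and B: "wff [s, NAT] B" "fv B \<subseteq> lang T"
    and ex: "\<And>T' n. T' \<in> exts T \<Longrightarrow> n \<in> D T' NAT \<Longrightarrow>
      \<exists>y \<in> D T' s. T' \<tturnstile> open_fm 0 y (open_fm 1 n B)"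
  obtains g where "g \<in> D T (FUN NAT s)"
    "\<And>T' n. T' \<in> exts T \<Longrightarrow> n \<in> D T' NAT \<Longrightarrow> T' \<tturnstile> open_fm 0 (g \<cdot> n) (open_fm 1 n B)"
proof -
  have wff1: "wff [s] (open_fm 1 n B)" if "n \<in> Tm NAT" for n
    using wff_open[of "[s]" NAT B n 1] B(1) that by simp
  have total: "T \<tturnstile> All NAT (Ex s B)"
    unfolding forces_all[OF W]
  proof (intro HOL.conjI ballI)
    fix T' n assume T': "T' \<in> exts T" and n: "n \<in> D T' NAT"
    have "fv (open_fm 1 n B) \<subseteq> lang T'"
      using fv_open_upper[of 1 n B] B(2) lang_mono[OF T'] D_fv_tm[OF n] by blast
    then show "T' \<tturnstile> open_fm 0 n (Ex s B)"
      using ex[OF T' n] wff1[OF D_Tm[OF n]] by (simp add: forces_ex[OF extsD[OF T']])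
  qed (use B in auto)
  \<comment> \<open>Fresh names for argument, value and function are needed because the axiom is
    formulated with named variables.\<close>
  obtain v where v: "snd v = NAT" "v \<notin> lang T"
    using fresh_for_world[OF W, of "{}" NAT] by blast
  obtain w where w: "snd w = s" "w \<notin> lang T" "w \<noteq> v"
    using fresh_for_world[OF W, of "{v}" s] by blast
  obtain f where f: "snd f = FUN NAT s" "f \<notin> lang T" "f \<noteq> v" "f \<noteq> w"
    using fresh_for_world[OF W, of "{v, w}" "FUN NAT s"] by blast
  have vwfB: "v \<notin> fv B" "w \<notin> fv B" "f \<notin> fv B" using v w f B(2) by blast+
  define B' where "B' = open_fm 1 (Fv v) B"
  have Tms: "Fv v \<in> Tm NAT" "Fv w \<in> Tm s" "Fv f \<cdot> Fv v \<in> Tm s"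
    using v w f by (auto simp: Tm_def)
  have B': "wff [s] B'" "w \<notin> fv B'" "f \<notin> fv B'" "close 1 v B' = B"
    using wff1[OF Tms(1)] fv_open_upper[of 1 "Fv v" B] vwfB w f
    by (auto simp: B'_def close_open)
  let ?A = "open_fm 0 (Fv w) B'"
  have "T \<turnstile> \<^bold>\<forall>v. \<^bold>\<exists>w. ?A"
    using total v w B' by (simp add: all_fm_def ex_fm_def close_open forces_def)
  moreover have "f \<notin> fv ?A" using fv_open_upper[of 0 "Fv w" B'] B' f by auto
  ultimately have "T \<turnstile> \<^bold>\<exists>f. \<^bold>\<forall>v. subst w (Fv f \<cdot> Fv v) ?A"
    using v w f wff_open0[OF B'(1) Tms(2)] by (intro countable_choice) auto
  then have chosen: "T \<turnstile> \<^bold>\<exists>f. \<^bold>\<forall>v. open_fm 0 (Fv f \<cdot> Fv v) B'"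
    using B' by (simp add: subst_open)
  let ?E = "open_fm 0 (Fv f \<cdot> Fv v) B'"
  have E: "?E \<in> Fm" using B' Tms by (auto intro: wff_open0)
  let ?C = "All NAT (close 0 v ?E)"
  have C: "?C \<in> Fm" using wff_close0[OF E, of v] v by (simp add: Fm_def)
  have "T \<turnstile> Ex (FUN NAT s) (close 0 f ?C)" using chosen v f by (simp add: ex_fm_def all_fm_def)
  moreover have "fv (close 0 f ?C) \<subseteq> lang T"
    unfolding fv_close fv.simps using fv_open_upper[of 0 "Fv f \<cdot> Fv v" B'] fv_open_upper[of 1 "Fv v" B] B(2)
    by (auto simp: B'_def)
  ultimately have "T \<tturnstile> Ex (FUN NAT s) (close 0 f ?C)"
    using wff_close0[OF C, of f] f by (simp add: forces_def Form_simps)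
  then obtain g where g: "g \<in> D T (FUN NAT s)" "T \<tturnstile> open_fm 0 g (close 0 f ?C)"
    using forces_ex[OF W] by blast
  have vg: "v \<notin> fv_tm g" using v D_fv_tm[OF g(1)] by blast
  have gT: "g \<in> Tm (FUN NAT s)" using D_Tm[OF g(1)] .
  \<comment> \<open>Substituting \<open>g\<close> for \<open>f\<close> passes under the quantifier,
    since \<open>v\<close> does not occur in \<open>g\<close>.\<close>
  have "open_fm 0 g (close 0 f ?C) = All NAT (close 0 v (subst f g ?E))"
    using open_close[of "[]" ?C 0 g f] C f(3) vg by (simp add: Fm_def subst_close)
  moreover have E': "subst f g ?E = open_fm 0 (g \<cdot> Fv v) B'"
    using subst_open_commute[OF gT] B' f by (simp add: subst_fresh)
  ultimately have all: "T \<tturnstile> All NAT (close 0 v (open_fm 0 (g \<cdot> Fv v) B'))" using g(2) by simp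
  have gv: "g \<cdot> Fv v \<in> Tm s" using gT v by (simp add: Tm_def)
  show thesis
  proof (rule that[OF g(1)])
    fix T' n assume T': "T' \<in> exts T" and n: "n \<in> D T' NAT"
    have "T' \<tturnstile> open_fm 0 n (close 0 v (open_fm 0 (g \<cdot> Fv v) B'))"
      using all T' n forces_all[OF W] by blast
    also have "open_fm 0 n (close 0 v (open_fm 0 (g \<cdot> Fv v) B')) = subst v n (open_fm 0 (g \<cdot> Fv v) B')"
      using wff_open0[OF B'(1) gv] by (simp add: open_close Fm_def)
    also have "\<dots> = open_fm 0 (g \<cdot> n) (open_fm 1 n B)"
      using subst_open_commute[OF D_Tm[OF n]] vg vwfB D_open_tm[OF n]
      by (simp add: B'_def subst_tm_fresh subst_fresh)
    finally show "T' \<tturnstile> open_fm 0 (g \<cdot> n) (open_fm 1 n B)" .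
  qed
qed

section \<open>Arithmetic in a world\<close>

lemma D_app: "f \<in> D T (FUN s t) \<Longrightarrow> x \<in> D T s \<Longrightarrow> f \<cdot> x \<in> D T t"
  by (simp add: D_def Tm_def)

lemma D_Cst: "cst_srt c = s \<Longrightarrow> Cst c \<in> D T s"
  by (simp add: D_def Tm_def)

lemma D_const [simp]:
  "Cst NZero \<in> D T NAT" "\<^bold>0 \<in> D T REAL" "\<^bold>1 \<in> D T REAL"
  "Cst NSuc \<cdot> m \<in> D T NAT \<longleftrightarrow> m \<in> D T NAT"
  "m \<^bold>+\<^sub>N n \<in> D T NAT \<longleftrightarrow> m \<in> D T NAT \<and> n \<in> D T NAT"
  "Cst OfNat \<cdot> m \<in> D T REAL \<longleftrightarrow> m \<in> D T NAT"
  "a \<^bold>+ b \<in> D T REAL \<longleftrightarrow> a \<in> D T REAL \<and> b \<in> D T REAL"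
  "a \<^bold>* b \<in> D T REAL \<longleftrightarrow> a \<in> D T REAL \<and> b \<in> D T REAL"
  "\<^bold>- a \<in> D T REAL \<longleftrightarrow> a \<in> D T REAL"
  by (auto simp: D_def Tm_def split: if_splits)

section \<open>Equality as a congruence inside a world\<close>

lemma forces_eqI: "T \<turnstile> t \<^bold>= u \<Longrightarrow> t \<in> D T s \<Longrightarrow> u \<in> D T s \<Longrightarrow> T \<tturnstile> t \<^bold>= u"
  by (auto simp: forces_def Form_simps)

lemma forces_eq_D: "T \<tturnstile> t \<^bold>= u \<Longrightarrow> t \<in> D T s \<Longrightarrow> u \<in> D T s"
  by (auto simp: forces_def Form_simps D_def Tm_def)

lemma forces_eq_D': "T \<tturnstile> t \<^bold>= u \<Longrightarrow> u \<in> D T s \<Longrightarrow> t \<in> D T s"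
  by (auto simp: forces_def Form_simps D_def Tm_def)

lemma forces_eqE:
  assumes "T \<tturnstile> t \<^bold>= u"
  obtains s where "t \<in> D T s" "u \<in> D T s"
  using assms by (auto simp: forces_def Form_simps)

lemmas D_simps [simp] = D_srt_of D_fv_tm D_open_tm

lemma forces_less_D: "T \<tturnstile> a \<^bold>< b \<Longrightarrow> a \<in> D T REAL \<and> b \<in> D T REAL"
  by (auto simp: forces_def Form_simps)

lemma forces_refl: "t \<in> D T s \<Longrightarrow> T \<tturnstile> t \<^bold>= t"
  by (meson D_Tm eq_refl forces_eqI)

lemma forces_subst:
  assumes "T \<tturnstile> t \<^bold>= u" "T \<tturnstile> open_fm 0 t B" "t \<in> D T s" "wff [s] B" "fv B \<subseteq> lang T"
  shows "T \<tturnstile> open_fm 0 u B"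
proof -
  obtain v where v: "snd v = s" "v \<notin> fv B" using ex_fresh by (metis finite_fv)
  have u: "u \<in> D T s" using assms forces_eq_D by blast
  have A: "open_fm 0 (Fv v) B \<in> Fm" using v assms(4) Fv_Tm[of v] by (auto intro: wff_open0)
  have "T \<turnstile> subst v u (open_fm 0 (Fv v) B)"
    by (rule eq_subst[where t = t])
       (use assms u v A D_Tm in \<open>auto simp: subst_open forces_def\<close>)
  then show ?thesis using assms u v by (simp add: subst_open forces_def Form_open)
qed

lemma forces_sym: "T \<tturnstile> t \<^bold>= u \<Longrightarrow> T \<tturnstile> u \<^bold>= t"
proof -
  assume tu: "T \<tturnstile> t \<^bold>= u"
  then obtain s where s: "t \<in> D T s" "u \<in> D T s" by (rule forces_eqE)
  show ?thesis
    using forces_subst[OF tu, of "Bv 0 \<^bold>= t" s] s forces_refl[OF s(1)] by simp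
qed

lemma forces_trans [trans]: "T \<tturnstile> t \<^bold>= u \<Longrightarrow> T \<tturnstile> u \<^bold>= v \<Longrightarrow> T \<tturnstile> t \<^bold>= v"
proof -
  assume tu: "T \<tturnstile> t \<^bold>= u" and uv: "T \<tturnstile> u \<^bold>= v"
  obtain s where s: "t \<in> D T s" "u \<in> D T s" using tu by (rule forces_eqE)
  have "v \<in> D T s" using uv s forces_eq_D by blast
  then show ?thesis
    using forces_subst[OF uv, of "t \<^bold>= Bv 0" s] s tu by simp
qed

lemma forces_app:
  assumes "T \<tturnstile> f \<^bold>= g" "T \<tturnstile> x \<^bold>= y" "f \<in> D T (FUN s t)" "x \<in> D T s"
  shows "T \<tturnstile> f \<cdot> x \<^bold>= g \<cdot> y"
proof -
  have D: "g \<in> D T (FUN s t)" "y \<in> D T s" using assms forces_eq_D by blast+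
  have fx: "f \<cdot> x \<in> D T t" using assms D_app by blast
  have "T \<tturnstile> f \<cdot> x \<^bold>= g \<cdot> x"
    using forces_subst[OF assms(1), of "f \<cdot> x \<^bold>= Bv 0 \<cdot> x" "FUN s t"] assms forces_refl[OF fx]
    by simp
  moreover have "T \<tturnstile> g \<cdot> x \<^bold>= g \<cdot> y"
    using forces_subst[OF assms(2), of "g \<cdot> x \<^bold>= g \<cdot> Bv 0" s] assms D
      forces_refl[OF D_app[OF D(1) assms(4)]] by simp
  ultimately show ?thesis by (rule forces_trans)
qed

lemma forces_less_cong:
  assumes "T \<tturnstile> a \<^bold>< b" "T \<tturnstile> a \<^bold>= a'" "T \<tturnstile> b \<^bold>= b'"
  shows "T \<tturnstile> a' \<^bold>< b'"
proof -
  have D: "a \<in> D T REAL" "b \<in> D T REAL" using assms(1) forces_less_D by blast+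
  then have D': "a' \<in> D T REAL" "b' \<in> D T REAL" using assms forces_eq_D by blast+
  have "T \<tturnstile> a' \<^bold>< b"
    using forces_subst[OF assms(2), of "Bv 0 \<^bold>< b" REAL] assms D by simp
  then show ?thesis
    using forces_subst[OF assms(3), of "a' \<^bold>< Bv 0" REAL] D D' by simp
qed

lemma forces_less_eq [trans]: "T \<tturnstile> a \<^bold>< b \<Longrightarrow> T \<tturnstile> b \<^bold>= c \<Longrightarrow> T \<tturnstile> a \<^bold>< c"
  using forces_less_cong[OF _ forces_refl] forces_less_D by blast

lemma forces_eq_less [trans]: "T \<tturnstile> a \<^bold>= b \<Longrightarrow> T \<tturnstile> b \<^bold>< c \<Longrightarrow> T \<tturnstile> a \<^bold>< c"
  using forces_less_cong[OF _ forces_sym forces_refl] forces_less_D by blast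

lemma forces_cong_op:
  assumes "T \<tturnstile> a \<^bold>= a'" "T \<tturnstile> b \<^bold>= b'" "cst_srt c = FUN s (FUN t u)" "a \<in> D T s" "b \<in> D T t"
  shows "T \<tturnstile> Cst c \<cdot> a \<cdot> b \<^bold>= Cst c \<cdot> a' \<cdot> b'"
proof -
  have "Cst c \<in> D T (FUN s (FUN t u))" using assms(3) by (rule D_Cst)
  then show ?thesis
    using forces_app[OF forces_app[OF forces_refl assms(1)] assms(2)] D_app assms(4,5) by metis
qed

lemma forces_suc_cong:
  assumes "T \<tturnstile> m \<^bold>= n" "m \<in> D T NAT"
  shows "T \<tturnstile> Cst NSuc \<cdot> m \<^bold>= Cst NSuc \<cdot> n"
proof -
  have "Cst NSuc \<in> D T (FUN NAT NAT)" by (rule D_Cst) simp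
  then show ?thesis using forces_app[OF forces_refl assms(1)] assms(2) by blast
qed

subsection \<open>Natural numbers\<close>

lemma forces_nadd_zero: "m \<in> D T NAT \<Longrightarrow> T \<tturnstile> m \<^bold>+\<^sub>N Cst NZero \<^bold>= m"
  by (rule forces_eqI[OF nadd_zero, where s = NAT]) (simp_all add: D_Tm)

lemma forces_nadd_suc:
  "m \<in> D T NAT \<Longrightarrow> n \<in> D T NAT \<Longrightarrow> T \<tturnstile> m \<^bold>+\<^sub>N (Cst NSuc \<cdot> n) \<^bold>= Cst NSuc \<cdot> (m \<^bold>+\<^sub>N n)"
  by (rule forces_eqI[OF nadd_suc, where s = NAT]) (simp_all add: D_Tm)

lemma forces_suc_inj:
  assumes "T \<tturnstile> Cst NSuc \<cdot> m \<^bold>= Cst NSuc \<cdot> n" "m \<in> D T NAT"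
  shows "T \<tturnstile> m \<^bold>= n"
proof -
  have n: "n \<in> D T NAT" using forces_eq_D[OF assms(1), of NAT] assms(2) by simp
  show ?thesis
    using impE[OF suc_inj] assms n by (intro forces_eqI[where s = NAT]) (auto simp: forces_def dest: D_Tm)
qed

lemma forces_suc_not_zero:
  assumes "world T"
  shows "\<not> (T \<tturnstile> Cst NSuc \<cdot> m \<^bold>= Cst NZero)"
proof
  assume *: "T \<tturnstile> Cst NSuc \<cdot> m \<^bold>= Cst NZero"
  then have "m \<in> Tm NAT" using forces_eq_D'[OF *, of NAT] D_Tm by simp
  then have "T \<turnstile> \<^bold>\<bottom>" using * impE[OF suc_not_zero] by (auto simp: forces_def)
  with assms show False by (simp add: world_def)
qed

lemma forces_nat_induct:
  assumes "world T" "wff [NAT] B" "fv B \<subseteq> lang T" "n \<in> D T NAT"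
    and "T \<tturnstile> open_fm 0 (Cst NZero) B"
    and "\<And>T' n. T' \<in> exts T \<Longrightarrow> n \<in> D T' NAT \<Longrightarrow> T' \<tturnstile> open_fm 0 n B \<Longrightarrow>
      T' \<tturnstile> open_fm 0 (Cst NSuc \<cdot> n) B"
  shows "T \<tturnstile> open_fm 0 n B"
  using forces_induct[OF assms(1-3,5,6)] assms(4) world_exts[OF assms(1)]
  unfolding forces_all[OF assms(1)] by blast

lemma forces_zero_nadd:
  assumes "world T" "n \<in> D T NAT"
  shows "T \<tturnstile> Cst NZero \<^bold>+\<^sub>N n \<^bold>= n"
proof -
  have "T \<tturnstile> open_fm 0 n (Cst NZero \<^bold>+\<^sub>N Bv 0 \<^bold>= Bv 0)"
  proof (rule forces_nat_induct[OF assms(1) _ _ assms(2)])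
    fix T' n assume "n \<in> D T' NAT" "T' \<tturnstile> open_fm 0 n (Cst NZero \<^bold>+\<^sub>N Bv 0 \<^bold>= Bv 0)"
    then show "T' \<tturnstile> open_fm 0 (Cst NSuc \<cdot> n) (Cst NZero \<^bold>+\<^sub>N Bv 0 \<^bold>= Bv 0)"
      by (auto intro: forces_trans[OF forces_nadd_suc forces_suc_cong])
  qed (auto intro: forces_nadd_zero)
  then show ?thesis by simp
qed

lemma forces_suc_nadd:
  assumes "world T" "m \<in> D T NAT" "n \<in> D T NAT"
  shows "T \<tturnstile> Cst NSuc \<cdot> m \<^bold>+\<^sub>N n \<^bold>= Cst NSuc \<cdot> (m \<^bold>+\<^sub>N n)"
proof -
  let ?B = "Cst NSuc \<cdot> m \<^bold>+\<^sub>N Bv 0 \<^bold>= Cst NSuc \<cdot> (m \<^bold>+\<^sub>N Bv 0)"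
  have "T \<tturnstile> open_fm 0 n ?B"
  proof (rule forces_nat_induct[OF assms(1) _ _ assms(3)])
    have "T \<tturnstile> Cst NSuc \<cdot> m \<^bold>+\<^sub>N Cst NZero \<^bold>= Cst NSuc \<cdot> m" using assms by (simp add: forces_nadd_zero)
    also have "T \<tturnstile> Cst NSuc \<cdot> m \<^bold>= Cst NSuc \<cdot> (m \<^bold>+\<^sub>N Cst NZero)"
      using assms by (intro forces_suc_cong forces_sym[OF forces_nadd_zero])
    finally show "T \<tturnstile> open_fm 0 (Cst NZero) ?B" using assms by simp
  next
    fix T' n assume T': "T' \<in> exts T" and n: "n \<in> D T' NAT" and IH: "T' \<tturnstile> open_fm 0 n ?B"
    have m: "m \<in> D T' NAT" using assms(2) T' by (rule D_mono)
    have "T' \<tturnstile> Cst NSuc \<cdot> m \<^bold>+\<^sub>N (Cst NSuc \<cdot> n) \<^bold>= Cst NSuc \<cdot> (Cst NSuc \<cdot> m \<^bold>+\<^sub>N n)"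
      using m n by (simp add: forces_nadd_suc)
    also have "T' \<tturnstile> Cst NSuc \<cdot> (Cst NSuc \<cdot> m \<^bold>+\<^sub>N n) \<^bold>= Cst NSuc \<cdot> (Cst NSuc \<cdot> (m \<^bold>+\<^sub>N n))"
      using m n IH by (intro forces_suc_cong) auto
    also have "T' \<tturnstile> Cst NSuc \<cdot> (Cst NSuc \<cdot> (m \<^bold>+\<^sub>N n)) \<^bold>= Cst NSuc \<cdot> (m \<^bold>+\<^sub>N (Cst NSuc \<cdot> n))"
      using m n by (intro forces_suc_cong forces_sym[OF forces_nadd_suc]) auto
    finally show "T' \<tturnstile> open_fm 0 (Cst NSuc \<cdot> n) ?B" using m n by simp
  qed (use assms in auto)
  then show ?thesis using assms by simp
qed

lemma forces_nadd_assoc: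
  assumes "world T" "l \<in> D T NAT" "m \<in> D T NAT" "n \<in> D T NAT"
  shows "T \<tturnstile> l \<^bold>+\<^sub>N m \<^bold>+\<^sub>N n \<^bold>= l \<^bold>+\<^sub>N (m \<^bold>+\<^sub>N n)"
proof -
  let ?B = "l \<^bold>+\<^sub>N m \<^bold>+\<^sub>N Bv 0 \<^bold>= l \<^bold>+\<^sub>N (m \<^bold>+\<^sub>N Bv 0)"
  have "T \<tturnstile> open_fm 0 n ?B"
  proof (rule forces_nat_induct[OF assms(1) _ _ assms(4)])
    have "T \<tturnstile> l \<^bold>+\<^sub>N m \<^bold>+\<^sub>N Cst NZero \<^bold>= l \<^bold>+\<^sub>N m" using assms by (simp add: forces_nadd_zero)
    also have "T \<tturnstile> l \<^bold>+\<^sub>N m \<^bold>= l \<^bold>+\<^sub>N (m \<^bold>+\<^sub>N Cst NZero)"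
      using assms by (intro forces_cong_op[OF forces_refl forces_sym[OF forces_nadd_zero]]) auto
    finally show "T \<tturnstile> open_fm 0 (Cst NZero) ?B" using assms by simp
  next
    fix T' n assume T': "T' \<in> exts T" and n: "n \<in> D T' NAT" and IH: "T' \<tturnstile> open_fm 0 n ?B"
    have lm: "l \<in> D T' NAT" "m \<in> D T' NAT" using assms(2,3) T' by (auto intro: D_mono)
    have "T' \<tturnstile> l \<^bold>+\<^sub>N m \<^bold>+\<^sub>N (Cst NSuc \<cdot> n) \<^bold>= Cst NSuc \<cdot> (l \<^bold>+\<^sub>N m \<^bold>+\<^sub>N n)"
      using lm n by (simp add: forces_nadd_suc)
    also have "T' \<tturnstile> Cst NSuc \<cdot> (l \<^bold>+\<^sub>N m \<^bold>+\<^sub>N n) \<^bold>= Cst NSuc \<cdot> (l \<^bold>+\<^sub>N (m \<^bold>+\<^sub>N n))"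
      using lm n IH by (intro forces_suc_cong) auto
    also have "T' \<tturnstile> Cst NSuc \<cdot> (l \<^bold>+\<^sub>N (m \<^bold>+\<^sub>N n)) \<^bold>= l \<^bold>+\<^sub>N (Cst NSuc \<cdot> (m \<^bold>+\<^sub>N n))"
      using lm n by (intro forces_sym[OF forces_nadd_suc]) auto
    also have "T' \<tturnstile> l \<^bold>+\<^sub>N (Cst NSuc \<cdot> (m \<^bold>+\<^sub>N n)) \<^bold>= l \<^bold>+\<^sub>N (m \<^bold>+\<^sub>N (Cst NSuc \<cdot> n))"
      using lm n by (intro forces_cong_op[OF forces_refl forces_sym[OF forces_nadd_suc]]) auto
    finally show "T' \<tturnstile> open_fm 0 (Cst NSuc \<cdot> n) ?B" using lm n by simp
  qed (use assms in auto)
  then show ?thesis using assms by simp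
qed

text \<open>Induction serves as case analysis here; primeness and the witness property turn the
  forced disjunction into a HOL one, also for elements that are not numerals.\<close>

lemma forces_nat_cases:
  assumes "world T" "n \<in> D T NAT"
  shows "(T \<tturnstile> n \<^bold>= Cst NZero) \<or> (\<exists>k \<in> D T NAT. T \<tturnstile> n \<^bold>= Cst NSuc \<cdot> k)"
proof -
  let ?B = "Bv 0 \<^bold>= Cst NZero \<^bold>\<or> Ex NAT (Bv 1 \<^bold>= Cst NSuc \<cdot> Bv 0)"
  have "T \<tturnstile> open_fm 0 n ?B"
  proof (rule forces_nat_induct[OF assms(1) _ _ assms(2)])
    show "T \<tturnstile> open_fm 0 (Cst NZero) ?B"
      using assms(1) forces_refl[OF D_const(1), of T] by (auto simp: forces_disj Form_simps intro!: HOL.exI[of _ NAT])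
  next
    fix T' n assume T': "T' \<in> exts T" and n: "n \<in> D T' NAT"
    have "T' \<tturnstile> Cst NSuc \<cdot> n \<^bold>= Cst NSuc \<cdot> n" using n by (intro forces_refl[where s = NAT]) simp
    then show "T' \<tturnstile> open_fm 0 (Cst NSuc \<cdot> n) ?B"
      using n extsD[OF T']
      by (auto simp: forces_disj forces_ex Form_simps intro!: HOL.exI[of _ NAT])
  qed auto
  then show ?thesis using assms by (auto simp: forces_disj forces_ex)
qed

text \<open>Only meant for arguments without dangling indices.\<close>

abbreviation nle :: "tm \<Rightarrow> tm \<Rightarrow> fm"  (infix "\<preceq>" 55) where
  "m \<preceq> n \<equiv> Ex NAT (n \<^bold>= m \<^bold>+\<^sub>N Bv 0)"

lemma forces_nle:
  assumes "world T" "m \<in> D T NAT" "n \<in> D T NAT"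
  shows "(T \<tturnstile> m \<preceq> n) \<longleftrightarrow> (\<exists>k \<in> D T NAT. T \<tturnstile> n \<^bold>= m \<^bold>+\<^sub>N k)"
  using assms by (simp add: forces_ex)

lemma nle_refl:
  assumes "world T" "n \<in> D T NAT"
  shows "T \<tturnstile> n \<preceq> n"
  using forces_nle[OF assms assms(2)] forces_sym[OF forces_nadd_zero[OF assms(2)]] D_const(1) by blast

lemma zero_nle:
  assumes "world T" "n \<in> D T NAT"
  shows "T \<tturnstile> Cst NZero \<preceq> n"
  using forces_nle[OF assms(1) D_const(1) assms(2)] forces_sym[OF forces_zero_nadd[OF assms]] assms(2)
  by blast

lemma nle_trans:
  assumes "world T" "l \<in> D T NAT" "m \<in> D T NAT" "n \<in> D T NAT" "T \<tturnstile> l \<preceq> m" "T \<tturnstile> m \<preceq> n"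
  shows "T \<tturnstile> l \<preceq> n"
proof -
  obtain j k where j: "j \<in> D T NAT" "T \<tturnstile> m \<^bold>= l \<^bold>+\<^sub>N j" and k: "k \<in> D T NAT" "T \<tturnstile> n \<^bold>= m \<^bold>+\<^sub>N k"
    using assms by (auto simp: forces_nle)
  note k(2)
  also have "T \<tturnstile> m \<^bold>+\<^sub>N k \<^bold>= l \<^bold>+\<^sub>N j \<^bold>+\<^sub>N k"
    using assms j k by (intro forces_cong_op[OF j(2) forces_refl]) auto
  also have "T \<tturnstile> l \<^bold>+\<^sub>N j \<^bold>+\<^sub>N k \<^bold>= l \<^bold>+\<^sub>N (j \<^bold>+\<^sub>N k)" using assms j k by (simp add: forces_nadd_assoc)
  finally show ?thesis using assms j k by (auto simp: forces_nle intro!: bexI[of _ "j \<^bold>+\<^sub>N k"])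
qed

lemma nle_cases:
  assumes "world T" "m \<in> D T NAT" "n \<in> D T NAT" "T \<tturnstile> m \<preceq> n"
  shows "(T \<tturnstile> m \<^bold>= n) \<or> (T \<tturnstile> Cst NSuc \<cdot> m \<preceq> n)"
proof -
  obtain k where k: "k \<in> D T NAT" "T \<tturnstile> n \<^bold>= m \<^bold>+\<^sub>N k" using assms by (auto simp: forces_nle)
  show ?thesis
    using forces_nat_cases[OF assms(1) k(1)]
  proof
    assume "T \<tturnstile> k \<^bold>= Cst NZero"
    note k(2)
    also have "T \<tturnstile> m \<^bold>+\<^sub>N k \<^bold>= m \<^bold>+\<^sub>N Cst NZero"
      using assms k \<open>T \<tturnstile> k \<^bold>= Cst NZero\<close> by (intro forces_cong_op[OF forces_refl]) auto
    also have "T \<tturnstile> m \<^bold>+\<^sub>N Cst NZero \<^bold>= m" using assms by (simp add: forces_nadd_zero)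
    finally show ?thesis using forces_sym by blast
  next
    assume "\<exists>j \<in> D T NAT. T \<tturnstile> k \<^bold>= Cst NSuc \<cdot> j"
    then obtain j where j: "j \<in> D T NAT" "T \<tturnstile> k \<^bold>= Cst NSuc \<cdot> j" by blast
    note k(2)
    also have "T \<tturnstile> m \<^bold>+\<^sub>N k \<^bold>= m \<^bold>+\<^sub>N (Cst NSuc \<cdot> j)"
      using assms k j by (intro forces_cong_op[OF forces_refl]) auto
    also have "T \<tturnstile> m \<^bold>+\<^sub>N (Cst NSuc \<cdot> j) \<^bold>= Cst NSuc \<cdot> (m \<^bold>+\<^sub>N j)"
      using assms j by (simp add: forces_nadd_suc)
    also have "T \<tturnstile> Cst NSuc \<cdot> (m \<^bold>+\<^sub>N j) \<^bold>= Cst NSuc \<cdot> m \<^bold>+\<^sub>N j"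
      using assms j by (intro forces_sym[OF forces_suc_nadd]) auto
    finally show ?thesis using assms j by (auto simp: forces_nle)
  qed
qed

lemma nle_suc: "world T \<Longrightarrow> n \<in> D T NAT \<Longrightarrow> T \<tturnstile> n \<preceq> Cst NSuc \<cdot> n"
proof -
  assume *: "world T" "n \<in> D T NAT"
  have "T \<tturnstile> n \<^bold>+\<^sub>N (Cst NSuc \<cdot> Cst NZero) \<^bold>= Cst NSuc \<cdot> (n \<^bold>+\<^sub>N Cst NZero)"
    using * by (simp add: forces_nadd_suc)
  also have "T \<tturnstile> Cst NSuc \<cdot> (n \<^bold>+\<^sub>N Cst NZero) \<^bold>= Cst NSuc \<cdot> n"
    using * by (intro forces_suc_cong forces_nadd_zero) auto
  finally have "T \<tturnstile> Cst NSuc \<cdot> n \<^bold>= n \<^bold>+\<^sub>N (Cst NSuc \<cdot> Cst NZero)" by (rule forces_sym)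
  then show ?thesis using * by (auto simp: forces_nle intro!: bexI[of _ "Cst NSuc \<cdot> Cst NZero"])
qed

lemma suc_nle_suc:
  assumes "world T" "m \<in> D T NAT" "n \<in> D T NAT"
  shows "(T \<tturnstile> Cst NSuc \<cdot> m \<preceq> Cst NSuc \<cdot> n) \<longleftrightarrow> (T \<tturnstile> m \<preceq> n)"
proof -
  have "(T \<tturnstile> Cst NSuc \<cdot> n \<^bold>= Cst NSuc \<cdot> m \<^bold>+\<^sub>N k) \<longleftrightarrow> (T \<tturnstile> n \<^bold>= m \<^bold>+\<^sub>N k)" if k: "k \<in> D T NAT" for k
  proof
    assume "T \<tturnstile> Cst NSuc \<cdot> n \<^bold>= Cst NSuc \<cdot> m \<^bold>+\<^sub>N k"
    also have "T \<tturnstile> Cst NSuc \<cdot> m \<^bold>+\<^sub>N k \<^bold>= Cst NSuc \<cdot> (m \<^bold>+\<^sub>N k)"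
      using assms k by (simp add: forces_suc_nadd)
    finally show "T \<tturnstile> n \<^bold>= m \<^bold>+\<^sub>N k" using assms(3) by (rule forces_suc_inj)
  next
    assume "T \<tturnstile> n \<^bold>= m \<^bold>+\<^sub>N k"
    then have "T \<tturnstile> Cst NSuc \<cdot> n \<^bold>= Cst NSuc \<cdot> (m \<^bold>+\<^sub>N k)" using assms by (intro forces_suc_cong)
    also have "T \<tturnstile> Cst NSuc \<cdot> (m \<^bold>+\<^sub>N k) \<^bold>= Cst NSuc \<cdot> m \<^bold>+\<^sub>N k"
      using assms k by (intro forces_sym[OF forces_suc_nadd])
    finally show "T \<tturnstile> Cst NSuc \<cdot> n \<^bold>= Cst NSuc \<cdot> m \<^bold>+\<^sub>N k" .
  qed
  then show ?thesis using assms by (simp add: forces_nle)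
qed

lemma not_suc_nle_zero:
  assumes "world T" "m \<in> D T NAT"
  shows "\<not> (T \<tturnstile> Cst NSuc \<cdot> m \<preceq> Cst NZero)"
proof
  assume "T \<tturnstile> Cst NSuc \<cdot> m \<preceq> Cst NZero"
  then obtain k where k: "k \<in> D T NAT" "T \<tturnstile> Cst NZero \<^bold>= Cst NSuc \<cdot> m \<^bold>+\<^sub>N k"
    using assms by (auto simp: forces_nle)
  note k(2)
  also have "T \<tturnstile> Cst NSuc \<cdot> m \<^bold>+\<^sub>N k \<^bold>= Cst NSuc \<cdot> (m \<^bold>+\<^sub>N k)"
    using assms k by (simp add: forces_suc_nadd)
  finally show False using forces_sym forces_suc_not_zero[OF assms(1)] by blast
qed

lemma suc_nle_suc_cases:
  assumes "world T" "m \<in> D T NAT" "n \<in> D T NAT" "T \<tturnstile> Cst NSuc \<cdot> m \<preceq> Cst NSuc \<cdot> n"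
  shows "(T \<tturnstile> m \<^bold>= n) \<or> (T \<tturnstile> Cst NSuc \<cdot> m \<preceq> n)"
  using nle_cases[OF assms(1-3)] suc_nle_suc[OF assms(1-3)] assms(4) by blast

text \<open>Proved by induction on \<open>m\<close> inside the world, because both alternatives must
  be forced in order to persist. A classical split on whether \<open>m \<preceq> n\<close> is forced
  would only concern the present world.\<close>

lemma nle_linear:
  assumes "world T" "m \<in> D T NAT" "n \<in> D T NAT"
  shows "(T \<tturnstile> m \<preceq> n) \<or> (T \<tturnstile> Cst NSuc \<cdot> n \<preceq> m)"
proof -
  let ?B = "Ex NAT (n \<^bold>= Bv 1 \<^bold>+\<^sub>N Bv 0) \<^bold>\<or> Ex NAT (Bv 1 \<^bold>= Cst NSuc \<cdot> n \<^bold>+\<^sub>N Bv 0)"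
  have "T \<tturnstile> open_fm 0 m ?B"
  proof (rule forces_nat_induct[OF assms(1) _ _ assms(2)])
    show "T \<tturnstile> open_fm 0 (Cst NZero) ?B"
      using assms zero_nle[OF assms(1,3)] by (simp add: forces_disj Form_simps)
  next
    fix T' m assume T': "T' \<in> exts T" and m: "m \<in> D T' NAT" and IH: "T' \<tturnstile> open_fm 0 m ?B"
    have n: "n \<in> D T' NAT" using assms(3) T' by (rule D_mono)
    have W: "world T'" using extsD[OF T'] .
    have "(T' \<tturnstile> m \<preceq> n) \<or> (T' \<tturnstile> Cst NSuc \<cdot> n \<preceq> m)" using IH m n W by (simp add: forces_disj)
    then have "(T' \<tturnstile> Cst NSuc \<cdot> m \<preceq> n) \<or> (T' \<tturnstile> Cst NSuc \<cdot> n \<preceq> Cst NSuc \<cdot> m)"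
    proof
      assume "T' \<tturnstile> m \<preceq> n"
      then consider "T' \<tturnstile> m \<^bold>= n" | "T' \<tturnstile> Cst NSuc \<cdot> m \<preceq> n" using nle_cases[OF W m n] by blast
      then show ?thesis
      proof cases
        case 1
        then have "T' \<tturnstile> n \<preceq> m"
          using forces_trans[OF 1 forces_sym[OF forces_nadd_zero[OF n]]] forces_nle[OF W n m]
            D_const(1) by blast
        then show ?thesis using suc_nle_suc[OF W n m] by blast
      qed blast
    next
      assume "T' \<tturnstile> Cst NSuc \<cdot> n \<preceq> m"
      then show ?thesis using nle_trans[OF W _ _ _ _ nle_suc[OF W m]] m n by (metis D_const(4))
    qed
    then show "T' \<tturnstile> open_fm 0 (Cst NSuc \<cdot> m) ?B"
      using m n W forces_Form[of T'] by (auto simp: forces_disj Form_simps)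
  qed (use assms in auto)
  then show ?thesis using assms by (simp add: forces_disj)
qed

text \<open>The negation enters the induction formula as an implication, so that the hypothesis
  covers all extensions; the step strips one successor with \<open>suc_nle_suc\<close>.\<close>

lemma not_suc_nle_self:
  assumes "world T" "n \<in> D T NAT"
  shows "\<not> (T \<tturnstile> Cst NSuc \<cdot> n \<preceq> n)"
proof -
  let ?B = "Ex NAT (Bv 1 \<^bold>= Cst NSuc \<cdot> Bv 1 \<^bold>+\<^sub>N Bv 0) \<^bold>\<longrightarrow> \<^bold>\<bottom>"
  have "T \<tturnstile> open_fm 0 n ?B"
  proof (rule forces_nat_induct[OF assms(1) _ _ assms(2)])
    have "\<not> (T' \<tturnstile> Cst NSuc \<cdot> Cst NZero \<preceq> Cst NZero)" if "T' \<in> exts T" for T'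
      using not_suc_nle_zero[OF extsD[OF that]] by simp
    then show "T \<tturnstile> open_fm 0 (Cst NZero) ?B"
      using assms(1) by (simp add: forces_imp Form_simps)
  next
    fix T' n assume T': "T' \<in> exts T" and n: "n \<in> D T' NAT" and IH: "T' \<tturnstile> open_fm 0 n ?B"
    have "\<not> (T'' \<tturnstile> Cst NSuc \<cdot> n \<preceq> n)" if "T'' \<in> exts T'" for T''
      using IH that extsD[OF T'] n forces_bot[OF extsD[OF that]] by (simp add: forces_imp) blast
    then have "\<not> (T'' \<tturnstile> Cst NSuc \<cdot> (Cst NSuc \<cdot> n) \<preceq> Cst NSuc \<cdot> n)" if "T'' \<in> exts T'" for T''
      using that suc_nle_suc[OF extsD[OF that], of "Cst NSuc \<cdot> n" n] D_mono[OF n that] D_const(4)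
      by blast
    then show "T' \<tturnstile> open_fm 0 (Cst NSuc \<cdot> n) ?B"
      using n extsD[OF T'] by (simp add: forces_imp Form_simps)
  qed auto
  then show ?thesis
    using assms world_exts[OF assms(1)] forces_bot[OF assms(1)] by (simp add: forces_imp) blast
qed

subsection \<open>Real numbers\<close>

lemma forces_radd_assoc:
  "a \<in> D T REAL \<Longrightarrow> b \<in> D T REAL \<Longrightarrow> c \<in> D T REAL \<Longrightarrow> T \<tturnstile> (a \<^bold>+ b) \<^bold>+ c \<^bold>= a \<^bold>+ (b \<^bold>+ c)"
  by (rule forces_eqI[OF radd_assoc, where s = REAL]) (simp_all add: D_Tm)

lemma forces_radd_comm:
  "a \<in> D T REAL \<Longrightarrow> b \<in> D T REAL \<Longrightarrow> T \<tturnstile> a \<^bold>+ b \<^bold>= b \<^bold>+ a"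
  by (rule forces_eqI[OF radd_comm, where s = REAL]) (simp_all add: D_Tm)

lemma forces_radd_zero: "a \<in> D T REAL \<Longrightarrow> T \<tturnstile> a \<^bold>+ \<^bold>0 \<^bold>= a"
  by (rule forces_eqI[OF radd_zero, where s = REAL]) (simp_all add: D_Tm)

lemma forces_radd_neg: "a \<in> D T REAL \<Longrightarrow> T \<tturnstile> a \<^bold>+ (\<^bold>- a) \<^bold>= \<^bold>0"
  by (rule forces_eqI[OF radd_neg, where s = REAL]) (simp_all add: D_Tm)

lemma forces_rmul_comm:
  "a \<in> D T REAL \<Longrightarrow> b \<in> D T REAL \<Longrightarrow> T \<tturnstile> a \<^bold>* b \<^bold>= b \<^bold>* a"
  by (rule forces_eqI[OF rmul_comm, where s = REAL]) (simp_all add: D_Tm)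

lemma forces_rmul_one: "a \<in> D T REAL \<Longrightarrow> T \<tturnstile> a \<^bold>* \<^bold>1 \<^bold>= a"
  by (rule forces_eqI[OF rmul_one, where s = REAL]) (simp_all add: D_Tm)

lemma forces_rdistrib:
  "a \<in> D T REAL \<Longrightarrow> b \<in> D T REAL \<Longrightarrow> c \<in> D T REAL \<Longrightarrow> T \<tturnstile> a \<^bold>* (b \<^bold>+ c) \<^bold>= a \<^bold>* b \<^bold>+ a \<^bold>* c"
  by (rule forces_eqI[OF rdistrib, where s = REAL]) (simp_all add: D_Tm)

lemma forces_of_nat_zero: "T \<tturnstile> Cst OfNat \<cdot> Cst NZero \<^bold>= \<^bold>0"
  by (rule forces_eqI[OF of_nat_zero, where s = REAL]) simp_all

lemma forces_of_nat_suc: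
  "k \<in> D T NAT \<Longrightarrow> T \<tturnstile> Cst OfNat \<cdot> (Cst NSuc \<cdot> k) \<^bold>= Cst OfNat \<cdot> k \<^bold>+ \<^bold>1"
  by (rule forces_eqI[OF of_nat_suc, where s = REAL]) (simp_all add: D_Tm)

lemma forces_radd_cong:
  "T \<tturnstile> a \<^bold>= a' \<Longrightarrow> T \<tturnstile> b \<^bold>= b' \<Longrightarrow> a \<in> D T REAL \<Longrightarrow> b \<in> D T REAL \<Longrightarrow>
    T \<tturnstile> a \<^bold>+ b \<^bold>= a' \<^bold>+ b'"
  by (rule forces_cong_op[where s = REAL and t = REAL and u = REAL]) simp_all

lemma forces_rmul_cong:
  "T \<tturnstile> a \<^bold>= a' \<Longrightarrow> T \<tturnstile> b \<^bold>= b' \<Longrightarrow> a \<in> D T REAL \<Longrightarrow> b \<in> D T REAL \<Longrightarrow>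
    T \<tturnstile> a \<^bold>* b \<^bold>= a' \<^bold>* b'"
  by (rule forces_cong_op[where s = REAL and t = REAL and u = REAL]) simp_all

lemma forces_less_asym:
  assumes "world T" "T \<tturnstile> a \<^bold>< b"
  shows "\<not> (T \<tturnstile> b \<^bold>< a)"
proof
  assume "T \<tturnstile> b \<^bold>< a"
  then have "T \<turnstile> a \<^bold>< b \<^bold>\<and> b \<^bold>< a" using assms(2) conjI by (auto simp: forces_def)
  moreover have "T \<turnstile> \<^bold>\<not> (a \<^bold>< b \<^bold>\<and> b \<^bold>< a)"
    using forces_less_D[OF assms(2)] by (intro less_asym) (auto dest: D_Tm)
  ultimately have "T \<turnstile> \<^bold>\<bottom>" by (rule impE[rotated])
  with assms(1) show False by (simp add: world_def)
qed

lemma forces_less_cotrans: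
  assumes "world T" "T \<tturnstile> a \<^bold>< b" "c \<in> D T REAL"
  shows "(T \<tturnstile> a \<^bold>< c) \<or> (T \<tturnstile> c \<^bold>< b)"
proof -
  have D: "a \<in> D T REAL" "b \<in> D T REAL" using forces_less_D[OF assms(2)] by auto
  have "T \<turnstile> a \<^bold>< c \<^bold>\<or> c \<^bold>< b"
    using assms D by (intro impE[OF less_cotrans]) (auto simp: forces_def dest: D_Tm)
  then have "T \<tturnstile> a \<^bold>< c \<^bold>\<or> c \<^bold>< b" using assms D by (simp add: forces_def Form_simps)
  then show ?thesis using assms(1) by (simp add: forces_disj)
qed

text \<open>Cotransitivity compares \<open>c\<close> with the ends of \<open>a < b\<close>; the
  alternative \<open>c < b\<close> contradicts asymmetry.\<close>

lemma forces_less_trans [trans]: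
  assumes "T \<tturnstile> a \<^bold>< b" "T \<tturnstile> b \<^bold>< c" "world T"
  shows "T \<tturnstile> a \<^bold>< c"
  using forces_less_cotrans[OF assms(3,1)] forces_less_asym[OF assms(3,2)] forces_less_D[OF assms(2)]
  by blast

lemma forces_less_tight:
  assumes "world T" "a \<in> D T REAL" "b \<in> D T REAL"
    and "\<And>T'. T' \<in> exts T \<Longrightarrow> \<not> (T' \<tturnstile> a \<^bold>< b) \<and> \<not> (T' \<tturnstile> b \<^bold>< a)"
  shows "T \<tturnstile> a \<^bold>= b"
proof -
  have "T \<tturnstile> \<^bold>\<not> (a \<^bold>< b \<^bold>\<or> b \<^bold>< a)"
    using assms by (auto simp: forces_imp forces_disj[OF extsD] Form_simps)
  then have "T \<turnstile> a \<^bold>= b"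
    using assms by (intro impE[OF less_tight]) (auto simp: forces_def dest: D_Tm)
  then show ?thesis using assms by (intro forces_eqI)
qed

lemma forces_less_add:
  assumes "T \<tturnstile> a \<^bold>< b" "c \<in> D T REAL"
  shows "T \<tturnstile> a \<^bold>+ c \<^bold>< b \<^bold>+ c"
proof -
  have D: "a \<in> D T REAL" "b \<in> D T REAL" using forces_less_D[OF assms(1)] by auto
  have "T \<turnstile> a \<^bold>+ c \<^bold>< b \<^bold>+ c"
    using assms D by (intro impE[OF less_add]) (auto simp: forces_def dest: D_Tm)
  then show ?thesis using assms D by (simp add: forces_def Form_simps)
qed

lemma forces_less_mul:
  assumes "T \<tturnstile> \<^bold>0 \<^bold>< a" "T \<tturnstile> \<^bold>0 \<^bold>< b"
  shows "T \<tturnstile> \<^bold>0 \<^bold>< a \<^bold>* b"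
proof -
  have D: "a \<in> D T REAL" "b \<in> D T REAL" using assms forces_less_D by auto
  have "T \<turnstile> \<^bold>0 \<^bold>< a \<^bold>* b"
    using assms D by (intro impE[OF less_mul] conjI) (auto simp: forces_def dest: D_Tm)
  then show ?thesis using D by (simp add: forces_def Form_simps)
qed

lemma forces_inverse:
  assumes "world T" "T \<tturnstile> \<^bold>0 \<^bold>< a"
  obtains y where "y \<in> D T REAL" "T \<tturnstile> a \<^bold>* y \<^bold>= \<^bold>1"
proof -
  have a: "a \<in> D T REAL" using forces_less_D[OF assms(2)] by auto
  obtain v where v: "snd v = REAL" "v \<notin> fv_tm a" using ex_fresh by (metis finite_fv_tm)
  have "T \<turnstile> a \<^bold>< \<^bold>0 \<^bold>\<or> \<^bold>0 \<^bold>< a"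
    using assms(2) D_Tm[OF a] by (intro disjI2) (auto simp: forces_def Fm_def Tm_def)
  then have "T \<turnstile> \<^bold>\<exists>v. a \<^bold>* Fv v \<^bold>= \<^bold>1"
    using v D_Tm[OF a] by (intro impE[OF rinverse])
  then have "T \<tturnstile> Ex REAL (a \<^bold>* Bv 0 \<^bold>= \<^bold>1)"
    using v a by (simp add: ex_fm_def close_tm_fresh forces_def Form_simps)
  then show thesis using that a by (auto simp: forces_ex[OF assms(1)])
qed

lemma forces_archimedean:
  assumes "world T" "a \<in> D T REAL"
  obtains k where "k \<in> D T NAT" "T \<tturnstile> a \<^bold>< Cst OfNat \<cdot> k"
proof -
  obtain v where v: "snd v = NAT" "v \<notin> fv_tm a" using ex_fresh by (metis finite_fv_tm)
  have "T \<turnstile> \<^bold>\<exists>v. a \<^bold>< Cst OfNat \<cdot> Fv v"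
    using v D_Tm[OF assms(2)] by (intro archimedean)
  then have "T \<tturnstile> Ex NAT (a \<^bold>< Cst OfNat \<cdot> Bv 0)"
    using v assms by (simp add: ex_fm_def close_tm_fresh forces_def Form_simps)
  then show thesis using that assms by (auto simp: forces_ex[OF assms(1)])
qed

lemma forces_zero_radd: "a \<in> D T REAL \<Longrightarrow> T \<tturnstile> \<^bold>0 \<^bold>+ a \<^bold>= a"
  by (rule forces_trans[OF forces_radd_comm forces_radd_zero]) simp_all

lemma forces_radd_right_neg:
  assumes "a \<in> D T REAL" "c \<in> D T REAL"
  shows "T \<tturnstile> (a \<^bold>+ c) \<^bold>+ (\<^bold>- c) \<^bold>= a"
proof -
  have "T \<tturnstile> (a \<^bold>+ c) \<^bold>+ (\<^bold>- c) \<^bold>= a \<^bold>+ (c \<^bold>+ (\<^bold>- c))" using assms by (simp add: forces_radd_assoc)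
  also have "T \<tturnstile> a \<^bold>+ (c \<^bold>+ (\<^bold>- c)) \<^bold>= a \<^bold>+ \<^bold>0"
    using assms by (intro forces_radd_cong[OF forces_refl forces_radd_neg]) simp_all
  also have "T \<tturnstile> a \<^bold>+ \<^bold>0 \<^bold>= a" using assms by (simp add: forces_radd_zero)
  finally show ?thesis .
qed

lemma forces_radd_left_neg:
  assumes "a \<in> D T REAL" "c \<in> D T REAL"
  shows "T \<tturnstile> (a \<^bold>+ (\<^bold>- c)) \<^bold>+ c \<^bold>= a"
proof -
  have "T \<tturnstile> (a \<^bold>+ (\<^bold>- c)) \<^bold>+ c \<^bold>= a \<^bold>+ ((\<^bold>- c) \<^bold>+ c)" using assms by (simp add: forces_radd_assoc)
  also have "T \<tturnstile> a \<^bold>+ ((\<^bold>- c) \<^bold>+ c) \<^bold>= a \<^bold>+ (c \<^bold>+ (\<^bold>- c))"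
    using assms by (intro forces_radd_cong[OF forces_refl forces_radd_comm]) simp_all
  also have "T \<tturnstile> a \<^bold>+ (c \<^bold>+ (\<^bold>- c)) \<^bold>= a \<^bold>+ \<^bold>0"
    using assms by (intro forces_radd_cong[OF forces_refl forces_radd_neg]) simp_all
  also have "T \<tturnstile> a \<^bold>+ \<^bold>0 \<^bold>= a" using assms by (simp add: forces_radd_zero)
  finally show ?thesis .
qed

lemma forces_less_add_cancel:
  assumes "T \<tturnstile> a \<^bold>+ c \<^bold>< b \<^bold>+ c" "a \<in> D T REAL" "b \<in> D T REAL" "c \<in> D T REAL"
  shows "T \<tturnstile> a \<^bold>< b"
proof -
  have "T \<tturnstile> (a \<^bold>+ c) \<^bold>+ (\<^bold>- c) \<^bold>< (b \<^bold>+ c) \<^bold>+ (\<^bold>- c)"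
    using assms by (simp add: forces_less_add)
  from forces_less_cong[OF this forces_radd_right_neg forces_radd_right_neg] show ?thesis
    using assms by blast
qed

text \<open>Here \<open>h\<close> is half of \<open>b\<close>, formed with an inverse
  \<open>y\<close> of \<open>1 + 1\<close>. Cotransitivity of \<open>0 < b\<close> at
  \<open>h\<close> gives its positivity: in the case \<open>h < b\<close> one cancels
  \<open>h\<close> in \<open>h < h + h\<close>. The result later supplies
  \<open>\<alpha>\<close>.\<close>

lemma forces_between_zero:
  assumes W: "world T" and b: "T \<tturnstile> \<^bold>0 \<^bold>< b"
  obtains h where "h \<in> D T REAL" "T \<tturnstile> \<^bold>0 \<^bold>< h" "T \<tturnstile> h \<^bold>< b"
proof -
  have bD: "b \<in> D T REAL" using forces_less_D[OF b] by auto
  have one: "T \<tturnstile> \<^bold>0 \<^bold>< \<^bold>1" by (simp add: forces_def Form_simps zero_less_one)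
  note one
  also have "T \<tturnstile> \<^bold>1 \<^bold>= \<^bold>0 \<^bold>+ \<^bold>1" by (rule forces_sym[OF forces_zero_radd]) simp
  also have "T \<tturnstile> \<^bold>0 \<^bold>+ \<^bold>1 \<^bold>< \<^bold>1 \<^bold>+ \<^bold>1" using one by (rule forces_less_add) simp
  finally have "T \<tturnstile> \<^bold>0 \<^bold>< \<^bold>1 \<^bold>+ \<^bold>1" using W .
  then obtain y where y: "y \<in> D T REAL" "T \<tturnstile> (\<^bold>1 \<^bold>+ \<^bold>1) \<^bold>* y \<^bold>= \<^bold>1"
    using forces_inverse[OF W] by blast
  define h where "h = b \<^bold>* y"
  have h: "h \<in> D T REAL" using bD y by (simp add: h_def)
  have "T \<tturnstile> h \<^bold>+ h \<^bold>= b \<^bold>* (y \<^bold>+ y)"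
    unfolding h_def using bD y by (intro forces_sym[OF forces_rdistrib])
  also have "T \<tturnstile> b \<^bold>* (y \<^bold>+ y) \<^bold>= b \<^bold>* (y \<^bold>* \<^bold>1 \<^bold>+ y \<^bold>* \<^bold>1)"
    using bD y by (intro forces_rmul_cong[OF forces_refl]
        forces_radd_cong[OF forces_sym[OF forces_rmul_one] forces_sym[OF forces_rmul_one]]) simp_all
  also have "T \<tturnstile> b \<^bold>* (y \<^bold>* \<^bold>1 \<^bold>+ y \<^bold>* \<^bold>1) \<^bold>= b \<^bold>* (y \<^bold>* (\<^bold>1 \<^bold>+ \<^bold>1))"
    using bD y by (intro forces_rmul_cong[OF forces_refl forces_sym[OF forces_rdistrib]]) simp_all
  also have "T \<tturnstile> b \<^bold>* (y \<^bold>* (\<^bold>1 \<^bold>+ \<^bold>1)) \<^bold>= b \<^bold>* ((\<^bold>1 \<^bold>+ \<^bold>1) \<^bold>* y)"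
    using bD y by (intro forces_rmul_cong[OF forces_refl forces_rmul_comm]) simp_all
  also have "T \<tturnstile> b \<^bold>* ((\<^bold>1 \<^bold>+ \<^bold>1) \<^bold>* y) \<^bold>= b \<^bold>* \<^bold>1"
    using bD y by (intro forces_rmul_cong[OF forces_refl y(2)]) simp_all
  also have "T \<tturnstile> b \<^bold>* \<^bold>1 \<^bold>= b" using bD by (rule forces_rmul_one)
  finally have hh: "T \<tturnstile> h \<^bold>+ h \<^bold>= b" .
  have pos: "T \<tturnstile> \<^bold>0 \<^bold>< h"
    using forces_less_cotrans[OF W b h]
  proof
    assume "T \<tturnstile> h \<^bold>< b"
    then have "T \<tturnstile> \<^bold>0 \<^bold>+ h \<^bold>< h \<^bold>+ h"
      using forces_less_cong[OF _ forces_sym[OF forces_zero_radd[OF h]] forces_sym[OF hh]] by blast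
    then show ?thesis by (rule forces_less_add_cancel) (use h in simp_all)
  qed
  have "T \<tturnstile> \<^bold>0 \<^bold>+ h \<^bold>< h \<^bold>+ h" using pos h by (rule forces_less_add)
  then have "T \<tturnstile> h \<^bold>< b" using forces_less_cong[OF _ forces_zero_radd[OF h] hh] by blast
  with h pos that show thesis by blast
qed

lemma forces_rmul_zero:
  assumes "a \<in> D T REAL"
  shows "T \<tturnstile> a \<^bold>* \<^bold>0 \<^bold>= \<^bold>0"
proof -
  let ?x = "a \<^bold>* \<^bold>0"
  have x: "?x \<in> D T REAL" using assms by simp
  have "T \<tturnstile> ?x \<^bold>+ ?x \<^bold>= a \<^bold>* (\<^bold>0 \<^bold>+ \<^bold>0)" using assms by (intro forces_sym[OF forces_rdistrib]) simp_all
  also have "T \<tturnstile> a \<^bold>* (\<^bold>0 \<^bold>+ \<^bold>0) \<^bold>= ?x"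
    using assms by (intro forces_rmul_cong[OF forces_refl forces_radd_zero]) simp_all
  finally have xx: "T \<tturnstile> ?x \<^bold>+ ?x \<^bold>= ?x" .
  have "T \<tturnstile> ?x \<^bold>= (?x \<^bold>+ ?x) \<^bold>+ (\<^bold>- ?x)" using forces_sym[OF forces_radd_right_neg[OF x x]] .
  also have "T \<tturnstile> (?x \<^bold>+ ?x) \<^bold>+ (\<^bold>- ?x) \<^bold>= ?x \<^bold>+ (\<^bold>- ?x)"
    using x assms by (intro forces_radd_cong[OF xx forces_refl[where s = REAL]]) simp_all
  also have "T \<tturnstile> ?x \<^bold>+ (\<^bold>- ?x) \<^bold>= \<^bold>0" using x by (rule forces_radd_neg)
  finally show ?thesis .
qed

lemma forces_of_nat_suc_rmul:
  assumes "k \<in> D T NAT" "t \<in> D T REAL"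
  shows "T \<tturnstile> Cst OfNat \<cdot> (Cst NSuc \<cdot> k) \<^bold>* t \<^bold>= t \<^bold>+ Cst OfNat \<cdot> k \<^bold>* t"
proof -
  let ?k = "Cst OfNat \<cdot> k"
  have "T \<tturnstile> Cst OfNat \<cdot> (Cst NSuc \<cdot> k) \<^bold>* t \<^bold>= (?k \<^bold>+ \<^bold>1) \<^bold>* t"
    using assms by (intro forces_rmul_cong[OF forces_of_nat_suc forces_refl]) simp_all
  also have "T \<tturnstile> (?k \<^bold>+ \<^bold>1) \<^bold>* t \<^bold>= t \<^bold>* (?k \<^bold>+ \<^bold>1)" using assms by (intro forces_rmul_comm) simp_all
  also have "T \<tturnstile> t \<^bold>* (?k \<^bold>+ \<^bold>1) \<^bold>= t \<^bold>* ?k \<^bold>+ t \<^bold>* \<^bold>1" using assms by (intro forces_rdistrib) simp_all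
  also have "T \<tturnstile> t \<^bold>* ?k \<^bold>+ t \<^bold>* \<^bold>1 \<^bold>= ?k \<^bold>* t \<^bold>+ t"
    using assms by (intro forces_radd_cong[OF forces_rmul_comm forces_rmul_one]) simp_all
  also have "T \<tturnstile> ?k \<^bold>* t \<^bold>+ t \<^bold>= t \<^bold>+ ?k \<^bold>* t" using assms by (intro forces_radd_comm) simp_all
  finally show ?thesis .
qed

text \<open>In the induction step, cotransitivity splits \<open>0 < t + k t\<close> at
  \<open>k t\<close>: either \<open>k t\<close> is positive, or \<open>t\<close> is after
  cancellation. The sign of \<open>t\<close> can thus be read off from its multiples without
  dividing.\<close>

lemma forces_of_nat_rmul_pos:
  assumes W: "world T" and k: "k \<in> D T NAT" and t: "t \<in> D T REAL"
    and pos: "T \<tturnstile> \<^bold>0 \<^bold>< Cst OfNat \<cdot> k \<^bold>* t"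
  shows "T \<tturnstile> \<^bold>0 \<^bold>< t"
proof -
  let ?B = "\<^bold>0 \<^bold>< Cst OfNat \<cdot> Bv 0 \<^bold>* t \<^bold>\<longrightarrow> \<^bold>0 \<^bold>< t"
  have B: "T' \<tturnstile> open_fm 0 n ?B"
    if "world T'" "n \<in> D T' NAT" "t \<in> D T' REAL"
      "\<And>T''. T'' \<in> exts T' \<Longrightarrow> T'' \<tturnstile> \<^bold>0 \<^bold>< Cst OfNat \<cdot> n \<^bold>* t \<Longrightarrow> T'' \<tturnstile> \<^bold>0 \<^bold>< t" for T' n
    using that by (simp add: forces_imp Form_simps)
  have "T \<tturnstile> open_fm 0 k ?B"
  proof (rule forces_nat_induct[OF W _ _ k])
    show "T \<tturnstile> open_fm 0 (Cst NZero) ?B"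
    proof (rule B[OF W _ t])
      fix T' assume T': "T' \<in> exts T" and *: "T' \<tturnstile> \<^bold>0 \<^bold>< Cst OfNat \<cdot> Cst NZero \<^bold>* t"
      have t': "t \<in> D T' REAL" using t T' by (rule D_mono)
      note *
      also have "T' \<tturnstile> Cst OfNat \<cdot> Cst NZero \<^bold>* t \<^bold>= \<^bold>0 \<^bold>* t"
        using t' by (intro forces_rmul_cong[OF forces_of_nat_zero forces_refl]) simp_all
      also have "T' \<tturnstile> \<^bold>0 \<^bold>* t \<^bold>= t \<^bold>* \<^bold>0" using t' by (intro forces_rmul_comm) simp_all
      also have "T' \<tturnstile> t \<^bold>* \<^bold>0 \<^bold>= \<^bold>0" using t' by (rule forces_rmul_zero)
      finally show "T' \<tturnstile> \<^bold>0 \<^bold>< t" using forces_less_asym[OF extsD[OF T']] by blast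
    qed simp
  next
    fix T' n assume T': "T' \<in> exts T" and n: "n \<in> D T' NAT" and IH: "T' \<tturnstile> open_fm 0 n ?B"
    have t': "t \<in> D T' REAL" using t T' by (rule D_mono)
    show "T' \<tturnstile> open_fm 0 (Cst NSuc \<cdot> n) ?B"
    proof (rule B[OF extsD[OF T'] _ t'])
      fix T'' assume T'': "T'' \<in> exts T'" and *: "T'' \<tturnstile> \<^bold>0 \<^bold>< Cst OfNat \<cdot> (Cst NSuc \<cdot> n) \<^bold>* t"
      have D: "n \<in> D T'' NAT" "t \<in> D T'' REAL" using n t' T'' by (auto intro: D_mono)
      let ?nt = "Cst OfNat \<cdot> n \<^bold>* t"
      have nt: "?nt \<in> D T'' REAL" using D by simp
      have "T'' \<tturnstile> \<^bold>0 \<^bold>< t \<^bold>+ ?nt"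
        using * forces_of_nat_suc_rmul[OF D] by (rule forces_less_eq)
      from forces_less_cotrans[OF extsD[OF T''] this nt] show "T'' \<tturnstile> \<^bold>0 \<^bold>< t"
      proof
        assume "T'' \<tturnstile> \<^bold>0 \<^bold>< ?nt"
        then show ?thesis using IH T'' n t' extsD[OF T'] by (simp add: forces_imp)
      next
        assume "T'' \<tturnstile> ?nt \<^bold>< t \<^bold>+ ?nt"
        then have "T'' \<tturnstile> \<^bold>0 \<^bold>+ ?nt \<^bold>< t \<^bold>+ ?nt"
          by (rule forces_eq_less[OF forces_zero_radd[OF nt]])
        then show ?thesis by (rule forces_less_add_cancel) (use D in simp_all)
      qed
    qed (use n in simp)
  qed (use t in auto)
  then show ?thesis
    using W k t pos world_exts[OF W] by (simp add: forces_imp)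
qed

text \<open>Let \<open>y\<close> be the inverse of \<open>t\<close>, choose \<open>k > y\<close> and
  put \<open>d = k - y > 0\<close>; then \<open>k t = t d + t y = t d + 1 > 1\<close>.\<close>

lemma forces_archimedean_rmul:
  assumes W: "world T" and t: "T \<tturnstile> \<^bold>0 \<^bold>< t"
  obtains k where "k \<in> D T NAT" "T \<tturnstile> \<^bold>1 \<^bold>< Cst OfNat \<cdot> k \<^bold>* t"
proof -
  have tD: "t \<in> D T REAL" using forces_less_D[OF t] by auto
  obtain y where y: "y \<in> D T REAL" "T \<tturnstile> t \<^bold>* y \<^bold>= \<^bold>1" using forces_inverse[OF W t] by blast
  obtain k where k: "k \<in> D T NAT" "T \<tturnstile> y \<^bold>< Cst OfNat \<cdot> k" using forces_archimedean[OF W y(1)] by blast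
  let ?k = "Cst OfNat \<cdot> k"
  have kD: "?k \<in> D T REAL" using k by simp
  define d where "d = ?k \<^bold>+ (\<^bold>- y)"
  have d: "d \<in> D T REAL" using kD y by (simp add: d_def)
  have "T \<tturnstile> \<^bold>0 \<^bold>= y \<^bold>+ (\<^bold>- y)" using y by (intro forces_sym[OF forces_radd_neg])
  also have "T \<tturnstile> y \<^bold>+ (\<^bold>- y) \<^bold>< d" unfolding d_def using k y by (intro forces_less_add) simp_all
  finally have "T \<tturnstile> \<^bold>0 \<^bold>< t \<^bold>* d" using t forces_less_mul by blast
  then have "T \<tturnstile> \<^bold>0 \<^bold>+ \<^bold>1 \<^bold>< t \<^bold>* d \<^bold>+ \<^bold>1" by (rule forces_less_add) simp
  then have "T \<tturnstile> \<^bold>1 \<^bold>< t \<^bold>* d \<^bold>+ \<^bold>1"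
    by (rule forces_eq_less[OF forces_sym[OF forces_zero_radd], rotated]) simp
  also have "T \<tturnstile> t \<^bold>* d \<^bold>+ \<^bold>1 \<^bold>= t \<^bold>* d \<^bold>+ t \<^bold>* y"
    using tD d y by (intro forces_radd_cong[OF forces_refl[where s = REAL] forces_sym[OF y(2)]]) simp_all
  also have "T \<tturnstile> t \<^bold>* d \<^bold>+ t \<^bold>* y \<^bold>= t \<^bold>* (d \<^bold>+ y)"
    using tD d y by (intro forces_sym[OF forces_rdistrib])
  also have "T \<tturnstile> t \<^bold>* (d \<^bold>+ y) \<^bold>= t \<^bold>* ?k"
    unfolding d_def using tD kD y
    by (intro forces_rmul_cong[OF forces_refl forces_radd_left_neg]) simp_all
  also have "T \<tturnstile> t \<^bold>* ?k \<^bold>= ?k \<^bold>* t" using tD kD by (rule forces_rmul_comm)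
  finally show thesis using that k by blast
qed

lemma forces_diff_pos:
  assumes "a \<in> D T REAL" "b \<in> D T REAL"
  shows "(T \<tturnstile> \<^bold>0 \<^bold>< b \<^bold>+ (\<^bold>- a)) \<longleftrightarrow> (T \<tturnstile> a \<^bold>< b)"
proof
  assume "T \<tturnstile> \<^bold>0 \<^bold>< b \<^bold>+ (\<^bold>- a)"
  then have "T \<tturnstile> \<^bold>0 \<^bold>+ a \<^bold>< (b \<^bold>+ (\<^bold>- a)) \<^bold>+ a" using assms by (intro forces_less_add)
  from forces_less_cong[OF this forces_zero_radd forces_radd_left_neg] show "T \<tturnstile> a \<^bold>< b"
    using assms by blast
next
  assume "T \<tturnstile> a \<^bold>< b"
  then have "T \<tturnstile> a \<^bold>+ (\<^bold>- a) \<^bold>< b \<^bold>+ (\<^bold>- a)" using assms by (intro forces_less_add) simp_all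
  then show "T \<tturnstile> \<^bold>0 \<^bold>< b \<^bold>+ (\<^bold>- a)"
    using forces_eq_less[OF forces_sym[OF forces_radd_neg]] assms by blast
qed

section \<open>Deciding between alternatives\<close>

text \<open>The quantifications over extensions for \<open>All\<close> and for the implication merge
  into one, since an extension of an extension is again one and domains are monotone.\<close>

lemma forces_all_imp:
  assumes "world T"
  shows "(T \<tturnstile> All s (G \<^bold>\<longrightarrow> P)) \<longleftrightarrow> wff [s] G \<and> wff [s] P \<and> fv G \<subseteq> lang T \<and> fv P \<subseteq> lang T \<and>
    (\<forall>T' \<in> exts T. \<forall>t \<in> D T' s. (T' \<tturnstile> open_fm 0 t G) \<longrightarrow> (T' \<tturnstile> open_fm 0 t P))"
    (is "?L \<longleftrightarrow> ?R")
proof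
  assume L: ?L
  have "(T' \<tturnstile> open_fm 0 t G) \<longrightarrow> (T' \<tturnstile> open_fm 0 t P)" if "T' \<in> exts T" "t \<in> D T' s" for T' t
  proof -
    have "T' \<tturnstile> open_fm 0 t G \<^bold>\<longrightarrow> open_fm 0 t P"
      using L that unfolding forces_all[OF assms] open_fm.simps by blast
    then show ?thesis
      using forces_imp[OF extsD[OF that(1)]] world_exts[OF extsD[OF that(1)]] by blast
  qed
  then show ?R using L unfolding forces_all[OF assms] by simp
next
  assume R: ?R
  show ?L
    unfolding forces_all[OF assms]
  proof (intro HOL.conjI ballI)
    fix T' t assume T': "T' \<in> exts T" and t: "t \<in> D T' s"
    have "open_fm 0 t G \<in> Form T'" "open_fm 0 t P \<in> Form T'"
      using R lang_mono[OF T'] t by (auto intro!: Form_open)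
    then show "T' \<tturnstile> open_fm 0 t (G \<^bold>\<longrightarrow> P)"
      unfolding open_fm.simps forces_imp[OF extsD[OF T']]
      using R exts_trans[OF T'] D_mono[OF t] by blast
  qed (use R in auto)
qed

lemma open_fm_id: "wff \<Theta> A \<Longrightarrow> length \<Theta> \<le> k \<Longrightarrow> open_fm k r A = A"
proof (induction A arbitrary: \<Theta> k)
  case (Eq t u)
  then show ?case by (auto simp: open_tm_id)
next
  case (Less t u)
  then show ?case by (auto simp: open_tm_id)
next
  case (All s A)
  from All.IH[of "s # \<Theta>" "Suc k"] All.prems show ?case by simp
next
  case (Ex s A)
  from Ex.IH[of "s # \<Theta>" "Suc k"] Ex.prems show ?case by simp
qed auto

lemma wff_append: "wff \<Theta> A \<Longrightarrow> wff (\<Theta> @ \<Theta>') A"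
proof (induction A arbitrary: \<Theta>)
  case (Eq t u)
  then show ?case by (auto simp: srt_of_append)
next
  case (Less t u)
  then show ?case by (auto simp: srt_of_append)
next
  case (All s A)
  from All.IH[of "s # \<Theta>"] All.prems show ?case by simp
next
  case (Ex s A)
  from Ex.IH[of "s # \<Theta>"] Ex.prems show ?case by simp
qed auto

text \<open>Choice expects the argument at index 1 and the value at index 0. The only index of
  \<open>B\<close> is moved to 1, leaving a body that ignores the value.\<close>

lemma shift_body:
  assumes B: "wff [s] B"
  obtains B' where "wff [s', s] B'" "fv B' \<subseteq> fv B"
    "\<And>y n. n \<in> Tm s \<Longrightarrow> open_fm 0 y (open_fm 1 n B') = open_fm 0 n B"
proof -
  obtain v where v: "snd v = s" "v \<notin> fv B" using ex_fresh by (metis finite_fv)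
  let ?E = "open_fm 0 (Fv v) B"
  have E: "wff [] ?E" using wff_open0[OF B, of "Fv v"] Fv_Tm[of v] v by (simp add: Fm_def)
  show thesis
  proof (rule that)
    show "wff [s', s] (close 1 v ?E)"
      using wff_close[OF wff_append[OF E, of "[s']"], of 1 v] v by simp
    show "fv (close 1 v ?E) \<subseteq> fv B"
      using fv_close[of 1 v ?E] fv_open_upper[of 0 "Fv v" B] by auto
    fix y n assume n: "n \<in> Tm s"
    have "open_fm 1 n (close 1 v ?E) = open_fm 0 n B"
      using open_close[OF E, of 1 n v] v by (simp add: subst_open)
    moreover have "wff [] (open_fm 0 n B)" using wff_open0[OF B n] by (simp add: Fm_def)
    ultimately show "open_fm 0 y (open_fm 1 n (close 1 v ?E)) = open_fm 0 n B"
      by (simp add: open_fm_id)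
  qed
qed

abbreviation nat_one :: tm where "nat_one \<equiv> Cst NSuc \<cdot> Cst NZero"

lemma forces_not_zero_one:
  assumes "world T" "T \<tturnstile> t \<^bold>= Cst NZero"
  shows "\<not> (T \<tturnstile> t \<^bold>= Cst NSuc \<cdot> Cst NZero)"
  using forces_trans[OF forces_sym assms(2)] forces_suc_not_zero[OF assms(1)] by blast

text \<open>The formula given to choice records the alternative taken: \<open>y = 0\<close> together
  with \<open>B\<close>, or \<open>y = 1\<close> together with \<open>A\<close>. Both alternatives
  may hold; \<open>\<mu>\<close> commits to one of them, coherently in all extensions and for equal
  arguments.\<close>

lemma forces_disj_choice:
  assumes W: "world T" and A: "wff [NAT] A" "fv A \<subseteq> lang T" and B: "wff [NAT] B" "fv B \<subseteq> lang T"
    and AB: "\<And>T' n. T' \<in> exts T \<Longrightarrow> n \<in> D T' NAT \<Longrightarrow>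
      (T' \<tturnstile> open_fm 0 n A) \<or> (T' \<tturnstile> open_fm 0 n B)"
  obtains \<mu> where "\<mu> \<in> D T (FUN NAT NAT)"
    "\<And>T' n. T' \<in> exts T \<Longrightarrow> n \<in> D T' NAT \<Longrightarrow>
      (T' \<tturnstile> \<mu> \<cdot> n \<^bold>= Cst NZero) \<and> (T' \<tturnstile> open_fm 0 n B) \<or>
      (T' \<tturnstile> \<mu> \<cdot> n \<^bold>= Cst NSuc \<cdot> Cst NZero) \<and> (T' \<tturnstile> open_fm 0 n A)"
proof -
  obtain A' where A': "wff [NAT, NAT] A'" "fv A' \<subseteq> fv A"
    "\<And>y n. n \<in> Tm NAT \<Longrightarrow> open_fm 0 y (open_fm 1 n A') = open_fm 0 n A"
    using shift_body[OF A(1)] by metis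
  obtain B' where B': "wff [NAT, NAT] B'" "fv B' \<subseteq> fv B"
    "\<And>y n. n \<in> Tm NAT \<Longrightarrow> open_fm 0 y (open_fm 1 n B') = open_fm 0 n B"
    using shift_body[OF B(1)] by metis
  let ?C = "Bv 0 \<^bold>= Cst NZero \<^bold>\<and> B' \<^bold>\<or> Bv 0 \<^bold>= Cst NSuc \<cdot> Cst NZero \<^bold>\<and> A'"
  have open_C: "open_fm 0 y (open_fm 1 n ?C) =
      (y \<^bold>= Cst NZero \<^bold>\<and> open_fm 0 n B \<^bold>\<or> y \<^bold>= Cst NSuc \<cdot> Cst NZero \<^bold>\<and> open_fm 0 n A)"
    if "n \<in> Tm NAT" for y n
    using A'(3) B'(3) that by simp
  have sem: "(T' \<tturnstile> open_fm 0 y (open_fm 1 n ?C)) \<longleftrightarrow>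
      (T' \<tturnstile> y \<^bold>= Cst NZero) \<and> (T' \<tturnstile> open_fm 0 n B) \<or>
      (T' \<tturnstile> y \<^bold>= Cst NSuc \<cdot> Cst NZero) \<and> (T' \<tturnstile> open_fm 0 n A)"
    if "T' \<in> exts T" "n \<in> D T' NAT" "y \<in> D T' NAT" for T' n y
  proof -
    have "open_fm 0 n A \<in> Form T'" "open_fm 0 n B \<in> Form T'"
      using A B lang_mono[OF that(1)] that(2) by (auto intro!: Form_open)
    moreover have "(y \<^bold>= Cst NZero) \<in> Form T'" "(y \<^bold>= Cst NSuc \<cdot> Cst NZero) \<in> Form T'"
      using that(3) by (auto simp: Form_simps intro!: HOL.exI[of _ NAT])
    ultimately show ?thesis
      unfolding open_C[OF D_Tm[OF that(2)]] forces_disj[OF extsD[OF that(1)]] forces_conj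
      by (simp add: Form_simps(4))
  qed
  have "\<exists>y \<in> D T' NAT. T' \<tturnstile> open_fm 0 y (open_fm 1 n ?C)"
    if "T' \<in> exts T" "n \<in> D T' NAT" for T' n
    using AB[OF that] sem[OF that] forces_refl[OF D_const(1)] forces_refl[of nat_one T' NAT] D_const(1,4)
    by metis
  moreover have "wff [NAT, NAT] ?C" "fv ?C \<subseteq> lang T" using A A' B B' by auto
  ultimately obtain \<mu> where \<mu>: "\<mu> \<in> D T (FUN NAT NAT)"
    "\<And>T' n. T' \<in> exts T \<Longrightarrow> n \<in> D T' NAT \<Longrightarrow> T' \<tturnstile> open_fm 0 (\<mu> \<cdot> n) (open_fm 1 n ?C)"
    using forces_countable_choice[OF W] by metis
  show thesis
  proof (rule that[OF \<mu>(1)])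
    fix T' n assume *: "T' \<in> exts T" "n \<in> D T' NAT"
    have "\<mu> \<cdot> n \<in> D T' NAT" using D_app[OF D_mono[OF \<mu>(1) *(1)] *(2)] .
    then show "(T' \<tturnstile> \<mu> \<cdot> n \<^bold>= Cst NZero) \<and> (T' \<tturnstile> open_fm 0 n B) \<or>
      (T' \<tturnstile> \<mu> \<cdot> n \<^bold>= Cst NSuc \<cdot> Cst NZero) \<and> (T' \<tturnstile> open_fm 0 n A)"
      using sem[OF *] \<mu>(2)[OF *] by blast
  qed
qed

section \<open>Ishihara's trick\<close>

text \<open>Kripke reading of \<open>converges\<close>. The bound \<open>N\<close> is found at the
  world where \<open>0 < e\<close> is forced, and then serves all of its extensions.\<close>

definition converges_in :: "tm \<Rightarrow> fm set \<Rightarrow> tm \<Rightarrow> tm \<Rightarrow> bool" where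
  "converges_in d T s l \<longleftrightarrow> (\<forall>T1 \<in> exts T. \<forall>e. (T1 \<tturnstile> \<^bold>0 \<^bold>< e) \<longrightarrow>
     (\<exists>N \<in> D T1 NAT. \<forall>T2 \<in> exts T1. \<forall>n \<in> D T2 NAT. (T2 \<tturnstile> N \<preceq> n) \<longrightarrow> (T2 \<tturnstile> d \<cdot> (s \<cdot> n) \<cdot> l \<^bold>< e)))"

definition cauchy_in :: "tm \<Rightarrow> fm set \<Rightarrow> tm \<Rightarrow> bool" where
  "cauchy_in d T s \<longleftrightarrow> (\<forall>T1 \<in> exts T. \<forall>e. (T1 \<tturnstile> \<^bold>0 \<^bold>< e) \<longrightarrow>
     (\<exists>N \<in> D T1 NAT. \<forall>T2 \<in> exts T1. \<forall>m \<in> D T2 NAT. \<forall>n \<in> D T2 NAT.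
        (T2 \<tturnstile> N \<preceq> m) \<longrightarrow> (T2 \<tturnstile> N \<preceq> n) \<longrightarrow> (T2 \<tturnstile> d \<cdot> (s \<cdot> m) \<cdot> (s \<cdot> n) \<^bold>< e)))"

text \<open>The Kripke content of the hypotheses at \<open>T0\<close>, stated for all extensions so
  that the trick can be applied with parameters that appear only in later worlds.\<close>

locale strongly_extensional_map =
  fixes X Y :: srt and \<sigma> \<rho> f a :: tm and T0 :: "fm set"
  assumes world0: "world T0"
    and \<sigma>0: "\<sigma> \<in> D T0 (FUN X (FUN X REAL))" and \<rho>0: "\<rho> \<in> D T0 (FUN Y (FUN Y REAL))"
    and f0: "f \<in> D T0 (FUN X Y)" and a0: "a \<in> D T0 X"
    and nonneg: "\<And>T x y. T \<in> exts T0 \<Longrightarrow> x \<in> D T X \<Longrightarrow> y \<in> D T X \<Longrightarrow> \<not> (T \<tturnstile> \<sigma> \<cdot> x \<cdot> y \<^bold>< \<^bold>0)"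
    and self: "\<And>T x. T \<in> exts T0 \<Longrightarrow> x \<in> D T X \<Longrightarrow> T \<tturnstile> \<sigma> \<cdot> x \<cdot> x \<^bold>= \<^bold>0"
    and identity: "\<And>T x y. T \<in> exts T0 \<Longrightarrow> x \<in> D T X \<Longrightarrow> y \<in> D T X \<Longrightarrow>
      T \<tturnstile> \<sigma> \<cdot> x \<cdot> y \<^bold>= \<^bold>0 \<Longrightarrow> T \<tturnstile> x \<^bold>= y"
    and symmetric: "\<And>T x y. T \<in> exts T0 \<Longrightarrow> x \<in> D T X \<Longrightarrow> y \<in> D T X \<Longrightarrow>
      T \<tturnstile> \<sigma> \<cdot> x \<cdot> y \<^bold>= \<sigma> \<cdot> y \<cdot> x"
    and limit: "\<And>T s. T \<in> exts T0 \<Longrightarrow> s \<in> D T (FUN NAT X) \<Longrightarrow> cauchy_in \<sigma> T s \<Longrightarrow>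
      \<exists>l \<in> D T X. converges_in \<sigma> T s l"
    and strong_ext: "\<And>T x y. T \<in> exts T0 \<Longrightarrow> x \<in> D T X \<Longrightarrow> y \<in> D T X \<Longrightarrow>
      T \<tturnstile> \<^bold>0 \<^bold>< \<rho> \<cdot> (f \<cdot> x) \<cdot> (f \<cdot> y) \<Longrightarrow> T \<tturnstile> \<^bold>0 \<^bold>< \<sigma> \<cdot> x \<cdot> y"
begin

abbreviation r :: "tm \<Rightarrow> tm" where
  "r x \<equiv> \<rho> \<cdot> (f \<cdot> x) \<cdot> (f \<cdot> a)"

lemma a_D: "T \<in> exts T0 \<Longrightarrow> a \<in> D T X"
  using a0 by (rule D_mono)

lemma \<sigma>_D: "T \<in> exts T0 \<Longrightarrow> x \<in> D T X \<Longrightarrow> y \<in> D T X \<Longrightarrow> \<sigma> \<cdot> x \<cdot> y \<in> D T REAL"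
  using D_mono[OF \<sigma>0] by (blast intro: D_app)

lemma r_D: "T \<in> exts T0 \<Longrightarrow> x \<in> D T X \<Longrightarrow> r x \<in> D T REAL"
  using D_mono[OF \<rho>0] D_mono[OF f0] D_mono[OF a0] by (blast intro: D_app)

lemma \<sigma>_cong:
  assumes "T \<in> exts T0" "T \<tturnstile> x \<^bold>= x'" "T \<tturnstile> y \<^bold>= y'" "x \<in> D T X" "y \<in> D T X"
  shows "T \<tturnstile> \<sigma> \<cdot> x \<cdot> y \<^bold>= \<sigma> \<cdot> x' \<cdot> y'"
proof -
  have \<sigma>: "\<sigma> \<in> D T (FUN X (FUN X REAL))" using D_mono[OF \<sigma>0 assms(1)] .
  show ?thesis
    using forces_app[OF forces_app[OF forces_refl[OF \<sigma>] assms(2) \<sigma> assms(4)] assms(3)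
        D_app[OF \<sigma> assms(4)] assms(5)] .
qed

lemma r_cong:
  assumes "T \<in> exts T0" "T \<tturnstile> x \<^bold>= x'" "x \<in> D T X"
  shows "T \<tturnstile> r x \<^bold>= r x'"
proof -
  have D: "\<rho> \<in> D T (FUN Y (FUN Y REAL))" "f \<in> D T (FUN X Y)" "f \<cdot> a \<in> D T Y"
    using D_mono[OF \<rho>0 assms(1)] D_mono[OF f0 assms(1)] D_mono[OF a0 assms(1)] D_app by blast+
  have "T \<tturnstile> f \<cdot> x \<^bold>= f \<cdot> x'" using forces_app[OF forces_refl[OF D(2)] assms(2) D(2) assms(3)] .
  then show ?thesis
    using forces_app[OF forces_app[OF forces_refl[OF D(1)] _ D(1)] forces_refl[OF D(3)] _ D(3)]
      D_app[OF D(2) assms(3)] D_app[OF D(1)] by blast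
qed

text \<open>If \<open>r l > 0\<close> for the limit \<open>l\<close>, strong extensionality
  separates \<open>l\<close> from \<open>a\<close>; then \<open>z\<close> differs from
  \<open>a\<close> somewhere, which exhibits a chosen index. If \<open>r l < \<alpha>\<close>, no
  index can have been chosen: otherwise \<open>z\<close> would become constantly some
  \<open>y m\<close>, so that \<open>l = y m\<close> and \<open>r l > \<alpha>\<close>.
  Cotransitivity of \<open>0 < \<alpha>\<close> decides between the two cases.\<close>

lemma ishihara_trick:
  assumes T: "T \<in> exts T0" and y: "y \<in> D T (FUN NAT X)" and conv: "converges_in \<sigma> T y a"
    and \<alpha>: "T \<tturnstile> \<^bold>0 \<^bold>< \<alpha>"
    and A: "wff [NAT] A" "fv A \<subseteq> lang T" and B: "wff [NAT] B" "fv B \<subseteq> lang T"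
    and AB: "\<And>T' n. T' \<in> exts T \<Longrightarrow> n \<in> D T' NAT \<Longrightarrow>
      (T' \<tturnstile> open_fm 0 n A) \<and> (T' \<tturnstile> \<alpha> \<^bold>< r (y \<cdot> n)) \<or> (T' \<tturnstile> open_fm 0 n B)"
  shows "(\<exists>n \<in> D T NAT. T \<tturnstile> open_fm 0 n A) \<or> (\<forall>T' \<in> exts T. \<forall>n \<in> D T' NAT. T' \<tturnstile> open_fm 0 n B)"
proof -
  have W: "world T" using extsD[OF T] .
  have W': "world T'" if "T' \<in> exts T" for T' using extsD[OF that] .
  note up = exts_trans[OF T]
  have \<alpha>D: "\<alpha> \<in> D T REAL" using forces_less_D[OF \<alpha>] by simp
  have D0: "\<rho> \<in> D T (FUN Y (FUN Y REAL))" "f \<in> D T (FUN X Y)" "a \<in> D T X"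
    using D_mono[OF \<rho>0 T] D_mono[OF f0 T] D_mono[OF a0 T] by auto
  have y': "y \<cdot> n \<in> D T' X" if "T' \<in> exts T" "n \<in> D T' NAT" for T' n
    using D_app[OF D_mono[OF y that(1)] that(2)] .
  let ?far = "\<alpha> \<^bold>< \<rho> \<cdot> (f \<cdot> (y \<cdot> Bv 0)) \<cdot> (f \<cdot> a)"
  have far: "open_fm 0 n ?far = (\<alpha> \<^bold>< r (y \<cdot> n))" for n
    using \<alpha>D D0 y by simp
  \<comment> \<open>The bound travels with \<open>A\<close>, so that the value 1 of
    \<open>\<mu>\<close> certifies both.\<close>
  have "wff [NAT] (A \<^bold>\<and> ?far)" "fv (A \<^bold>\<and> ?far) \<subseteq> lang T"
    using A \<alpha>D D0 y by simp_all
  moreover have "(T' \<tturnstile> open_fm 0 n (A \<^bold>\<and> ?far)) \<or> (T' \<tturnstile> open_fm 0 n B)"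
    if "T' \<in> exts T" "n \<in> D T' NAT" for T' n
    using AB[OF that] unfolding open_fm.simps(4) forces_conj far by blast
  ultimately obtain \<mu> where \<mu>: "\<mu> \<in> D T (FUN NAT NAT)"
    "\<And>T' n. T' \<in> exts T \<Longrightarrow> n \<in> D T' NAT \<Longrightarrow>
      (T' \<tturnstile> \<mu> \<cdot> n \<^bold>= Cst NZero) \<and> (T' \<tturnstile> open_fm 0 n B) \<or>
      (T' \<tturnstile> \<mu> \<cdot> n \<^bold>= nat_one) \<and> (T' \<tturnstile> open_fm 0 n (A \<^bold>\<and> ?far))"
    using forces_disj_choice[OF W _ _ B, of "A \<^bold>\<and> ?far"] by metis
  have \<mu>': "\<mu> \<cdot> n \<in> D T' NAT" if "T' \<in> exts T" "n \<in> D T' NAT" for T' n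
    using D_app[OF D_mono[OF \<mu>(1) that(1)] that(2)] .
  have one: "(T' \<tturnstile> open_fm 0 n A) \<and> (T' \<tturnstile> \<alpha> \<^bold>< r (y \<cdot> n))"
    if "T' \<in> exts T" "n \<in> D T' NAT" "T' \<tturnstile> \<mu> \<cdot> n \<^bold>= nat_one" for T' n
    using \<mu>(2)[OF that(1,2)] forces_not_zero_one[OF W'[OF that(1)]] that(3)
    unfolding open_fm.simps(4) forces_conj far by blast

  \<comment> \<open>\<open>Z\<close> says that \<open>\<mu>\<close> vanishes strictly below
    \<open>n\<close>, strictness being expressed by the successor; \<open>F\<close> says that
    \<open>m\<close> is the first place with value 1.\<close>
  define Z where "Z T' n \<longleftrightarrow> (\<forall>T'' \<in> exts T'. \<forall>j \<in> D T'' NAT.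
      (T'' \<tturnstile> Cst NSuc \<cdot> j \<preceq> n) \<longrightarrow> (T'' \<tturnstile> \<mu> \<cdot> j \<^bold>= Cst NZero))" for T' n
  define F where "F T' m \<longleftrightarrow> m \<in> D T' NAT \<and> (T' \<tturnstile> \<mu> \<cdot> m \<^bold>= nat_one) \<and> Z T' m" for T' m
  have ZD: "T' \<tturnstile> \<mu> \<cdot> j \<^bold>= Cst NZero"
    if "Z T' n" "T' \<in> exts T" "j \<in> D T' NAT" "T' \<tturnstile> Cst NSuc \<cdot> j \<preceq> n" for T' n j
    using that world_exts[OF W'[OF that(2)]] by (auto simp: Z_def)
  have Z_F: False if "Z T' n" "F T' m" "T' \<in> exts T" "T' \<tturnstile> Cst NSuc \<cdot> m \<preceq> n" for T' n m
    using ZD[OF that(1,3) _ that(4)] that(2) forces_not_zero_one[OF W'[OF that(3)]]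
    by (auto simp: F_def)
  \<comment> \<open>Of two first places neither lies strictly below the other. Hence the value
    \<open>y m\<close> used for \<open>z\<close> does not depend on the witness
    \<open>m\<close>.\<close>
  have F_unique: "T' \<tturnstile> m \<^bold>= m'" if "F T' m" "F T' m'" "T' \<in> exts T" for T' m m'
    using nle_linear[OF W'[OF that(3)], of m m'] nle_cases[OF W'[OF that(3)], of m m'] that Z_F
    by (meson F_def)
  have Z_iff: "(T' \<tturnstile> All NAT (Ex NAT (n \<^bold>= Cst NSuc \<cdot> Bv 1 \<^bold>+\<^sub>N Bv 0) \<^bold>\<longrightarrow> \<mu> \<cdot> Bv 0 \<^bold>= Cst NZero)) \<longleftrightarrow> Z T' n"
    if "T' \<in> exts T" "n \<in> D T' NAT" for T' n
    using that W'[OF that(1)] D_mono[OF \<mu>(1) that(1)]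
    unfolding Z_def by (simp add: forces_all_imp)
  have Z_or_F: "Z T' n \<or> (\<exists>m. F T' m)" if T': "T' \<in> exts T" and n: "n \<in> D T' NAT" for T' n
  proof -
    \<comment> \<open>Under the two binders of \<open>?below\<close>, index 2 is the nearest
      variable outside: the induction variable in the first disjunct, the bound place
      \<open>m\<close> in the second.\<close>
    let ?below = "\<lambda>i. All NAT (Ex NAT (Bv i \<^bold>= Cst NSuc \<cdot> Bv 1 \<^bold>+\<^sub>N Bv 0) \<^bold>\<longrightarrow> \<mu> \<cdot> Bv 0 \<^bold>= Cst NZero)"
    let ?B = "?below 2 \<^bold>\<or> Ex NAT (\<mu> \<cdot> Bv 0 \<^bold>= nat_one \<^bold>\<and> ?below 2)"
    have sem: "(T'' \<tturnstile> open_fm 0 n ?B) \<longleftrightarrow> Z T'' n \<or> (\<exists>m. F T'' m)"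
      if "T'' \<in> exts T" "n \<in> D T'' NAT" for T'' n
      using that W'[OF that(1)] D_mono[OF \<mu>(1) that(1)] Z_iff[OF that(1)] Z_iff[OF that]
      by (auto simp: forces_disj forces_ex forces_conj Form_simps F_def numeral_2_eq_2)
    have "T' \<tturnstile> open_fm 0 n ?B"
    proof (rule forces_nat_induct[OF W'[OF T'] _ _ n])
      have "Z T' (Cst NZero)"
        unfolding Z_def using not_suc_nle_zero[OF extsD] by blast
      then show "T' \<tturnstile> open_fm 0 (Cst NZero) ?B" using sem[OF T' D_const(1)] by blast
    next
      fix T'' n assume *: "T'' \<in> exts T'" "n \<in> D T'' NAT" and IH: "T'' \<tturnstile> open_fm 0 n ?B"
      have T'': "T'' \<in> exts T" using exts_trans[OF T' *(1)] .
      consider "\<exists>m. F T'' m" | "Z T'' n" using IH sem[OF T'' *(2)] by blast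
      then have "Z T'' (Cst NSuc \<cdot> n) \<or> (\<exists>m. F T'' m)"
      proof cases
        case 2
        show ?thesis
        \<comment> \<open>The classical split is harmless: where the value 1 is not forced,
          \<open>\<mu>(2)\<close> forces the value 0.\<close>
        proof (cases "T'' \<tturnstile> \<mu> \<cdot> n \<^bold>= nat_one")
          case True
          then show ?thesis using 2 *(2) by (auto simp: F_def)
        next
          case False
          then have zero: "T'' \<tturnstile> \<mu> \<cdot> n \<^bold>= Cst NZero" using \<mu>(2)[OF T'' *(2)] by blast
          have "U \<tturnstile> \<mu> \<cdot> j \<^bold>= Cst NZero"
            if U: "U \<in> exts T''" and j: "j \<in> D U NAT" "U \<tturnstile> Cst NSuc \<cdot> j \<preceq> Cst NSuc \<cdot> n" for U j
          proof -
            have nU: "n \<in> D U NAT" using D_mono[OF *(2) U] .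
            have "(U \<tturnstile> j \<^bold>= n) \<or> (U \<tturnstile> Cst NSuc \<cdot> j \<preceq> n)"
              using suc_nle_suc_cases[OF extsD[OF U] j(1) nU j(2)] .
            then show ?thesis
            proof
              assume "U \<tturnstile> j \<^bold>= n"
              then have "U \<tturnstile> \<mu> \<cdot> j \<^bold>= \<mu> \<cdot> n"
                using forces_app[OF forces_refl] D_mono[OF \<mu>(1) exts_trans[OF T'' U]] j(1) by blast
              also have "U \<tturnstile> \<mu> \<cdot> n \<^bold>= Cst NZero" using forces_mono[OF zero U] .
              finally show ?thesis .
            next
              assume "U \<tturnstile> Cst NSuc \<cdot> j \<preceq> n"
              then show ?thesis using 2 U j(1) by (auto simp: Z_def)
            qed
          qed
          then show ?thesis by (auto simp: Z_def)
        qed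
      qed blast
      then show "T'' \<tturnstile> open_fm 0 (Cst NSuc \<cdot> n) ?B"
        using sem[OF T'', of "Cst NSuc \<cdot> n"] *(2) by simp
    qed (use D_mono[OF \<mu>(1) T'] in auto)
    then show ?thesis using sem[OF T' n] by blast
  qed

  let ?below = "\<lambda>i. All NAT (Ex NAT (Bv i \<^bold>= Cst NSuc \<cdot> Bv 1 \<^bold>+\<^sub>N Bv 0) \<^bold>\<longrightarrow> \<mu> \<cdot> Bv 0 \<^bold>= Cst NZero)"
  \<comment> \<open>Index 0 is the value of \<open>z\<close> and index 1 its argument, so
    \<open>?below 3\<close> concerns the argument. Inside the existential quantifier,
    \<open>?below 2\<close> concerns the first place \<open>m\<close>, and the value has moved to
    index 1.\<close>
  let ?C = "?below 3 \<^bold>\<and> Bv 0 \<^bold>= a \<^bold>\<or>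
    Ex NAT ((\<mu> \<cdot> Bv 0 \<^bold>= nat_one \<^bold>\<and> ?below 2) \<^bold>\<and> Bv 1 \<^bold>= y \<cdot> Bv 0)"
  have sem: "(T' \<tturnstile> open_fm 0 x (open_fm 1 n ?C)) \<longleftrightarrow>
      Z T' n \<and> (T' \<tturnstile> x \<^bold>= a) \<or> (\<exists>m. F T' m \<and> (T' \<tturnstile> x \<^bold>= y \<cdot> m))"
    if "T' \<in> exts T" "n \<in> D T' NAT" "x \<in> D T' X" for T' n x
  proof -
    have "(x \<^bold>= a) \<in> Form T'"
      using that D_mono[OF D0(3) that(1)] by (auto simp: Form_simps)
    then show ?thesis
      using that W'[OF that(1)] D_mono[OF \<mu>(1) that(1)] D_mono[OF y that(1)] D_mono[OF D0(3) that(1)]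
        Z_iff[OF that(1)] Z_iff[OF that(1,2)] 
      by (auto simp: forces_disj forces_ex forces_conj Form_simps(4-8) F_def eval_nat_numeral)
  qed
  have "\<exists>x \<in> D T' X. T' \<tturnstile> open_fm 0 x (open_fm 1 n ?C)" if "T' \<in> exts T" "n \<in> D T' NAT" for T' n
    using Z_or_F[OF that]
  proof
    assume "Z T' n"
    then show ?thesis
      using sem[OF that] D_mono[OF D0(3) that(1)] forces_refl by blast
  next
    assume "\<exists>m. F T' m"
    then obtain m where m: "F T' m" by blast
    then have "y \<cdot> m \<in> D T' X" using y'[OF that(1)] by (simp add: F_def)
    then show ?thesis using sem[OF that] m forces_refl by blast
  qed
  moreover have "wff [X, NAT] ?C" "fv ?C \<subseteq> lang T"
    using \<mu>(1) y D0(3) by (simp_all add: eval_nat_numeral)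
  ultimately obtain z where z: "z \<in> D T (FUN NAT X)"
    "\<And>T' n. T' \<in> exts T \<Longrightarrow> n \<in> D T' NAT \<Longrightarrow> T' \<tturnstile> open_fm 0 (z \<cdot> n) (open_fm 1 n ?C)"
    using forces_countable_choice[OF W, of X ?C] by blast
  have z': "z \<cdot> n \<in> D T' X" if "T' \<in> exts T" "n \<in> D T' NAT" for T' n
    using D_app[OF D_mono[OF z(1) that(1)] that(2)] .
  have z_cases: "Z T' n \<and> (T' \<tturnstile> z \<cdot> n \<^bold>= a) \<or> (\<exists>m. F T' m \<and> (T' \<tturnstile> z \<cdot> n \<^bold>= y \<cdot> m))"
    if "T' \<in> exts T" "n \<in> D T' NAT" for T' n
    using z(2)[OF that] sem[OF that z'[OF that]] by blast
  have F_D: "m \<in> D T' NAT" if "F T' m" for T' m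
    using that by (simp add: F_def)
  have F_eq: "T' \<tturnstile> y \<cdot> m \<^bold>= y \<cdot> m'" if "F T' m" "F T' m'" "T' \<in> exts T" for T' m m'
    using forces_app[OF forces_refl F_unique[OF that]] D_mono[OF y that(3)] F_D[OF that(1)] by blast

  \<comment> \<open>Two values of \<open>z\<close> past \<open>N\<close> are equal, or one is
    \<open>a\<close> and the other \<open>y m\<close>. In the latter case \<open>z\<close> is still
    \<open>a\<close> at an index past \<open>N\<close>, so \<open>m\<close> lies past
    \<open>N\<close> as well and \<open>y m\<close> is within \<open>e\<close> of
    \<open>a\<close>.\<close>
  have "cauchy_in \<sigma> T z"
    unfolding cauchy_in_def
  proof (intro ballI HOL.allI HOL.impI)
    fix T1 e assume T1: "T1 \<in> exts T" and e: "T1 \<tturnstile> \<^bold>0 \<^bold>< e"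
    obtain N where N: "N \<in> D T1 NAT" "\<And>T2 n. T2 \<in> exts T1 \<Longrightarrow> n \<in> D T2 NAT \<Longrightarrow> T2 \<tturnstile> N \<preceq> n \<Longrightarrow>
        T2 \<tturnstile> \<sigma> \<cdot> (y \<cdot> n) \<cdot> a \<^bold>< e"
      using conv T1 e unfolding converges_in_def by meson
    have "T2 \<tturnstile> \<sigma> \<cdot> (z \<cdot> i) \<cdot> (z \<cdot> j) \<^bold>< e"
      if T2: "T2 \<in> exts T1" and i: "i \<in> D T2 NAT" "T2 \<tturnstile> N \<preceq> i" and j: "j \<in> D T2 NAT" "T2 \<tturnstile> N \<preceq> j"
      for T2 i j
    proof -
      have T2T: "T2 \<in> exts T" using exts_trans[OF T1 T2] .
      have T20: "T2 \<in> exts T0" using up[OF T2T] .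
      have a2: "a \<in> D T2 X" using a_D[OF T20] .
      have NT2: "N \<in> D T2 NAT" using D_mono[OF N(1) T2] .
      have small: "T2 \<tturnstile> \<sigma> \<cdot> u \<cdot> u \<^bold>< e" if "u \<in> D T2 X" for u
        using forces_eq_less[OF self[OF T20 that] forces_mono[OF e T2]] .
      have near: "T2 \<tturnstile> \<sigma> \<cdot> (y \<cdot> m) \<cdot> a \<^bold>< e" if "Z T2 k" "F T2 m" "k \<in> D T2 NAT" "T2 \<tturnstile> N \<preceq> k" for k m
      proof -
        note mD = F_D[OF that(2)]
        have "T2 \<tturnstile> k \<preceq> m"
          using nle_linear[OF extsD[OF T2] that(3) mD] Z_F[OF that(1,2) T2T] by blast
        then have "T2 \<tturnstile> N \<preceq> m" using nle_trans[OF extsD[OF T2] NT2 that(3) mD that(4)] by blast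
        then show ?thesis using N(2)[OF T2 mD] by blast
      qed
      have zz: "T2 \<tturnstile> \<sigma> \<cdot> (z \<cdot> i) \<cdot> (z \<cdot> j) \<^bold>< e"
        if "T2 \<tturnstile> z \<cdot> i \<^bold>= u" "T2 \<tturnstile> z \<cdot> j \<^bold>= v" "T2 \<tturnstile> \<sigma> \<cdot> u \<cdot> v \<^bold>< e" for u v
        using forces_eq_less[OF \<sigma>_cong[OF T20 that(1,2) z'[OF T2T i(1)] z'[OF T2T j(1)]] that(3)] .
      consider
          (aa) "T2 \<tturnstile> z \<cdot> i \<^bold>= a" "T2 \<tturnstile> z \<cdot> j \<^bold>= a"
        | (ay) m where "Z T2 i" "F T2 m" "T2 \<tturnstile> z \<cdot> i \<^bold>= a" "T2 \<tturnstile> z \<cdot> j \<^bold>= y \<cdot> m"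
        | (ya) m where "Z T2 j" "F T2 m" "T2 \<tturnstile> z \<cdot> i \<^bold>= y \<cdot> m" "T2 \<tturnstile> z \<cdot> j \<^bold>= a"
        | (yy) m m' where "F T2 m" "F T2 m'" "T2 \<tturnstile> z \<cdot> i \<^bold>= y \<cdot> m" "T2 \<tturnstile> z \<cdot> j \<^bold>= y \<cdot> m'"
        using z_cases[OF T2T i(1)] z_cases[OF T2T j(1)] by blast
      then show ?thesis
      proof cases
        case aa
        then show ?thesis using zz small[OF a2] by blast
      next
        case ay
        note ym = y'[OF T2T F_D[OF ay(2)]]
        show ?thesis
          using zz[OF ay(3,4)] forces_eq_less[OF symmetric[OF T20 a2 ym] near[OF ay(1,2) i]] by blast
      next
        case ya
        then show ?thesis using zz[OF ya(3,4)] near[OF ya(1,2) j] by blast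
      next
        case yy
        note eq = forces_trans[OF yy(4) F_eq[OF yy(2,1) T2T]]
        show ?thesis using zz[OF yy(3) eq] small[OF y'[OF T2T F_D[OF yy(1)]]] by blast
      qed
    qed
    then show "\<exists>N\<in>D T1 NAT. \<forall>T2\<in>exts T1. \<forall>m\<in>D T2 NAT. \<forall>n\<in>D T2 NAT.
        (T2 \<tturnstile> N \<preceq> m) \<longrightarrow> (T2 \<tturnstile> N \<preceq> n) \<longrightarrow> (T2 \<tturnstile> \<sigma> \<cdot> (z \<cdot> m) \<cdot> (z \<cdot> n) \<^bold>< e)"
      using N(1) by blast
  qed
  then obtain l where l: "l \<in> D T X" "converges_in \<sigma> T z l" using limit[OF T z(1)] by blast
  have TT: "T \<in> exts T" using world_exts[OF W] .
  have near_l: "\<exists>N \<in> D T1 NAT. \<forall>n \<in> D T1 NAT. (T1 \<tturnstile> N \<preceq> n) \<longrightarrow> (T1 \<tturnstile> \<sigma> \<cdot> (z \<cdot> n) \<cdot> l \<^bold>< e)"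
    if "T1 \<in> exts T" "T1 \<tturnstile> \<^bold>0 \<^bold>< e" for T1 e
    using l(2) that world_exts[OF W'[OF that(1)]] unfolding converges_in_def by blast
  from forces_less_cotrans[OF W \<alpha> r_D[OF T l(1)]] show ?thesis
  proof
    assume "T \<tturnstile> \<^bold>0 \<^bold>< r l"
    then have la: "T \<tturnstile> \<^bold>0 \<^bold>< \<sigma> \<cdot> l \<cdot> a" using strong_ext[OF T l(1) D0(3)] by blast
    \<comment> \<open>The tolerance is the positive distance from \<open>l\<close> to
      \<open>a\<close>; closer than that, \<open>z N\<close> cannot be \<open>a\<close>.\<close>
    obtain N where N: "N \<in> D T NAT" "T \<tturnstile> \<sigma> \<cdot> (z \<cdot> N) \<cdot> l \<^bold>< \<sigma> \<cdot> l \<cdot> a"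
      using near_l[OF TT la] nle_refl[OF W] by blast
    have "\<not> (T \<tturnstile> z \<cdot> N \<^bold>= a)"
    proof
      assume "T \<tturnstile> z \<cdot> N \<^bold>= a"
      then have "T \<tturnstile> \<sigma> \<cdot> (z \<cdot> N) \<cdot> l \<^bold>= \<sigma> \<cdot> a \<cdot> l"
        using \<sigma>_cong[OF T _ forces_refl[OF l(1)] z'[OF TT N(1)] l(1)] by blast
      also have "T \<tturnstile> \<sigma> \<cdot> a \<cdot> l \<^bold>= \<sigma> \<cdot> l \<cdot> a" using symmetric[OF T D0(3) l(1)] .
      finally have "T \<tturnstile> \<sigma> \<cdot> l \<cdot> a \<^bold>< \<sigma> \<cdot> l \<cdot> a" using forces_eq_less[OF forces_sym N(2)] by blast
      then show False using forces_less_asym[OF W] by blast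
    qed
    then obtain m where "F T m" using z_cases[OF TT N(1)] by blast
    then show ?thesis using one[OF TT] by (auto simp: F_def)
  next
    assume lt: "T \<tturnstile> r l \<^bold>< \<alpha>"
    have "T' \<tturnstile> open_fm 0 n B" if T': "T' \<in> exts T" and n: "n \<in> D T' NAT" for T' n
    proof (rule ccontr)
      assume "\<not> (T' \<tturnstile> open_fm 0 n B)"
      then have n1: "T' \<tturnstile> \<mu> \<cdot> n \<^bold>= nat_one" using \<mu>(2)[OF T' n] by blast
      have W1: "world T'" using W'[OF T'] .
      have Sn: "Cst NSuc \<cdot> n \<in> D T' NAT" using n by simp
      \<comment> \<open>The successor makes the strict range of \<open>Z\<close> include
        \<open>n\<close> itself.\<close>
      have "\<not> Z T' (Cst NSuc \<cdot> n)"
        using ZD[OF _ T' n nle_refl[OF W1 Sn]] forces_not_zero_one[OF W1] n1 by blast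
      then obtain m where m: "F T' m" using Z_or_F[OF T' Sn] by blast
      note mD = F_D[OF m]
      note ym = y'[OF T' mD]
      have T'0: "T' \<in> exts T0" using up[OF T'] .
      have l': "l \<in> D T' X" using D_mono[OF l(1) T'] .
      \<comment> \<open>Tightness reduces this to refuting a positive distance in every extension.
        Taking that distance as the tolerance leads to an index where \<open>z\<close> agrees with
        \<open>y m\<close> and is yet closer to \<open>l\<close>.\<close>
      have "T' \<tturnstile> \<sigma> \<cdot> (y \<cdot> m) \<cdot> l \<^bold>= \<^bold>0"
      proof (rule forces_less_tight[OF W1 \<sigma>_D[OF T'0 ym l'] D_const(2)], intro HOL.conjI)
        fix U assume U: "U \<in> exts T'"
        have UT: "U \<in> exts T" using exts_trans[OF T' U] .
        have U0: "U \<in> exts T0" using up[OF UT] .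
        have WU: "world U" using extsD[OF U] .
        have mU: "m \<in> D U NAT" "y \<cdot> m \<in> D U X" "l \<in> D U X"
          using D_mono[OF mD U] D_mono[OF ym U] D_mono[OF l' U] by auto
        have FU: "F U m"
          using m mU(1) forces_mono[OF _ U] exts_trans[OF U] unfolding F_def Z_def by blast
        show "\<not> (U \<tturnstile> \<sigma> \<cdot> (y \<cdot> m) \<cdot> l \<^bold>< \<^bold>0)" using nonneg[OF U0 mU(2,3)] .
        show "\<not> (U \<tturnstile> \<^bold>0 \<^bold>< \<sigma> \<cdot> (y \<cdot> m) \<cdot> l)"
        proof
          assume "U \<tturnstile> \<^bold>0 \<^bold>< \<sigma> \<cdot> (y \<cdot> m) \<cdot> l"
          then obtain N where N: "N \<in> D U NAT" "\<And>i. i \<in> D U NAT \<Longrightarrow> U \<tturnstile> N \<preceq> i \<Longrightarrow>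
              U \<tturnstile> \<sigma> \<cdot> (z \<cdot> i) \<cdot> l \<^bold>< \<sigma> \<cdot> (y \<cdot> m) \<cdot> l"
            using near_l[OF UT] by blast
          have Sm: "Cst NSuc \<cdot> m \<in> D U NAT" using mU by simp
          \<comment> \<open>The larger of \<open>N\<close> and the successor of \<open>m\<close>;
            strictly beyond \<open>m\<close> the sequence \<open>z\<close> has switched to
            \<open>y m\<close>.\<close>
          obtain i where i: "i \<in> D U NAT" "U \<tturnstile> N \<preceq> i" "U \<tturnstile> Cst NSuc \<cdot> m \<preceq> i"
            using nle_linear[OF WU N(1) Sm] nle_refl[OF WU N(1)] nle_refl[OF WU Sm]
              nle_trans[OF WU Sm _ N(1) nle_suc[OF WU Sm]] N(1) Sm D_const(4) by blast
          have "\<not> Z U i" using Z_F[OF _ FU UT i(3)] by blast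
          then obtain m' where m': "F U m'" "U \<tturnstile> z \<cdot> i \<^bold>= y \<cdot> m'" using z_cases[OF UT i(1)] by blast
          have "U \<tturnstile> z \<cdot> i \<^bold>= y \<cdot> m" using forces_trans[OF m'(2) F_eq[OF m'(1) FU UT]] .
          then have "U \<tturnstile> \<sigma> \<cdot> (z \<cdot> i) \<cdot> l \<^bold>= \<sigma> \<cdot> (y \<cdot> m) \<cdot> l"
            using \<sigma>_cong[OF U0 _ forces_refl[OF mU(3)] z'[OF UT i(1)] mU(3)] by blast
          then have "U \<tturnstile> \<sigma> \<cdot> (y \<cdot> m) \<cdot> l \<^bold>< \<sigma> \<cdot> (y \<cdot> m) \<cdot> l"
            using forces_eq_less[OF forces_sym N(2)[OF i(1,2)]] by blast
          then show False using forces_less_asym[OF WU] by blast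
        qed
      qed
      then have "T' \<tturnstile> y \<cdot> m \<^bold>= l" using identity[OF T'0 ym l'] by blast
      then have "T' \<tturnstile> r (y \<cdot> m) \<^bold>= r l" using r_cong[OF T'0 _ ym] by blast
      then have "T' \<tturnstile> r (y \<cdot> m) \<^bold>< \<alpha>" using forces_eq_less forces_mono[OF lt T'] by blast
      moreover have "T' \<tturnstile> \<alpha> \<^bold>< r (y \<cdot> m)" using one[OF T' mD] m by (auto simp: F_def)
      ultimately show False using forces_less_asym[OF W1] by blast
    qed
    then show ?thesis by blast
  qed
qed

end

section \<open>Omniscience from a sequence converging to \<open>a\<close>\<close>

locale convergent_sequence = strongly_extensional_map +
  fixes xs \<beta> :: tm
  assumes xs0: "xs \<in> D T0 (FUN NAT X)"
    and conv0: "converges_in \<sigma> T0 xs a"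
    and \<beta>0: "T0 \<tturnstile> \<^bold>0 \<^bold>< \<beta>"
begin

lemma xs_D: "T \<in> exts T0 \<Longrightarrow> n \<in> D T NAT \<Longrightarrow> xs \<cdot> n \<in> D T X"
  using D_mono[OF xs0] by (blast intro: D_app)

lemma \<beta>_D: "T \<in> exts T0 \<Longrightarrow> \<beta> \<in> D T REAL"
  using forces_less_D[OF \<beta>0] D_mono by blast

lemma params_D:
  assumes "T \<in> exts T0"
  shows "\<rho> \<in> D T (FUN Y (FUN Y REAL))" "f \<in> D T (FUN X Y)" "a \<in> D T X" "xs \<in> D T (FUN NAT X)"
    "\<beta> \<in> D T REAL"
  using D_mono[OF \<rho>0 assms] D_mono[OF f0 assms] D_mono[OF a0 assms] D_mono[OF xs0 assms] \<beta>_D[OF assms]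
  by auto

lemma q_D: "T \<in> exts T0 \<Longrightarrow> n \<in> D T NAT \<Longrightarrow> r (xs \<cdot> n) \<in> D T REAL"
  by (intro r_D xs_D)

lemma converges_in_mono: "converges_in d T s l \<Longrightarrow> T' \<in> exts T \<Longrightarrow> converges_in d T' s l"
  unfolding converges_in_def using exts_trans by blast

definition finally_less :: "fm set \<Rightarrow> tm \<Rightarrow> bool" where
  "finally_less T N \<longleftrightarrow>
     (\<forall>T' \<in> exts T. \<forall>n \<in> D T' NAT. (T' \<tturnstile> N \<preceq> n) \<longrightarrow> (T' \<tturnstile> r (xs \<cdot> n) \<^bold>< \<beta>))"

text \<open>Kripke reading of the negation, that is, of
  \<open>\<beta> \<le> r (xs n)\<close>.\<close>

definition not_less :: "fm set \<Rightarrow> tm \<Rightarrow> bool" where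
  "not_less T n \<longleftrightarrow> (\<forall>T' \<in> exts T. \<not> (T' \<tturnstile> r (xs \<cdot> n) \<^bold>< \<beta>))"

text \<open>A semantic limited principle of omniscience. The alternatives are formulas, so that
  choice applies to them; they may overlap, and they may contain parameters of any world above
  \<open>T0\<close>.\<close>

definition lpo :: bool where
  "lpo \<longleftrightarrow> (\<forall>T \<in> exts T0. \<forall>A B. wff [NAT] A \<longrightarrow> fv A \<subseteq> lang T \<longrightarrow> wff [NAT] B \<longrightarrow> fv B \<subseteq> lang T \<longrightarrow>
     (\<forall>T' \<in> exts T. \<forall>n \<in> D T' NAT. (T' \<tturnstile> open_fm 0 n A) \<or> (T' \<tturnstile> open_fm 0 n B)) \<longrightarrow>
     (\<exists>n \<in> D T NAT. T \<tturnstile> open_fm 0 n A) \<or> (\<forall>T' \<in> exts T. \<forall>n \<in> D T' NAT. T' \<tturnstile> open_fm 0 n B))"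

lemma lpoD:
  assumes "lpo" "T \<in> exts T0" "wff [NAT] A" "fv A \<subseteq> lang T" "wff [NAT] B" "fv B \<subseteq> lang T"
    and "\<And>T' n. T' \<in> exts T \<Longrightarrow> n \<in> D T' NAT \<Longrightarrow> (T' \<tturnstile> open_fm 0 n A) \<or> (T' \<tturnstile> open_fm 0 n B)"
  shows "(\<exists>n \<in> D T NAT. T \<tturnstile> open_fm 0 n A) \<or> (\<forall>T' \<in> exts T. \<forall>n \<in> D T' NAT. T' \<tturnstile> open_fm 0 n B)"
  using assms unfolding lpo_def by blast

text \<open>The trick is applied to the tail of \<open>xs\<close> past a given \<open>N\<close>,
  then to the search for a last index with value 1, and, if there is none, to a sequence built from
  the indices with value 1, where arbitrary formulas may take the place of \<open>A\<close>.\<close>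

lemma finally_less_or_lpo: "(\<exists>N \<in> D T0 NAT. finally_less T0 N) \<or> lpo"
proof -
  have T00: "T0 \<in> exts T0" using world_exts[OF world0] .
  note W = extsD
  obtain \<alpha> where \<alpha>: "\<alpha> \<in> D T0 REAL" "T0 \<tturnstile> \<^bold>0 \<^bold>< \<alpha>" "T0 \<tturnstile> \<alpha> \<^bold>< \<beta>"
    using forces_between_zero[OF world0 \<beta>0] by blast
  have \<alpha>_D: "\<alpha> \<in> D T REAL" if "T \<in> exts T0" for T using D_mono[OF \<alpha>(1) that] .
  let ?q = "\<rho> \<cdot> (f \<cdot> (xs \<cdot> Bv 0)) \<cdot> (f \<cdot> a)"
  note P0 = params_D[OF T00]
  have open_q: "open_fm 0 n (\<alpha> \<^bold>< ?q) = (\<alpha> \<^bold>< r (xs \<cdot> n))" "open_fm 0 n (?q \<^bold>< \<beta>) = (r (xs \<cdot> n) \<^bold>< \<beta>)" for n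
    using P0 \<alpha>(1) by simp_all
  have wq: "wff [NAT] (\<alpha> \<^bold>< ?q)" "fv (\<alpha> \<^bold>< ?q) \<subseteq> lang T0" "wff [NAT] (?q \<^bold>< \<beta>)" "fv (?q \<^bold>< \<beta>) \<subseteq> lang T0"
    using P0 \<alpha>(1) by simp_all
  have "(T \<tturnstile> open_fm 0 n (\<alpha> \<^bold>< ?q)) \<or> (T \<tturnstile> open_fm 0 n (?q \<^bold>< \<beta>))" if "T \<in> exts T0" "n \<in> D T NAT" for T n
    unfolding open_q using forces_less_cotrans[OF W forces_mono[OF \<alpha>(3)] q_D] that by blast
  from forces_disj_choice[OF world0 wq this]
  obtain \<mu> where \<mu>: "\<mu> \<in> D T0 (FUN NAT NAT)"
    "\<And>T n. T \<in> exts T0 \<Longrightarrow> n \<in> D T NAT \<Longrightarrow>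
      (T \<tturnstile> \<mu> \<cdot> n \<^bold>= Cst NZero) \<and> (T \<tturnstile> r (xs \<cdot> n) \<^bold>< \<beta>) \<or>
      (T \<tturnstile> \<mu> \<cdot> n \<^bold>= nat_one) \<and> (T \<tturnstile> \<alpha> \<^bold>< r (xs \<cdot> n))"
    unfolding open_q by metis
  have \<mu>_D: "\<mu> \<in> D T (FUN NAT NAT)" if "T \<in> exts T0" for T using D_mono[OF \<mu>(1) that] .
  have \<mu>n_D: "\<mu> \<cdot> n \<in> D T NAT" if "T \<in> exts T0" "n \<in> D T NAT" for T n
    using D_app[OF \<mu>_D[OF that(1)] that(2)] .
  have zero: "T \<tturnstile> r (xs \<cdot> n) \<^bold>< \<beta>" if "T \<in> exts T0" "n \<in> D T NAT" "T \<tturnstile> \<mu> \<cdot> n \<^bold>= Cst NZero" for T n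
    using \<mu>(2)[OF that(1,2)] forces_not_zero_one[OF W[OF that(1)] that(3)] by blast
  have one: "T \<tturnstile> \<alpha> \<^bold>< r (xs \<cdot> n)" if "T \<in> exts T0" "n \<in> D T NAT" "T \<tturnstile> \<mu> \<cdot> n \<^bold>= nat_one" for T n
    using \<mu>(2)[OF that(1,2)] forces_not_zero_one[OF W[OF that(1)]] that(3) by blast
  have \<mu>_Form: "(\<mu> \<cdot> n \<^bold>= Cst NZero) \<in> Form T" "(\<mu> \<cdot> n \<^bold>= nat_one) \<in> Form T"
    if "T \<in> exts T0" "n \<in> D T NAT" for T n
    using \<mu>n_D[OF that] by (auto simp: Form_simps intro!: HOL.exI[of _ NAT])

  define Z where "Z T N \<longleftrightarrow> (\<forall>T' \<in> exts T. \<forall>n \<in> D T' NAT.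
      (T' \<tturnstile> N \<preceq> n) \<longrightarrow> (T' \<tturnstile> \<mu> \<cdot> n \<^bold>= Cst NZero))" for T N
  define I where "I T N \<longleftrightarrow> (\<exists>n \<in> D T NAT. (T \<tturnstile> N \<preceq> n) \<and> (T \<tturnstile> \<mu> \<cdot> n \<^bold>= nat_one))" for T N
  have Z_less: "finally_less T N" if "Z T N" "T \<in> exts T0" for T N
    unfolding finally_less_def using that zero exts_trans[OF that(2)] unfolding Z_def by blast

  have I_or_Z: "I T N \<or> Z T N" if T: "T \<in> exts T0" and N: "N \<in> D T NAT" for T N
  proof -
    let ?A = "Ex NAT (Bv 1 \<^bold>= N \<^bold>+\<^sub>N Bv 0) \<^bold>\<and> \<mu> \<cdot> Bv 0 \<^bold>= nat_one"
    let ?B = "Ex NAT (Bv 1 \<^bold>= N \<^bold>+\<^sub>N Bv 0) \<^bold>\<longrightarrow> \<mu> \<cdot> Bv 0 \<^bold>= Cst NZero"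
    have A: "open_fm 0 n ?A = (N \<preceq> n \<^bold>\<and> \<mu> \<cdot> n \<^bold>= nat_one)" for n using N \<mu>_D[OF T] by simp
    have B: "open_fm 0 n ?B = (N \<preceq> n \<^bold>\<longrightarrow> \<mu> \<cdot> n \<^bold>= Cst NZero)" for n using N \<mu>_D[OF T] by simp
    have semB: "(T' \<tturnstile> open_fm 0 n ?B) \<longleftrightarrow>
        (\<forall>T'' \<in> exts T'. (T'' \<tturnstile> N \<preceq> n) \<longrightarrow> (T'' \<tturnstile> \<mu> \<cdot> n \<^bold>= Cst NZero))"
      if T': "T' \<in> exts T" and n: "n \<in> D T' NAT" for T' n
      unfolding B forces_imp[OF W[OF T']]
      using \<mu>_Form(1)[OF exts_trans[OF T T'] n] n D_mono[OF N T'] by (simp add: Form_simps(8))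
    have "(\<exists>n \<in> D T NAT. T \<tturnstile> open_fm 0 n ?A) \<or> (\<forall>T' \<in> exts T. \<forall>n \<in> D T' NAT. T' \<tturnstile> open_fm 0 n ?B)"
    proof (rule ishihara_trick[OF T params_D(4)[OF T] converges_in_mono[OF conv0 T] forces_mono[OF \<alpha>(2) T]])
      show "wff [NAT] ?A" "fv ?A \<subseteq> lang T" "wff [NAT] ?B" "fv ?B \<subseteq> lang T"
        using N \<mu>_D[OF T] by simp_all
      fix T' n assume T': "T' \<in> exts T" and n: "n \<in> D T' NAT"
      have T'0: "T' \<in> exts T0" using exts_trans[OF T T'] .
      consider (0) "T' \<tturnstile> \<mu> \<cdot> n \<^bold>= Cst NZero" | (1) "T' \<tturnstile> \<mu> \<cdot> n \<^bold>= nat_one" "T' \<tturnstile> N \<preceq> n"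
        | (2) "T' \<tturnstile> Cst NSuc \<cdot> n \<preceq> N"
        using \<mu>(2)[OF T'0 n] nle_linear[OF W[OF T'] D_mono[OF N T'] n] by blast
      then show "(T' \<tturnstile> open_fm 0 n ?A) \<and> (T' \<tturnstile> \<alpha> \<^bold>< r (xs \<cdot> n)) \<or> (T' \<tturnstile> open_fm 0 n ?B)"
      proof cases
        case 0
        then show ?thesis using semB[OF T' n] forces_mono by blast
      next
        case 1
        then show ?thesis using one[OF T'0 n] unfolding A forces_conj by blast
      next
        \<comment> \<open>For \<open>n < N\<close> the guard is forced in no extension, so the
          implication \<open>?B\<close> holds vacuously.\<close>
        case 2
        have "\<not> (T'' \<tturnstile> N \<preceq> n)" if T'': "T'' \<in> exts T'" for T''
        proof
          assume "T'' \<tturnstile> N \<preceq> n"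
          then have "T'' \<tturnstile> Cst NSuc \<cdot> n \<preceq> n"
            using nle_trans[OF W[OF T''], of "Cst NSuc \<cdot> n" N n] forces_mono[OF 2 T'']
              D_mono[OF n T''] D_mono[OF D_mono[OF N T'] T''] by simp
          then show False using not_suc_nle_self[OF W[OF T''] D_mono[OF n T'']] by blast
        qed
        then show ?thesis using semB[OF T' n] by blast
      qed
    qed
    then show ?thesis
    proof
      assume "\<exists>n \<in> D T NAT. T \<tturnstile> open_fm 0 n ?A"
      then show ?thesis unfolding A forces_conj I_def by blast
    next
      assume "\<forall>T' \<in> exts T. \<forall>n \<in> D T' NAT. T' \<tturnstile> open_fm 0 n ?B"
      then have "Z T N" unfolding Z_def using semB world_exts W by blast
      then show ?thesis by blast
    qed
  qed

  have I_iff: "(T \<tturnstile> Ex NAT (Ex NAT (Bv 1 \<^bold>= N \<^bold>+\<^sub>N Bv 0) \<^bold>\<and> \<mu> \<cdot> Bv 0 \<^bold>= nat_one)) \<longleftrightarrow> I T N"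
    if "T \<in> exts T0" "N \<in> D T NAT" for T N
    using that \<mu>_D[OF that(1)] by (simp add: forces_ex[OF W[OF that(1)]] forces_conj I_def)
  have Z_iff: "(T \<tturnstile> All NAT (Ex NAT (Bv 1 \<^bold>= N \<^bold>+\<^sub>N Bv 0) \<^bold>\<longrightarrow> \<mu> \<cdot> Bv 0 \<^bold>= Cst NZero)) \<longleftrightarrow> Z T N"
    if "T \<in> exts T0" "N \<in> D T NAT" for T N
    using that \<mu>_D[OF that(1)] by (simp add: forces_all_imp[OF W[OF that(1)]] Z_def)

  \<comment> \<open>\<open>?A\<close> marks \<open>N\<close> as the last index with value 1, and by
    containing \<open>\<mu> N = 1\<close> it brings the bound that the trick requires. If there is
    no such \<open>N\<close>, every index with value 1 is followed by another one.\<close>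
  have "(\<exists>N \<in> D T0 NAT. Z T0 N) \<or> (\<forall>T \<in> exts T0. \<forall>N \<in> D T NAT. (T \<tturnstile> \<mu> \<cdot> N \<^bold>= nat_one) \<longrightarrow> I T (Cst NSuc \<cdot> N))"
  proof -
    let ?A = "\<mu> \<cdot> Bv 0 \<^bold>= nat_one \<^bold>\<and>
      All NAT (Ex NAT (Bv 1 \<^bold>= Cst NSuc \<cdot> Bv 2 \<^bold>+\<^sub>N Bv 0) \<^bold>\<longrightarrow> \<mu> \<cdot> Bv 0 \<^bold>= Cst NZero)"
    let ?B = "\<mu> \<cdot> Bv 0 \<^bold>= Cst NZero \<^bold>\<or>
      Ex NAT (Ex NAT (Bv 1 \<^bold>= Cst NSuc \<cdot> Bv 2 \<^bold>+\<^sub>N Bv 0) \<^bold>\<and> \<mu> \<cdot> Bv 0 \<^bold>= nat_one)"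
    have semA: "(T \<tturnstile> open_fm 0 N ?A) \<longleftrightarrow> (T \<tturnstile> \<mu> \<cdot> N \<^bold>= nat_one) \<and> Z T (Cst NSuc \<cdot> N)"
      if "T \<in> exts T0" "N \<in> D T NAT" for T N
      using that \<mu>_D[OF that(1)] Z_iff[OF that(1), of "Cst NSuc \<cdot> N"]
      by (simp add: forces_conj eval_nat_numeral)
    have semB: "(T \<tturnstile> open_fm 0 N ?B) \<longleftrightarrow> (T \<tturnstile> \<mu> \<cdot> N \<^bold>= Cst NZero) \<or> I T (Cst NSuc \<cdot> N)"
      if "T \<in> exts T0" "N \<in> D T NAT" for T N
      using that \<mu>_D[OF that(1)] I_iff[OF that(1), of "Cst NSuc \<cdot> N"] \<mu>_Form(1)[OF that]
      by (simp add: forces_disj[OF W[OF that(1)]] Form_simps(8) eval_nat_numeral)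
    have "(\<exists>n \<in> D T0 NAT. T0 \<tturnstile> open_fm 0 n ?A) \<or> (\<forall>T' \<in> exts T0. \<forall>n \<in> D T' NAT. T' \<tturnstile> open_fm 0 n ?B)"
    proof (rule ishihara_trick[OF T00 xs0 conv0 \<alpha>(2)])
      show "wff [NAT] ?A" "fv ?A \<subseteq> lang T0" "wff [NAT] ?B" "fv ?B \<subseteq> lang T0"
        using \<mu>(1) by (simp_all add: eval_nat_numeral)
      fix T N assume T: "T \<in> exts T0" and N: "N \<in> D T NAT"
      have "I T (Cst NSuc \<cdot> N) \<or> Z T (Cst NSuc \<cdot> N)" using I_or_Z[OF T] N by simp
      then show "(T \<tturnstile> open_fm 0 N ?A) \<and> (T \<tturnstile> \<alpha> \<^bold>< r (xs \<cdot> N)) \<or> (T \<tturnstile> open_fm 0 N ?B)"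
        unfolding semA[OF T N] semB[OF T N] using \<mu>(2)[OF T N] by blast
    qed
    then show ?thesis
    proof
      assume "\<exists>n \<in> D T0 NAT. T0 \<tturnstile> open_fm 0 n ?A"
      then show ?thesis using semA[OF T00] D_const(4) by blast
    next
      assume "\<forall>T' \<in> exts T0. \<forall>n \<in> D T' NAT. T' \<tturnstile> open_fm 0 n ?B"
      then show ?thesis using semB forces_not_zero_one W by blast
    qed
  qed
  then consider "\<exists>N \<in> D T0 NAT. Z T0 N"
    | (often) "\<And>T N. T \<in> exts T0 \<Longrightarrow> N \<in> D T NAT \<Longrightarrow> T \<tturnstile> \<mu> \<cdot> N \<^bold>= nat_one \<Longrightarrow> I T (Cst NSuc \<cdot> N)"
      "I T0 (Cst NZero)"
    using I_or_Z[OF T00 D_const(1)] D_const(1)[of T0] by blast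
  then show ?thesis
  proof cases
    case 1
    then show ?thesis using Z_less T00 by blast
  next
    case often
    \<comment> \<open>Starting from one index with value 1, induction on \<open>N\<close> finds one
      at or beyond every \<open>N\<close>.\<close>
    have I: "I T N" if T: "T \<in> exts T0" and N: "N \<in> D T NAT" for T N
    proof -
      let ?B = "Ex NAT (Ex NAT (Bv 1 \<^bold>= Bv 2 \<^bold>+\<^sub>N Bv 0) \<^bold>\<and> \<mu> \<cdot> Bv 0 \<^bold>= nat_one)"
      have sem: "(T' \<tturnstile> open_fm 0 N ?B) \<longleftrightarrow> I T' N" if "T' \<in> exts T0" "N \<in> D T' NAT" for T' N
        using I_iff[OF that] \<mu>_D[OF that(1)] by (simp add: eval_nat_numeral)
      have "T \<tturnstile> open_fm 0 N ?B"
      proof (rule forces_nat_induct[OF W[OF T] _ _ N])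
        have "T \<tturnstile> open_fm 0 (Cst NZero) ?B"
          using sem[OF T00 D_const(1)] often(2) forces_mono[OF _ T] by blast
        then show "T \<tturnstile> open_fm 0 (Cst NZero) ?B" .
      next
        fix T' N assume T': "T' \<in> exts T" and N: "N \<in> D T' NAT" and IH: "T' \<tturnstile> open_fm 0 N ?B"
        have T'0: "T' \<in> exts T0" using exts_trans[OF T T'] .
        have SN: "Cst NSuc \<cdot> N \<in> D T' NAT" using N by simp
        obtain n where n: "n \<in> D T' NAT" "T' \<tturnstile> N \<preceq> n" "T' \<tturnstile> \<mu> \<cdot> n \<^bold>= nat_one"
          using IH sem[OF T'0 N] by (auto simp: I_def)
        have "I T' (Cst NSuc \<cdot> N)"
          using nle_cases[OF W[OF T'] N n(1,2)]
        proof
          assume "T' \<tturnstile> N \<^bold>= n"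
          then have "T' \<tturnstile> \<mu> \<cdot> N \<^bold>= \<mu> \<cdot> n"
            using forces_app[OF forces_refl[OF \<mu>_D[OF T'0]] _ \<mu>_D[OF T'0] N] by blast
          then show ?thesis using often(1)[OF T'0 N] forces_trans[OF _ n(3)] by blast
        next
          assume "T' \<tturnstile> Cst NSuc \<cdot> N \<preceq> n"
          then show ?thesis using n by (auto simp: I_def)
        qed
        then show "T' \<tturnstile> open_fm 0 (Cst NSuc \<cdot> N) ?B" using sem[OF T'0 SN] by blast
      qed (use \<mu>_D[OF T] in \<open>simp_all add: eval_nat_numeral\<close>)
      then show ?thesis using sem[OF T N] by blast
    qed
    \<comment> \<open>The value is some \<open>xs n\<close> with \<open>n\<close> at or beyond
      \<open>N\<close> and \<open>\<mu> n = 1\<close>. Under the two binders the argument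
      \<open>N\<close>, index 1 outside, has become index 3.\<close>
    let ?C = "Ex NAT ((Ex NAT (Bv 1 \<^bold>= Bv 3 \<^bold>+\<^sub>N Bv 0) \<^bold>\<and> \<mu> \<cdot> Bv 0 \<^bold>= nat_one) \<^bold>\<and> Bv 1 \<^bold>= xs \<cdot> Bv 0)"
    have sem: "(T \<tturnstile> open_fm 0 x (open_fm 1 N ?C)) \<longleftrightarrow>
        (\<exists>n \<in> D T NAT. (T \<tturnstile> N \<preceq> n) \<and> (T \<tturnstile> \<mu> \<cdot> n \<^bold>= nat_one) \<and> (T \<tturnstile> x \<^bold>= xs \<cdot> n))"
      if "T \<in> exts T0" "N \<in> D T NAT" "x \<in> D T X" for T N x
      using that \<mu>_D[OF that(1)] params_D(4)[OF that(1)]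
      by (simp add: forces_ex[OF W[OF that(1)]] forces_conj eval_nat_numeral)
    have "\<exists>x \<in> D T X. T \<tturnstile> open_fm 0 x (open_fm 1 N ?C)" if "T \<in> exts T0" "N \<in> D T NAT" for T N
    proof -
      have "I T N" using I[OF that] .
      then obtain n where n: "n \<in> D T NAT" "T \<tturnstile> N \<preceq> n" "T \<tturnstile> \<mu> \<cdot> n \<^bold>= nat_one"
        by (auto simp: I_def)
      then show ?thesis
        using sem[OF that xs_D[OF that(1) n(1)]] forces_refl[OF xs_D[OF that(1) n(1)]]
          xs_D[OF that(1) n(1)] by blast
    qed
    moreover have "wff [X, NAT] ?C" "fv ?C \<subseteq> lang T0"
      using \<mu>(1) xs0 by (simp_all add: eval_nat_numeral)
    ultimately obtain y where y: "y \<in> D T0 (FUN NAT X)"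
      "\<And>T N. T \<in> exts T0 \<Longrightarrow> N \<in> D T NAT \<Longrightarrow> T \<tturnstile> open_fm 0 (y \<cdot> N) (open_fm 1 N ?C)"
      using forces_countable_choice[OF world0, of X ?C] by blast
    have y_D: "y \<cdot> N \<in> D T X" if "T \<in> exts T0" "N \<in> D T NAT" for T N
      using D_app[OF D_mono[OF y(1) that(1)] that(2)] .
    have y_xs: "\<exists>n \<in> D T NAT. (T \<tturnstile> N \<preceq> n) \<and> (T \<tturnstile> \<mu> \<cdot> n \<^bold>= nat_one) \<and> (T \<tturnstile> y \<cdot> N \<^bold>= xs \<cdot> n)"
      if "T \<in> exts T0" "N \<in> D T NAT" for T N
      using sem[OF that y_D[OF that]] y(2)[OF that] by blast
    have far: "T \<tturnstile> \<alpha> \<^bold>< r (y \<cdot> N)" if T: "T \<in> exts T0" and N: "N \<in> D T NAT" for T N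
    proof -
      obtain n where n: "n \<in> D T NAT" "T \<tturnstile> \<mu> \<cdot> n \<^bold>= nat_one" "T \<tturnstile> y \<cdot> N \<^bold>= xs \<cdot> n"
        using y_xs[OF T N] by blast
      show ?thesis
        using forces_less_eq[OF one[OF T n(1,2)] r_cong[OF T forces_sym[OF n(3)] xs_D[OF T n(1)]]] .
    qed
    \<comment> \<open>As \<open>y N\<close> is a term of \<open>xs\<close> at or beyond
      \<open>N\<close>, a bound that serves for \<open>xs\<close> also serves for
      \<open>y\<close>.\<close>
    have conv: "converges_in \<sigma> T0 y a"
      unfolding converges_in_def
    proof (intro ballI HOL.allI HOL.impI)
      fix T1 e assume T1: "T1 \<in> exts T0" and e: "T1 \<tturnstile> \<^bold>0 \<^bold>< e"
      obtain N where N: "N \<in> D T1 NAT" "\<And>T2 n. T2 \<in> exts T1 \<Longrightarrow> n \<in> D T2 NAT \<Longrightarrow> T2 \<tturnstile> N \<preceq> n \<Longrightarrow>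
          T2 \<tturnstile> \<sigma> \<cdot> (xs \<cdot> n) \<cdot> a \<^bold>< e"
        using conv0 T1 e unfolding converges_in_def by meson
      have "T2 \<tturnstile> \<sigma> \<cdot> (y \<cdot> n) \<cdot> a \<^bold>< e" if T2: "T2 \<in> exts T1" and n: "n \<in> D T2 NAT" "T2 \<tturnstile> N \<preceq> n" for T2 n
      proof -
        have T20: "T2 \<in> exts T0" using exts_trans[OF T1 T2] .
        obtain k where k: "k \<in> D T2 NAT" "T2 \<tturnstile> n \<preceq> k" "T2 \<tturnstile> y \<cdot> n \<^bold>= xs \<cdot> k"
          using y_xs[OF T20 n(1)] by blast
        have "T2 \<tturnstile> N \<preceq> k" using nle_trans[OF W[OF T2] D_mono[OF N(1) T2] n(1) k(1) n(2) k(2)] .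
        then show ?thesis
          using forces_eq_less[OF \<sigma>_cong[OF T20 k(3) forces_refl[OF a_D[OF T20]] y_D[OF T20 n(1)]
                a_D[OF T20]] N(2)[OF T2 k(1)]] by blast
      qed
      then show "\<exists>N\<in>D T1 NAT. \<forall>T2\<in>exts T1. \<forall>n\<in>D T2 NAT. (T2 \<tturnstile> N \<preceq> n) \<longrightarrow> (T2 \<tturnstile> \<sigma> \<cdot> (y \<cdot> n) \<cdot> a \<^bold>< e)"
        using N(1) by blast
    qed
    \<comment> \<open>Along \<open>y\<close> the side condition holds at every index, so no
      restriction on \<open>A\<close> remains.\<close>
    have lpo
      unfolding lpo_def
    proof (intro ballI HOL.allI HOL.impI)
      fix T A B
      assume T: "T \<in> exts T0" and AB: "wff [NAT] A" "fv A \<subseteq> lang T" "wff [NAT] B" "fv B \<subseteq> lang T"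
        "\<forall>T' \<in> exts T. \<forall>n \<in> D T' NAT. (T' \<tturnstile> open_fm 0 n A) \<or> (T' \<tturnstile> open_fm 0 n B)"
      show "(\<exists>n \<in> D T NAT. T \<tturnstile> open_fm 0 n A) \<or> (\<forall>T' \<in> exts T. \<forall>n \<in> D T' NAT. T' \<tturnstile> open_fm 0 n B)"
      proof (rule ishihara_trick[OF T D_mono[OF y(1) T] converges_in_mono[OF conv T]
            forces_mono[OF \<alpha>(2) T] AB(1-4)])
        fix T' n assume "T' \<in> exts T" "n \<in> D T' NAT"
        then show "(T' \<tturnstile> open_fm 0 n A) \<and> (T' \<tturnstile> \<alpha> \<^bold>< r (y \<cdot> n)) \<or> (T' \<tturnstile> open_fm 0 n B)"
          using AB(5) far[OF exts_trans[OF T]] by blast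
      qed
    qed
    then show ?thesis ..
  qed
qed

text \<open>With \<open>t = \<beta> - r (xs n)\<close>, cotransitivity of \<open>0 < 1\<close> at
  each multiple \<open>k t\<close> gives \<open>t > 0\<close> or \<open>k t < 1\<close>. Omniscience
  then yields \<open>t > 0\<close>, or \<open>k t < 1\<close> for all \<open>k\<close>, and by the
  Archimedean property the latter refutes \<open>t > 0\<close> in every extension.\<close>

lemma less_or_not_less:
  assumes lpo and T: "T \<in> exts T0" and n: "n \<in> D T NAT"
  shows "(T \<tturnstile> r (xs \<cdot> n) \<^bold>< \<beta>) \<or> not_less T n"
proof -
  let ?q = "r (xs \<cdot> n)"
  define t where "t = \<beta> \<^bold>+ (\<^bold>- ?q)"
  have q: "?q \<in> D T REAL" using q_D[OF T n] .
  have t: "t \<in> D T REAL" using q \<beta>_D[OF T] by (simp add: t_def)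
  \<comment> \<open>\<open>?A\<close> does not mention \<open>k\<close>: a single success settles
    the question.\<close>
  let ?A = "?q \<^bold>< \<beta>" and ?B = "Cst OfNat \<cdot> Bv 0 \<^bold>* t \<^bold>< \<^bold>1"
  have A: "open_fm 0 k ?A = ?A" for k
    using D_open_tm[OF q] \<beta>_D[OF T] by simp
  have B: "open_fm 0 k ?B = (Cst OfNat \<cdot> k \<^bold>* t \<^bold>< \<^bold>1)" for k using t by simp
  have "(\<exists>k \<in> D T NAT. T \<tturnstile> open_fm 0 k ?A) \<or> (\<forall>T' \<in> exts T. \<forall>k \<in> D T' NAT. T' \<tturnstile> open_fm 0 k ?B)"
  proof (rule lpoD[OF assms(1) T])
    show "wff [NAT] ?A" "fv ?A \<subseteq> lang T"
      using D_srt_of[OF q] D_fv_tm[OF q] \<beta>_D[OF T] by (simp_all del: srt_of.simps)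
    show "wff [NAT] ?B" "fv ?B \<subseteq> lang T" using t by simp_all
    fix T' k assume T': "T' \<in> exts T" and k: "k \<in> D T' NAT"
    have one: "T' \<tturnstile> \<^bold>0 \<^bold>< \<^bold>1" by (simp add: forces_def Form_simps zero_less_one)
    have "Cst OfNat \<cdot> k \<^bold>* t \<in> D T' REAL" using k D_mono[OF t T'] by simp
    from forces_less_cotrans[OF extsD[OF T'] one this]
    show "(T' \<tturnstile> open_fm 0 k ?A) \<or> (T' \<tturnstile> open_fm 0 k ?B)"
      unfolding A B
      using forces_of_nat_rmul_pos[OF extsD[OF T'] k D_mono[OF t T']]
        forces_diff_pos[OF D_mono[OF q T'] \<beta>_D[OF exts_trans[OF T T']]] unfolding t_def by blast
  qed
  then show ?thesis
  proof
    assume "\<exists>k \<in> D T NAT. T \<tturnstile> open_fm 0 k ?A"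
    then show ?thesis unfolding A by blast
  next
    assume *: "\<forall>T' \<in> exts T. \<forall>k \<in> D T' NAT. T' \<tturnstile> open_fm 0 k ?B"
    have "\<not> (T' \<tturnstile> ?q \<^bold>< \<beta>)" if T': "T' \<in> exts T" for T'
    proof
      assume "T' \<tturnstile> ?q \<^bold>< \<beta>"
      then have "T' \<tturnstile> \<^bold>0 \<^bold>< t"
        unfolding t_def using forces_diff_pos[OF D_mono[OF q T'] \<beta>_D[OF exts_trans[OF T T']]] by blast
      then obtain k where "k \<in> D T' NAT" "T' \<tturnstile> \<^bold>1 \<^bold>< Cst OfNat \<cdot> k \<^bold>* t"
        using forces_archimedean_rmul[OF extsD[OF T']] by blast
      then show False using * T' forces_less_asym[OF extsD[OF T']] unfolding B by blast
    qed
    then show ?thesis by (simp add: not_less_def)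
  qed
qed

lemma forces_not_less:
  assumes "T \<in> exts T0" "n \<in> D T NAT"
  shows "(T \<tturnstile> \<^bold>\<not> (r (xs \<cdot> n) \<^bold>< \<beta>)) \<longleftrightarrow> not_less T n"
  using q_D[OF assms] \<beta>_D[OF assms(1)] forces_bot[OF extsD]
  unfolding forces_imp[OF extsD[OF assms(1)]] not_less_def by (auto simp: Form_simps(2,3))

lemma finally_or_infinitely_often:
  "(\<exists>N \<in> D T0 NAT. finally_less T0 N) \<or>
   (\<forall>T \<in> exts T0. \<forall>N \<in> D T NAT. \<exists>n \<in> D T NAT. (T \<tturnstile> N \<preceq> n) \<and> not_less T n)"
  using finally_less_or_lpo
proof
  assume lpo: lpo
  note W = extsD
  let ?q = "\<rho> \<cdot> (f \<cdot> (xs \<cdot> Bv 0)) \<cdot> (f \<cdot> a)"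
  define I where "I T N \<longleftrightarrow> (\<exists>n \<in> D T NAT. (T \<tturnstile> N \<preceq> n) \<and> not_less T n)" for T N
  have I_or_less: "I T N \<or> finally_less T N" if T: "T \<in> exts T0" and N: "N \<in> D T NAT" for T N
  proof -
    let ?A = "Ex NAT (Bv 1 \<^bold>= N \<^bold>+\<^sub>N Bv 0) \<^bold>\<and> \<^bold>\<not> (?q \<^bold>< \<beta>)"
    let ?B = "Ex NAT (Bv 1 \<^bold>= N \<^bold>+\<^sub>N Bv 0) \<^bold>\<longrightarrow> ?q \<^bold>< \<beta>"
    note P = params_D[OF T]
    have A: "open_fm 0 n ?A = (N \<preceq> n \<^bold>\<and> \<^bold>\<not> (r (xs \<cdot> n) \<^bold>< \<beta>))" for n using N P by simp
    have B: "open_fm 0 n ?B = (N \<preceq> n \<^bold>\<longrightarrow> r (xs \<cdot> n) \<^bold>< \<beta>)" for n using N P by simp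
    have semB: "(T' \<tturnstile> open_fm 0 n ?B) \<longleftrightarrow>
        (\<forall>T'' \<in> exts T'. (T'' \<tturnstile> N \<preceq> n) \<longrightarrow> (T'' \<tturnstile> r (xs \<cdot> n) \<^bold>< \<beta>))"
      if T': "T' \<in> exts T" and n: "n \<in> D T' NAT" for T' n
      unfolding B forces_imp[OF W[OF T']]
      using q_D[OF exts_trans[OF T T'] n] \<beta>_D[OF exts_trans[OF T T']] n D_mono[OF N T']
      by (simp add: Form_simps(2,8))
    have "(\<exists>n \<in> D T NAT. T \<tturnstile> open_fm 0 n ?A) \<or> (\<forall>T' \<in> exts T. \<forall>n \<in> D T' NAT. T' \<tturnstile> open_fm 0 n ?B)"
    proof (rule lpoD[OF lpo T])
      show "wff [NAT] ?A" "fv ?A \<subseteq> lang T" "wff [NAT] ?B" "fv ?B \<subseteq> lang T"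
        using N P by simp_all
      fix T' n assume T': "T' \<in> exts T" and n: "n \<in> D T' NAT"
      have T'0: "T' \<in> exts T0" using exts_trans[OF T T'] .
      consider (0) "T' \<tturnstile> r (xs \<cdot> n) \<^bold>< \<beta>" | (1) "not_less T' n" "T' \<tturnstile> N \<preceq> n"
        | (2) "T' \<tturnstile> Cst NSuc \<cdot> n \<preceq> N"
        using less_or_not_less[OF lpo T'0 n] nle_linear[OF W[OF T'] D_mono[OF N T'] n] by blast
      then show "(T' \<tturnstile> open_fm 0 n ?A) \<or> (T' \<tturnstile> open_fm 0 n ?B)"
      proof cases
        case 0
        then show ?thesis using semB[OF T' n] forces_mono by blast
      next
        case 1
        then show ?thesis unfolding A forces_conj forces_not_less[OF T'0 n] by blast
      next
        case 2
        have "\<not> (T'' \<tturnstile> N \<preceq> n)" if T'': "T'' \<in> exts T'" for T''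
        proof
          assume "T'' \<tturnstile> N \<preceq> n"
          then have "T'' \<tturnstile> Cst NSuc \<cdot> n \<preceq> n"
            using nle_trans[OF W[OF T''], of "Cst NSuc \<cdot> n" N n] forces_mono[OF 2 T'']
              D_mono[OF n T''] D_mono[OF D_mono[OF N T'] T''] by simp
          then show False using not_suc_nle_self[OF W[OF T''] D_mono[OF n T'']] by blast
        qed
        then show ?thesis using semB[OF T' n] by blast
      qed
    qed
    then show ?thesis
    proof
      assume "\<exists>n \<in> D T NAT. T \<tturnstile> open_fm 0 n ?A"
      then show ?thesis unfolding A forces_conj I_def using forces_not_less[OF T] by blast
    next
      assume "\<forall>T' \<in> exts T. \<forall>n \<in> D T' NAT. T' \<tturnstile> open_fm 0 n ?B"
      then have "finally_less T N" unfolding finally_less_def using semB world_exts W by blast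
      then show ?thesis by blast
    qed
  qed
  let ?A = "All NAT (Ex NAT (Bv 1 \<^bold>= Bv 2 \<^bold>+\<^sub>N Bv 0) \<^bold>\<longrightarrow> ?q \<^bold>< \<beta>)"
  let ?B = "Ex NAT (Ex NAT (Bv 1 \<^bold>= Bv 2 \<^bold>+\<^sub>N Bv 0) \<^bold>\<and> \<^bold>\<not> (?q \<^bold>< \<beta>))"
  have semA: "(T \<tturnstile> open_fm 0 N ?A) \<longleftrightarrow> finally_less T N" if "T \<in> exts T0" "N \<in> D T NAT" for T N
    using that params_D[OF that(1)]
    by (simp add: forces_all_imp[OF W[OF that(1)]] finally_less_def eval_nat_numeral)
  have semB: "(T \<tturnstile> open_fm 0 N ?B) \<longleftrightarrow> I T N" if "T \<in> exts T0" "N \<in> D T NAT" for T N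
    using that params_D[OF that(1)] forces_not_less[OF that(1)]
    by (simp add: forces_ex[OF W[OF that(1)]] forces_conj I_def eval_nat_numeral)
  have T00: "T0 \<in> exts T0" using world_exts[OF world0] .
  \<comment> \<open>The search is now for the bound \<open>N\<close> itself; the alternatives at
    each \<open>N\<close> are those of \<open>I_or_less\<close>.\<close>
  have "(\<exists>N \<in> D T0 NAT. T0 \<tturnstile> open_fm 0 N ?A) \<or> (\<forall>T \<in> exts T0. \<forall>N \<in> D T NAT. T \<tturnstile> open_fm 0 N ?B)"
  proof (rule lpoD[OF lpo T00])
    show "wff [NAT] ?A" "fv ?A \<subseteq> lang T0" "wff [NAT] ?B" "fv ?B \<subseteq> lang T0"
      using params_D[OF T00] by (simp_all add: eval_nat_numeral)
  qed (use semA semB I_or_less in blast)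
  then show ?thesis using semA[OF T00] semB unfolding I_def by blast
qed blast

end

section \<open>The dichotomy as a forced formula\<close>

text \<open>Besides the extension, the rule hands on that it is a world and that the instance
  belongs to its language, so nested binders can be stripped by resolution alone.\<close>

lemma forces_allI:
  assumes "world T" "All s A \<in> Form T"
    and "\<And>T' t. T' \<in> exts T \<Longrightarrow> world T' \<Longrightarrow> t \<in> D T' s \<Longrightarrow> open_fm 0 t A \<in> Form T' \<Longrightarrow>
      T' \<tturnstile> open_fm 0 t A"
  shows "T \<tturnstile> All s A"
  unfolding forces_all[OF assms(1)]
proof (intro HOL.conjI ballI)
  fix T' t assume T': "T' \<in> exts T" and t: "t \<in> D T' s"
  have "open_fm 0 t A \<in> Form T'"
    using assms(2) lang_mono[OF T'] by (intro Form_open[OF _ _ t]) (auto simp: Form_simps)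
  then show "T' \<tturnstile> open_fm 0 t A" using assms(3) T' extsD[OF T'] t by blast
qed (use assms(2) in \<open>simp_all add: Form_simps\<close>)

lemma forces_impI:
  assumes "world T" "(A \<^bold>\<longrightarrow> B) \<in> Form T"
    and "\<And>T'. T' \<in> exts T \<Longrightarrow> world T' \<Longrightarrow> T' \<tturnstile> A \<Longrightarrow> B \<in> Form T' \<Longrightarrow> T' \<tturnstile> B"
  shows "T \<tturnstile> A \<^bold>\<longrightarrow> B"
  unfolding forces_imp[OF assms(1)]
  using assms(2,3) Form_mono extsD by (auto simp: Form_simps(6))

text \<open>The formula is \<open>converges d s l\<close> with its named binders computed away. The
  first index 2 refers to \<open>N\<close>, since it stands under the inner existential quantifier,
  and the last one to \<open>e\<close>.\<close>

lemma forces_converges: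
  assumes W: "world T" and d: "d \<in> D T (FUN X (FUN X REAL))" and s: "s \<in> D T (FUN NAT X)" and l: "l \<in> D T X"
  shows "(T \<tturnstile> All REAL (\<^bold>0 \<^bold>< Bv 0 \<^bold>\<longrightarrow> Ex NAT (All NAT
      (Ex NAT (Bv 1 \<^bold>= Bv 2 \<^bold>+\<^sub>N Bv 0) \<^bold>\<longrightarrow> d \<cdot> (s \<cdot> Bv 0) \<cdot> l \<^bold>< Bv 2)))) \<longleftrightarrow> converges_in d T s l"
proof -
  let ?B = "\<lambda>e. Ex NAT (All NAT (Ex NAT (Bv 1 \<^bold>= Bv 2 \<^bold>+\<^sub>N Bv 0) \<^bold>\<longrightarrow> d \<cdot> (s \<cdot> Bv 0) \<cdot> l \<^bold>< e))"
  have inner: "(T1 \<tturnstile> ?B e) \<longleftrightarrow> (\<exists>N \<in> D T1 NAT. \<forall>T2 \<in> exts T1. \<forall>n \<in> D T2 NAT.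
      (T2 \<tturnstile> N \<preceq> n) \<longrightarrow> (T2 \<tturnstile> d \<cdot> (s \<cdot> n) \<cdot> l \<^bold>< e))"
    if "T1 \<in> exts T" "e \<in> D T1 REAL" for T1 e
    using that D_mono[OF d that(1)] D_mono[OF s that(1)] D_mono[OF l that(1)]
    by (simp add: forces_ex[OF extsD[OF that(1)]] forces_all_imp[OF extsD[OF that(1)]] eval_nat_numeral)
  have outer: "(T \<tturnstile> All REAL (\<^bold>0 \<^bold>< Bv 0 \<^bold>\<longrightarrow> ?B (Bv 2))) \<longleftrightarrow>
      (\<forall>T1 \<in> exts T. \<forall>e \<in> D T1 REAL. (T1 \<tturnstile> \<^bold>0 \<^bold>< e) \<longrightarrow> (T1 \<tturnstile> ?B e))"
    using d s l by (simp add: forces_all_imp[OF W] eval_nat_numeral)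
  show ?thesis
    unfolding outer converges_in_def using inner forces_less_D by blast
qed

lemma forces_cauchy:
  assumes W: "world T" and d: "d \<in> D T (FUN X (FUN X REAL))" and s: "s \<in> D T (FUN NAT X)"
    and cauchy: "cauchy_in d T s"
  shows "T \<tturnstile> All REAL (\<^bold>0 \<^bold>< Bv 0 \<^bold>\<longrightarrow> Ex NAT (All NAT (All NAT
      (Ex NAT (Bv 2 \<^bold>= Bv 3 \<^bold>+\<^sub>N Bv 0) \<^bold>\<and> Ex NAT (Bv 1 \<^bold>= Bv 3 \<^bold>+\<^sub>N Bv 0) \<^bold>\<longrightarrow>
        d \<cdot> (s \<cdot> Bv 1) \<cdot> (s \<cdot> Bv 0) \<^bold>< Bv 3))))"
proof -
  let ?P = "\<lambda>N m e. All NAT (N \<preceq> m \<^bold>\<and> Ex NAT (Bv 1 \<^bold>= N \<^bold>+\<^sub>N Bv 0) \<^bold>\<longrightarrow> d \<cdot> (s \<cdot> m) \<cdot> (s \<cdot> Bv 0) \<^bold>< e)"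
  let ?B = "\<lambda>e. Ex NAT (All NAT (All NAT
      (Ex NAT (Bv 2 \<^bold>= Bv 3 \<^bold>+\<^sub>N Bv 0) \<^bold>\<and> Ex NAT (Bv 1 \<^bold>= Bv 3 \<^bold>+\<^sub>N Bv 0) \<^bold>\<longrightarrow>
        d \<cdot> (s \<cdot> Bv 1) \<cdot> (s \<cdot> Bv 0) \<^bold>< e)))"
  have P: "(T2 \<tturnstile> ?P N m e) \<longleftrightarrow> (\<forall>T3 \<in> exts T2. \<forall>n \<in> D T3 NAT.
      (T3 \<tturnstile> N \<preceq> m) \<and> (T3 \<tturnstile> N \<preceq> n) \<longrightarrow> (T3 \<tturnstile> d \<cdot> (s \<cdot> m) \<cdot> (s \<cdot> n) \<^bold>< e))"
    if "T2 \<in> exts T" "N \<in> D T2 NAT" "m \<in> D T2 NAT" "e \<in> D T2 REAL" for T2 N m e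
    using that D_mono[OF d that(1)] D_mono[OF s that(1)]
    by (simp add: forces_all_imp[OF extsD[OF that(1)]] forces_conj)
  have B: "(T1 \<tturnstile> ?B e) \<longleftrightarrow> (\<exists>N \<in> D T1 NAT. \<forall>T2 \<in> exts T1. \<forall>m \<in> D T2 NAT. T2 \<tturnstile> ?P N m e)"
    if "T1 \<in> exts T" "e \<in> D T1 REAL" for T1 e
    using that D_mono[OF d that(1)] D_mono[OF s that(1)]
    by (simp add: forces_ex[OF extsD[OF that(1)]] forces_all[OF extsD[OF that(1)]] eval_nat_numeral)
  have outer: "(T \<tturnstile> All REAL (\<^bold>0 \<^bold>< Bv 0 \<^bold>\<longrightarrow> ?B (Bv 3))) \<longleftrightarrow>
      (\<forall>T1 \<in> exts T. \<forall>e \<in> D T1 REAL. (T1 \<tturnstile> \<^bold>0 \<^bold>< e) \<longrightarrow> (T1 \<tturnstile> ?B e))"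
    using d s by (simp add: forces_all_imp[OF W] eval_nat_numeral)
  show ?thesis
    unfolding outer
  proof (intro ballI HOL.impI)
    fix T1 e assume T1: "T1 \<in> exts T" and e: "e \<in> D T1 REAL" "T1 \<tturnstile> \<^bold>0 \<^bold>< e"
    obtain N where N: "N \<in> D T1 NAT" "\<forall>T2 \<in> exts T1. \<forall>m \<in> D T2 NAT. \<forall>n \<in> D T2 NAT.
        (T2 \<tturnstile> N \<preceq> m) \<longrightarrow> (T2 \<tturnstile> N \<preceq> n) \<longrightarrow> (T2 \<tturnstile> d \<cdot> (s \<cdot> m) \<cdot> (s \<cdot> n) \<^bold>< e)"
      using cauchy T1 e(2) unfolding cauchy_in_def by meson
    have "T2 \<tturnstile> ?P N m e" if T2: "T2 \<in> exts T1" and m: "m \<in> D T2 NAT" for T2 m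
      unfolding P[OF exts_trans[OF T1 T2] D_mono[OF N(1) T2] m D_mono[OF e(1) T2]]
      using N(2) exts_trans[OF T2] D_mono[OF m] by blast
    then show "T1 \<tturnstile> ?B e" unfolding B[OF T1 e(1)] using N(1) by blast
  qed
qed

lemma forces_complete:
  assumes W: "world T" and d: "d \<in> D T (FUN X (FUN X REAL))"
    and complete: "T \<tturnstile> All (FUN NAT X)
      (All REAL (\<^bold>0 \<^bold>< Bv 0 \<^bold>\<longrightarrow> Ex NAT (All NAT (All NAT
        (Ex NAT (Bv 2 \<^bold>= Bv 3 \<^bold>+\<^sub>N Bv 0) \<^bold>\<and> Ex NAT (Bv 1 \<^bold>= Bv 3 \<^bold>+\<^sub>N Bv 0) \<^bold>\<longrightarrow>
          d \<cdot> (Bv 4 \<cdot> Bv 1) \<cdot> (Bv 4 \<cdot> Bv 0) \<^bold>< Bv 3)))) \<^bold>\<longrightarrow>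
       Ex X (All REAL (\<^bold>0 \<^bold>< Bv 0 \<^bold>\<longrightarrow> Ex NAT (All NAT
         (Ex NAT (Bv 1 \<^bold>= Bv 2 \<^bold>+\<^sub>N Bv 0) \<^bold>\<longrightarrow> d \<cdot> (Bv 4 \<cdot> Bv 0) \<cdot> Bv 3 \<^bold>< Bv 2)))))"
    and T': "T' \<in> exts T" and s: "s \<in> D T' (FUN NAT X)" and cauchy: "cauchy_in d T' s"
  shows "\<exists>l \<in> D T' X. converges_in d T' s l"
proof -
  have W': "world T'" using extsD[OF T'] .
  have d': "d \<in> D T' (FUN X (FUN X REAL))" using D_mono[OF d T'] .
  let ?conv = "\<lambda>l. All REAL (\<^bold>0 \<^bold>< Bv 0 \<^bold>\<longrightarrow> Ex NAT (All NAT
         (Ex NAT (Bv 1 \<^bold>= Bv 2 \<^bold>+\<^sub>N Bv 0) \<^bold>\<longrightarrow> d \<cdot> (s \<cdot> Bv 0) \<cdot> l \<^bold>< Bv 2)))"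
  have "T' \<tturnstile> Ex X (?conv (Bv 3))"
    using complete T' s d d' forces_cauchy[OF W' d' s cauchy]
    by (simp add: forces_all_imp[OF W] eval_nat_numeral)
  then obtain l where l: "l \<in> D T' X" "T' \<tturnstile> ?conv l"
    using d' s by (auto simp: forces_ex[OF W'] eval_nat_numeral)
  then show ?thesis using forces_converges[OF W' d' s l(1)] by blast
qed

text \<open>The premises are the hypotheses of the theorem in raw indices, gathered at one world.
  They instantiate the locale there, and its semantic dichotomy is read back as a formula.\<close>

lemma forces_dichotomy:
  assumes W: "world T" and \<sigma>: "\<sigma> \<in> D T (FUN X (FUN X REAL))" and \<rho>: "\<rho> \<in> D T (FUN Y (FUN Y REAL))"
    and f: "f \<in> D T (FUN X Y)" and xs: "xs \<in> D T (FUN NAT X)" and a: "a \<in> D T X"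
    and \<beta>: "T \<tturnstile> \<^bold>0 \<^bold>< \<beta>"
    and nonneg: "T \<tturnstile> All X (All X (\<^bold>\<not> (\<sigma> \<cdot> Bv 1 \<cdot> Bv 0 \<^bold>< \<^bold>0)))"
    and self: "T \<tturnstile> All X (\<sigma> \<cdot> Bv 0 \<cdot> Bv 0 \<^bold>= \<^bold>0)"
    and identity: "T \<tturnstile> All X (All X (\<sigma> \<cdot> Bv 1 \<cdot> Bv 0 \<^bold>= \<^bold>0 \<^bold>\<longrightarrow> Bv 1 \<^bold>= Bv 0))"
    and symmetric: "T \<tturnstile> All X (All X (\<sigma> \<cdot> Bv 1 \<cdot> Bv 0 \<^bold>= \<sigma> \<cdot> Bv 0 \<cdot> Bv 1))"
    and complete: "T \<tturnstile> All (FUN NAT X)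
      (All REAL (\<^bold>0 \<^bold>< Bv 0 \<^bold>\<longrightarrow> Ex NAT (All NAT (All NAT
        (Ex NAT (Bv 2 \<^bold>= Bv 3 \<^bold>+\<^sub>N Bv 0) \<^bold>\<and> Ex NAT (Bv 1 \<^bold>= Bv 3 \<^bold>+\<^sub>N Bv 0) \<^bold>\<longrightarrow>
          \<sigma> \<cdot> (Bv 4 \<cdot> Bv 1) \<cdot> (Bv 4 \<cdot> Bv 0) \<^bold>< Bv 3)))) \<^bold>\<longrightarrow>
       Ex X (All REAL (\<^bold>0 \<^bold>< Bv 0 \<^bold>\<longrightarrow> Ex NAT (All NAT
         (Ex NAT (Bv 1 \<^bold>= Bv 2 \<^bold>+\<^sub>N Bv 0) \<^bold>\<longrightarrow> \<sigma> \<cdot> (Bv 4 \<cdot> Bv 0) \<cdot> Bv 3 \<^bold>< Bv 2)))))"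
    and strong_ext: "T \<tturnstile> All X (All X (\<^bold>0 \<^bold>< \<rho> \<cdot> (f \<cdot> Bv 1) \<cdot> (f \<cdot> Bv 0) \<^bold>\<longrightarrow> \<^bold>0 \<^bold>< \<sigma> \<cdot> Bv 1 \<cdot> Bv 0))"
    and conv: "T \<tturnstile> All REAL (\<^bold>0 \<^bold>< Bv 0 \<^bold>\<longrightarrow> Ex NAT (All NAT
      (Ex NAT (Bv 1 \<^bold>= Bv 2 \<^bold>+\<^sub>N Bv 0) \<^bold>\<longrightarrow> \<sigma> \<cdot> (xs \<cdot> Bv 0) \<cdot> a \<^bold>< Bv 2)))"
  shows "T \<tturnstile>
    Ex NAT (All NAT (Ex NAT (Bv 1 \<^bold>= Bv 2 \<^bold>+\<^sub>N Bv 0) \<^bold>\<longrightarrow>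
      \<rho> \<cdot> (f \<cdot> (xs \<cdot> Bv 0)) \<cdot> (f \<cdot> a) \<^bold>< \<beta>)) \<^bold>\<or>
    All NAT (Ex NAT (Ex NAT (Bv 1 \<^bold>= Bv 2 \<^bold>+\<^sub>N Bv 0) \<^bold>\<and>
      \<^bold>\<not> (\<rho> \<cdot> (f \<cdot> (xs \<cdot> Bv 0)) \<cdot> (f \<cdot> a) \<^bold>< \<beta>)))"
proof -
  have inst: "T' \<tturnstile> open_fm 0 y (open_fm 1 x A)" if all: "T \<tturnstile> All X (All X A)"
    and "T' \<in> exts T" "x \<in> D T' X" "y \<in> D T' X" for T' x y A
  proof -
    have "T' \<tturnstile> All X (open_fm 1 x A)" using all that(2,3) by (simp add: forces_all[OF W])
    then show ?thesis
      using that(2,4) world_exts[OF extsD[OF that(2)]] by (simp add: forces_all[OF extsD[OF that(2)]])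
  qed
  have mp: "T' \<tturnstile> B" if "T' \<tturnstile> A \<^bold>\<longrightarrow> B" "T' \<tturnstile> A" "T' \<in> exts T" for T' A B
    using that forces_imp[OF extsD[OF that(3)]] world_exts[OF extsD[OF that(3)]] by blast
  have closed: "open_tm k u \<sigma> = \<sigma>" "open_tm k u \<rho> = \<rho>" "open_tm k u f = f" for k u
    using \<sigma> \<rho> f by simp_all
  interpret convergent_sequence X Y \<sigma> \<rho> f a T xs \<beta>
  proof
    fix T' x y assume T': "T' \<in> exts T" and x: "x \<in> D T' X" and y: "y \<in> D T' X"
    note inst = inst[OF _ T' x y] and cl = closed D_open_tm[OF x]
    show "\<not> (T' \<tturnstile> \<sigma> \<cdot> x \<cdot> y \<^bold>< \<^bold>0)"
      using inst[OF nonneg] mp[OF _ _ T'] forces_bot[OF extsD[OF T']] by (auto simp: cl)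
    show "T' \<tturnstile> \<sigma> \<cdot> x \<cdot> y \<^bold>= \<sigma> \<cdot> y \<cdot> x" using inst[OF symmetric] by (simp add: cl)
    show "T' \<tturnstile> x \<^bold>= y" if "T' \<tturnstile> \<sigma> \<cdot> x \<cdot> y \<^bold>= \<^bold>0"
      using inst[OF identity] mp[OF _ that T'] by (simp add: cl)
    show "T' \<tturnstile> \<^bold>0 \<^bold>< \<sigma> \<cdot> x \<cdot> y" if "T' \<tturnstile> \<^bold>0 \<^bold>< \<rho> \<cdot> (f \<cdot> x) \<cdot> (f \<cdot> y)"
      using inst[OF strong_ext] mp[OF _ that T'] by (simp add: cl)
  next
    fix T' x assume "T' \<in> exts T" "x \<in> D T' X"
    then show "T' \<tturnstile> \<sigma> \<cdot> x \<cdot> x \<^bold>= \<^bold>0" using self by (simp add: forces_all[OF W] closed)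
  next
    fix T' s assume "T' \<in> exts T" "s \<in> D T' (FUN NAT X)" "cauchy_in \<sigma> T' s"
    then show "\<exists>l \<in> D T' X. converges_in \<sigma> T' s l" by (rule forces_complete[OF W \<sigma> complete])
  next
    show "converges_in \<sigma> T xs a" using conv forces_converges[OF W \<sigma> xs a] by blast
  qed (use assms in simp_all)
  let ?q = "\<rho> \<cdot> (f \<cdot> (xs \<cdot> Bv 0)) \<cdot> (f \<cdot> a)"
  have TT: "T \<in> exts T" using world_exts[OF W] .
  let ?E = "All NAT (Ex NAT (Bv 1 \<^bold>= Bv 2 \<^bold>+\<^sub>N Bv 0) \<^bold>\<longrightarrow> ?q \<^bold>< \<beta>)"
  let ?I = "Ex NAT (Ex NAT (Bv 1 \<^bold>= Bv 2 \<^bold>+\<^sub>N Bv 0) \<^bold>\<and> \<^bold>\<not> (?q \<^bold>< \<beta>))"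
  note D = \<rho> f xs a \<beta>_D[OF TT]
  have E: "(T \<tturnstile> open_fm 0 N ?E) \<longleftrightarrow> finally_less T N" if "N \<in> D T NAT" for N
    using that D by (simp add: forces_all_imp[OF W] finally_less_def eval_nat_numeral)
  have I: "(T' \<tturnstile> open_fm 0 N ?I) \<longleftrightarrow> (\<exists>n \<in> D T' NAT. (T' \<tturnstile> N \<preceq> n) \<and> not_less T' n)"
    if "T' \<in> exts T" "N \<in> D T' NAT" for T' N
    using that params_D[OF that(1)] forces_not_less[OF that(1)]
    by (simp add: forces_ex[OF extsD[OF that(1)]] forces_conj eval_nat_numeral)
  have wf: "wff [NAT] ?E" "fv ?E \<subseteq> lang T" "wff [NAT] ?I" "fv ?I \<subseteq> lang T"
    using D by (simp_all add: eval_nat_numeral)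
  show ?thesis
    unfolding forces_disj[OF W] Form_simps(7,8) forces_ex[OF W, of _ ?E] forces_all[OF W, of _ ?I]
    using wf finally_or_infinitely_often E I by blast
qed

theorem proposition3p3:
  fixes X Y :: srt and \<sigma> \<rho> f xs a \<beta> n :: var
  assumes "\<sigma> = (''sigma'', FUN X (FUN X REAL))"
    and "\<rho> = (''rho'', FUN Y (FUN Y REAL))"
    and "f = (''f'', FUN X Y)"
    and "xs = (''xs'', FUN NAT X)"
    and "a = (''a'', X)"
    and "\<beta> = (''beta'', REAL)"
    and "n = (''n'', NAT)"
  shows "{} \<turnstile>
    (\<^bold>\<forall>\<sigma>. \<^bold>\<forall>\<rho>. metric X (Fv \<sigma>) \<^bold>\<and> complete X (Fv \<sigma>) \<^bold>\<and> metric Y (Fv \<rho>) \<^bold>\<longrightarrow>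
      (\<^bold>\<forall>f. strongly_extensional X (Fv \<sigma>) (Fv \<rho>) (Fv f) \<^bold>\<longrightarrow>
        (\<^bold>\<forall>xs. \<^bold>\<forall>a. converges (Fv \<sigma>) (Fv xs) (Fv a) \<^bold>\<longrightarrow>
          (\<^bold>\<forall>\<beta>. \<^bold>0 \<^bold>< Fv \<beta> \<^bold>\<longrightarrow>
            eventually_fm n
              (Fv \<rho> \<cdot> (Fv f \<cdot> (Fv xs \<cdot> Fv n)) \<cdot> (Fv f \<cdot> Fv a) \<^bold>< Fv \<beta>) \<^bold>\<or>
            infinitely_often_fm n
              (Fv \<beta> \<^bold>\<le> Fv \<rho> \<cdot> (Fv f \<cdot> (Fv xs \<cdot> Fv n)) \<cdot> (Fv f \<cdot> Fv a))))))"
  unfolding assms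
  \<comment> \<open>Computing the named binders leaves the raw indices in which the Kripke lemmas
    are stated.\<close>
  apply (simp add: all_fm_def ex_fm_def metric_def complete_def cauchy_def converges_def
    strongly_extensional_def eventually_fm_def infinitely_often_fm_def nle_fm_def le_fm_def Let_def)
  apply (rule kripke_complete)
   apply (simp add: Fm_def)
  \<comment> \<open>Each quantifier and each implication passes to a further extension.\<close>
  apply (rule forces_allI, assumption, assumption, simp)
  apply (rule forces_allI, assumption, assumption, simp)
  apply (rule forces_impI, assumption, assumption)
  apply (rule forces_allI, assumption, assumption, simp)
  apply (rule forces_impI, assumption, assumption)
  apply (rule forces_allI, assumption, assumption, simp)
  apply (rule forces_allI, assumption, assumption, simp)
  apply (rule forces_impI, assumption, assumption)
  apply (rule forces_allI, assumption, assumption, simp)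
  apply (rule forces_impI, assumption, assumption)
  \<comment> \<open>Every hypothesis is forced at the world where it was introduced; monotonicity
    carries all of them, and all parameters, to the last world \<open>U\<close>.\<close>
  subgoal premises prems for T T1 \<sigma> T2 \<rho> T3 T4 f T5 T6 xs T7 a T8 T9 \<beta> U
  proof -
    have ext: "U \<in> exts T8" "U \<in> exts T7" "U \<in> exts T6" "U \<in> exts T5" "U \<in> exts T4"
        "U \<in> exts T3" "U \<in> exts T2" "U \<in> exts T1"
      using prems(7,11,15,19,23,27,31,35,39) exts_trans by meson+
    note M = forces_mono[OF prems(13) ext(6), unfolded forces_conj]
    show ?thesis
      using forces_dichotomy[OF prems(40) D_mono[OF prems(5) ext(8)] D_mono[OF prems(9) ext(7)]
          D_mono[OF prems(17) ext(5)] D_mono[OF prems(25) ext(3)] D_mono[OF prems(29) ext(2)] prems(41)]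
        M forces_mono[OF prems(21) ext(4)] forces_mono[OF prems(33) ext(1)]
      by (simp add: eval_nat_numeral)
  qed
  done

end
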